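(* Let $n\ge 1$, let $\sigma=(\sigma_1,\dots,\sigma_n)\in\mathbb{R}^n$ with $\sigma_j>0$ for $j=1,\dots,n$, let $1\le p<\infty$, and let $f\in B^p_{Q^n_\sigma}$. Then $$ f(z)=\sum_{u\in(2\pi/\sigma)\mathbb{Z}^n}\biggl(\sum_{k\in E^n}P_{f,k,u}(z-u)\biggr)\,\mathrm{sinc}_n^2\Bigl(\frac{1}{2\pi}\,\sigma(z-u)\Bigr),\qquad z\in\mathbb{C}^n . $$ Moreover, the series over $u\in(2\pi/\sigma)\mathbb{Z}^n$ converges absolutely and uniformly on $\mathbb{R}^n$ and also on any compact subset of $\mathbb{C}^n$.
   Context: For $a,b\in\mathbb{C}^n$ and $\tau\in\mathbb{C}$, write $\tau a=(\tau a_1,\dots,\tau a_n)$ and $ab=(a_1b_1,\dots,a_nb_n)$ (componentwise product). For $\sigma\in\mathbb{R}^n$ with all $\sigma_j>0$, $(2\pi/\sigma)\mathbb{Z}^n$ denotes the lattice $\{(2\pi m_1/\sigma_1,\dots,2\pi m_n/\sigma_n): m\in\mathbb{Z}^n\}$. The Fourier transform of $f\in L^1(\mathbb{R}^n)$ is $\widehat f(t)=\int_{\mathbb{R}^n}e^{-i\langle x,t\rangle}f(x)\,dx$; for $f\notin L^1(\mathbb{R}^n)$ it is understood in the sense of tempered distributions. Let $Q^n_\sigma=\{x\in\mathbb{R}^n: |x_j|\le\sigma_j,\ j=1,\dots,n\}$ and, for $1\le p\le\infty$, $B^p_{Q^n_\sigma}=\{f\in L^p(\mathbb{R}^n): \operatorname{supp}\widehat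 f\subset Q^n_\sigma\}$. By the Paley-Wiener-Schwartz theorem each $f\in B^p_{Q^n_\sigma}$ is (a.e. equal to) an infinitely differentiable function on $\mathbb{R}^n$ which extends to an entire function on $\mathbb{C}^n$; $f$ is identified with this entire function. $\mathrm{sinc}_n(z)=\prod_{j=1}^n\frac{\sin\pi z_j}{\pi z_j}$ for $z\in\mathbb{C}^n$ (each factor taken equal to $1$ at $z_j=0$), and $\mathrm{sinc}_n^2$ is its square. $E^n=\{(t_1,\dots,t_n): t_j\in\{0,1\},\ j=1,\dots,n\}$. For $k\in\mathbb{Z}^n$ with all $k_j\ge0$, $\partial^k_z=\frac{\partial^{k_1+\dots+k_n}}{\partial z_1^{k_1}\cdots\partial z_n^{k_n}}$ (with $\partial^k_z f=f$ if $k=0$). For $k\in E^n$ and a point $u$ of the lattice $(2\pi/\sigma)\mathbb{Z}^n$, $P_{f,k,u}$ is the polynomial in $\lambda\in\mathbb{C}^n$ given by $P_{f,k,u}(\lambda)=(\partial^k_z f)(u)\cdot\prod_{j=1}^n\lambda_j^{k_j}$. *)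

theory Defs
  imports "HOL-Analysis.Analysis"
begin

definition complex_vec :: "real^'n \<Rightarrow> complex^'n" where
  "complex_vec x = (\<chi> j. complex_of_real (x $ j))"

definition fourier :: "(real^'n \<Rightarrow> complex) \<Rightarrow> real^'n \<Rightarrow> complex" where
  "fourier f t = (LINT x|lebesgue. exp (- \<i> * complex_of_real (x \<bullet> t)) * f x)"

definition topological_support :: "('a::topological_space \<Rightarrow> complex) \<Rightarrow> 'a set" where
  "topological_support f = closure {x. f x \<noteq> 0}"

definition partial_real :: "'n \<Rightarrow> (real^'n \<Rightarrow> complex) \<Rightarrow> real^'n \<Rightarrow> complex" where
  "partial_real j \<phi> x = vector_derivative (\<lambda>s. \<phi> (x + s *\<^sub>R axis j 1)) (at 0)"

definition smooth :: "(real^'n \<Rightarrow> complex) \<Rightarrow> bool" where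
  "smooth \<phi> \<longleftrightarrow> (\<forall>js x. foldr partial_real js \<phi> differentiable (at x))"

definition test_functions :: "(real^'n) set \<Rightarrow> (real^'n \<Rightarrow> complex) set" where
  "test_functions U =
     {\<phi>. smooth \<phi> \<and> compact (topological_support \<phi>) \<and> topological_support \<phi> \<subseteq> U}"

definition distribution_support :: "((real^'n \<Rightarrow> complex) \<Rightarrow> complex) \<Rightarrow> (real^'n) set" where
  "distribution_support T = - \<Union>{U. open U \<and> (\<forall>\<phi>\<in>test_functions U. T \<phi> = 0)}"

text \<open>The Fourier transform of a tempered distribution is defined by duality; here for the
  distribution given by a function \<open>f\<close> (in some L^p).  Only its values on
  compactly supported test functions enter into its support.\<close>

definition fourier_distribution :: "(real^'n \<Rightarrow> complex) \<Rightarrow> (real^'n \<Rightarrow> complex) \<Rightarrow> complex" where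
  "fourier_distribution f \<phi> = (LINT x|lebesgue. f x * fourier \<phi> x)"

definition spectrum :: "(real^'n \<Rightarrow> complex) \<Rightarrow> (real^'n) set" where
  "spectrum f = (if integrable lebesgue f then topological_support (fourier f)
                 else distribution_support (fourier_distribution f))"

definition box_Q :: "real^'n \<Rightarrow> (real^'n) set" where
  "box_Q \<sigma> = {x. \<forall>j. \<bar>x $ j\<bar> \<le> \<sigma> $ j}"

definition L_space :: "real \<Rightarrow> (real^'n \<Rightarrow> complex) set" where
  "L_space p = {f \<in> borel_measurable lebesgue. integrable lebesgue (\<lambda>x. norm (f x) powr p)}"

definition bernstein_space :: "real \<Rightarrow> real^'n \<Rightarrow> (real^'n \<Rightarrow> complex) set" where
  "bernstein_space p \<sigma> = {f \<in> L_space p. spectrum f \<subseteq> box_Q \<sigma>}"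

definition entire :: "(complex^'n \<Rightarrow> complex) \<Rightarrow> bool" where
  "entire F \<longleftrightarrow>
     (\<forall>z. \<exists>D. (F has_derivative D) (at z) \<and> (\<forall>c v. D (c *s v) = c * D v))"

text \<open>An element of the Bernstein space is identified with the entire function that agrees with
  it almost everywhere on the real subspace: it exists by the Paley-Wiener-Schwartz theorem and
  is unique by the identity theorem.\<close>

definition entire_extension :: "(real^'n \<Rightarrow> complex) \<Rightarrow> complex^'n \<Rightarrow> complex" where
  "entire_extension f = (THE F. entire F \<and> (AE x in lebesgue. F (complex_vec x) = f x))"

definition partial_complex :: "'n \<Rightarrow> (complex^'n \<Rightarrow> complex) \<Rightarrow> complex^'n \<Rightarrow> complex" where
  "partial_complex j F z = deriv (\<lambda>w. F (z + w *s axis j 1)) 0"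

text \<open>The index type carries no order, so the coordinates are listed in an arbitrary fixed one;
  for entire functions the partial derivatives commute and the choice is immaterial.\<close>

definition coordinates :: "'n::finite list" where
  "coordinates = (SOME js. distinct js \<and> set js = UNIV)"

definition multi_deriv :: "nat^'n \<Rightarrow> (complex^'n \<Rightarrow> complex) \<Rightarrow> complex^'n \<Rightarrow> complex" where
  "multi_deriv k F = foldr (\<lambda>j. partial_complex j ^^ (k $ j)) coordinates F"

definition index_cube :: "(nat^'n) set" where
  "index_cube = {k. \<forall>j. k $ j \<in> {0, 1}}"

definition sampling_lattice :: "real^'n \<Rightarrow> (real^'n) set" where
  "sampling_lattice \<sigma> = range (\<lambda>m::int^'n. \<chi> j. 2 * pi * of_int (m $ j) / \<sigma> $ j)"

definition sampling_poly ::
    "(complex^'n \<Rightarrow> complex) \<Rightarrow> nat^'n \<Rightarrow> real^'n \<Rightarrow> complex^'n \<Rightarrow> complex" where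
  "sampling_poly F k u w = multi_deriv k F (complex_vec u) * (\<Prod>j\<in>UNIV. (w $ j) ^ (k $ j))"

definition sinc_vec :: "complex^'n \<Rightarrow> complex" where
  "sinc_vec z = (\<Prod>j\<in>UNIV. if z $ j = 0 then 1 else sin (pi * z $ j) / (pi * z $ j))"

text \<open>The product of vectors is the componentwise one.\<close>

definition sampling_term ::
    "real^'n \<Rightarrow> (complex^'n \<Rightarrow> complex) \<Rightarrow> real^'n \<Rightarrow> complex^'n \<Rightarrow> complex" where
  "sampling_term \<sigma> F u z =
     (\<Sum>k\<in>index_cube. sampling_poly F k u (z - complex_vec u)) *
     (sinc_vec ((1 / (2 * pi)) *s (complex_vec \<sigma> * (z - complex_vec u))))\<^sup>2"

text \<open>Absolute convergence at each point of \<open>S\<close>, and uniform convergence on \<open>S\<close> to \<open>g\<close> along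
  the net of finite partial sums, so independently of any enumeration of the index set.\<close>

definition converges_abs_uniformly_on ::
    "'z set \<Rightarrow> 'u set \<Rightarrow> ('u \<Rightarrow> 'z \<Rightarrow> complex) \<Rightarrow> ('z \<Rightarrow> complex) \<Rightarrow> bool" where
  "converges_abs_uniformly_on S I a g \<longleftrightarrow>
     (\<forall>z\<in>S. (\<lambda>u. norm (a u z)) summable_on I) \<and>
     uniform_limit S (\<lambda>A z. \<Sum>u\<in>A. a u z) g (finite_subsets_at_top I)"

end

theory Submission
  imports Defs "HOL-Complex_Analysis.Complex_Analysis" "HOL-Probability.Probability"
begin

text \<open>
  Let \<open>f\<close> have spectrum in the box. Pairing \<open>f\<close> with Fourier transforms of test functions that approximate
  indicators of boxes, and cutting these test functions off outside a slightly larger box, which does not change the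
  pairing, shows that \<open>f\<close> agrees almost everywhere with its convolution \<open>F\<close> with a product of one-variable
  kernels. Each kernel is entire of exponential type \<open>\<sigma>\<^sub>j + e\<close> and decays quadratically on the real line. Hence
  \<open>F\<close> is entire, its derivatives are bounded by a convolution of \<open>|f|\<close> with an integrable weight, and their values
  on shifted lattices are \<open>p\<close>-summable. Since \<open>e\<close> is arbitrary, a Phragmen-Lindeloef argument yields the exact
  type \<open>\<sigma>\<^sub>j\<close> in each variable.

  In one variable, the difference between a function and its sampling series, divided by the square of the sine that
  vanishes on the lattice, is a bounded entire function, and it tends to zero along the midpoints. In several variables
  this formula is iterated over the coordinates. The resulting multiple series converges absolutely, and uniformly on
  strips of bounded imaginary part, by Hoelder's inequality.
\<close>

text \<open>The exact type is what shapes the proof. A smooth cutoff that equals 1 near the box is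
  supported in a strictly larger box, so the reproducing kernels have type
  \<open>\<sigma> $ j + e\<close> with \<open>e\<close> > 0, whereas division by the squared sine
  leaves a bounded quotient only for type \<open>\<sigma> $ j\<close> itself. The representation is
  therefore proved for every \<open>e\<close>, the entire functions obtained for different
  \<open>e\<close> are identified by uniqueness of the extension, and the type is then sharpened in
  one variable at a time. The spectrum is defined by two clauses, through the support of the
  transform if the function is integrable and through a distribution otherwise. Both enter only
  through one consequence: the pairing vanishes on every tensor product of test functions one of
  whose factors vanishes on a neighbourhood of the interval from \<open>- \<sigma> $ i\<close> to
  \<open>\<sigma> $ i\<close>. Tensor products suffice because integrals over boxes determine a
  function almost everywhere. They also reduce Fourier inversion to one variable and to the single
  point 0, where a Gaussian regularisation proves it.\<close>

no_notation fps_nth (infixl "$" 75)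

section \<open>Weights and lattice sums\<close>

text \<open>All kernels decay like this weight, coordinate by coordinate.\<close>

definition wt :: "real \<Rightarrow> real" where "wt x = 1 / (1 + x\<^sup>2)"

lemma wt_pos: "0 < wt x"
  unfolding wt_def by (simp add: add_pos_nonneg)

lemma wt_nonneg [simp]: "0 \<le> wt x"
  using wt_pos[of x] by simp

lemma wt_le_1: "wt x \<le> 1"
  unfolding wt_def by (simp add: divide_le_eq_1 add_pos_nonneg)

lemma wt_minus: "wt (- x) = wt x"
  by (simp add: wt_def)

lemma continuous_wt: "continuous_on A wt"
  unfolding wt_def by (intro continuous_intros) (metis add_pos_nonneg less_irrefl zero_le_power2 zero_less_one)

lemma borel_measurable_wt [measurable]: "wt \<in> borel_measurable borel"
  by (intro borel_measurable_continuous_onI continuous_wt)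

text \<open>Peetre's inequality.\<close>

lemma wt_shift: "wt (x + a) \<le> 2 * (1 + a\<^sup>2) * wt x"
proof -
  have "2 * (1 + a\<^sup>2) * (1 + (x + a)\<^sup>2) = (1 + x\<^sup>2) + (1 + (x + 2 * a)\<^sup>2 + 2 * a\<^sup>2 * (x + a)\<^sup>2)"
    by (simp add: power2_eq_square algebra_simps)
  moreover have "0 \<le> 1 + (x + 2 * a)\<^sup>2 + 2 * a\<^sup>2 * (x + a)\<^sup>2" by simp
  ultimately have "1 + x\<^sup>2 \<le> 2 * (1 + a\<^sup>2) * (1 + (x + a)\<^sup>2)" by linarith
  then show ?thesis
    unfolding wt_def by (simp add: divide_simps add_pos_nonneg mult.commute not_less_iff_gr_or_eq) 
qed

lemma integrable_wt: "integrable lborel wt"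
  using integrable_I0i_1_div_plus_square integrable_inverse_1_plus_square
  by (simp add: set_integrable_def wt_def[abs_def] inverse_eq_divide)

text \<open>\<open>lborel\<close> is the image of a product measure over \<open>Basis\<close>, so
  Fubini's theorem for finite products applies once coordinates are renamed as basis vectors
  \<open>axis j 1\<close>; \<open>?ix\<close> undoes this renaming.\<close>

lemma 
  fixes g :: "'n::finite \<Rightarrow> real \<Rightarrow> 'a::{real_normed_field,banach,second_countable_topology}"
  assumes "\<And>j. integrable lborel (g j)"
  shows integrable_prod_vec: "integrable lborel (\<lambda>x::real^'n. \<Prod>j\<in>UNIV. g j (x$j))" (is ?A)
    and integral_prod_vec: "(LINT x|lborel. (\<Prod>j\<in>UNIV. g j ((x::real^'n)$j))) = (\<Prod>j\<in>UNIV. (LINT t|lborel. g j t))" (is ?B)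
proof -
  interpret P: product_sigma_finite "\<lambda>_::real^'n. lborel :: real measure" ..
  let ?P = "\<Pi>\<^sub>M b\<in>(Basis::(real^'n) set). (lborel :: real measure)"
  let ?T = "\<lambda>f. \<Sum>b\<in>(Basis::(real^'n) set). f b *\<^sub>R b"
  let ?ix = "\<lambda>b::real^'n. THE j. b = axis j 1"
  have bij: "bij_betw (\<lambda>j::'n. axis j (1::real)) UNIV Basis"
    by (auto simp: bij_betw_def inj_on_def Basis_vec_def axis_eq_axis)
  have ix: "?ix (axis j 1) = j" for j :: 'n
    by (simp add: axis_eq_axis)
  have comp: "(?T f) $ j = f (axis j 1)" for f and j :: 'n
  proof -
    have "(?T f) $ j = (?T f) \<bullet> axis j 1" by (simp add: inner_axis)
    also have "\<dots> = f (axis j 1)"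
      by (rule inner_sum_left_Basis) auto
    finally show ?thesis .
  qed
  have re: "(\<Prod>j\<in>UNIV. g j (?T f $ j)) = (\<Prod>b\<in>Basis. g (?ix b) (f b))" for f
    unfolding comp by (subst prod.reindex_bij_betw[OF bij, symmetric]) (simp only: ix)
  have [measurable]: "?T \<in> ?P \<rightarrow>\<^sub>M borel" by measurable
  have [measurable]: "g j \<in> borel_measurable borel" for j
    using assms[of j] by simp
  have m: "(\<lambda>x::real^'n. \<Prod>j\<in>UNIV. g j (x$j)) \<in> borel_measurable borel"
    by measurable
  show ?A
    apply (subst lborel_eq)
    apply (subst integrable_distr_eq)
      apply measurable
     apply (subst re)
    apply (rule P.product_integrable_prod)
     apply (simp_all add: assms)
    done
  have "(LINT x|lborel. (\<Prod>j\<in>UNIV. g j ((x::real^'n)$j))) = (LINT f|?P. (\<Prod>b\<in>Basis. g (?ix b) (f b)))"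
    apply (subst lborel_eq)
    apply (subst integral_distr)
      apply measurable
     apply (subst re)
    apply simp
    done
  also have "\<dots> = (\<Prod>b\<in>Basis. (LINT t|lborel. g (?ix b) t))"
    by (rule P.product_integral_prod) (simp_all add: assms)
  also have "\<dots> = (\<Prod>j\<in>UNIV. (LINT t|lborel. g j t))"
    by (subst prod.reindex_bij_betw[OF bij, symmetric]) (simp only: ix)
  finally show ?B .
qed

definition wtn :: "real^'n \<Rightarrow> real" where "wtn x = (\<Prod>j\<in>UNIV. wt (x $ j))"

lemma wtn_pos: "0 < wtn x"
  unfolding wtn_def by (simp add: prod_pos wt_pos)

lemma wtn_nonneg [simp]: "0 \<le> wtn x"
  using wtn_pos[of x] by simp

lemma wtn_le_1: "wtn x \<le> 1"
  unfolding wtn_def by (intro prod_le_1) (simp add: wt_le_1)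

lemma borel_measurable_wtn [measurable]: "wtn \<in> borel_measurable borel"
  unfolding wtn_def[abs_def] by measurable

lemma wtn_minus: "wtn (- x) = wtn x"
  by (simp add: wtn_def wt_minus)

lemma integrable_wtn: "integrable lborel wtn"
  unfolding wtn_def[abs_def] by (intro integrable_prod_vec integrable_wt)

section \<open>Sums over integer lattices, uniformly in the shift\<close>

lemma summable_on_int_powr:
  fixes s :: real
  assumes "1 < s"
  shows "(\<lambda>k::int. (1 + \<bar>real_of_int k\<bar>) powr (- s)) summable_on UNIV"
proof -
  have "summable (\<lambda>n::nat. (real (Suc n)) powr (- s))"
    using summable_real_powr_iff[of "- s"] assms by (subst summable_Suc_iff) simp
  then have n: "(\<lambda>n::nat. (1 + real n) powr (- s)) summable_on UNIV"
    by (intro norm_summable_imp_summable_on) (simp add: add.commute)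
  have "(\<lambda>k::int. (1 + \<bar>real_of_int k\<bar>) powr (- s)) summable_on (range int)"
    by (subst summable_on_reindex) (use n in \<open>simp_all add: o_def\<close>)
  moreover have "(\<lambda>k::int. (1 + \<bar>real_of_int k\<bar>) powr (- s)) summable_on (range (\<lambda>n. - int n))"
    by (subst summable_on_reindex) (use n in \<open>simp_all add: o_def inj_on_def\<close>)
  moreover have "(UNIV::int set) = range int \<union> range (\<lambda>n. - int n)"
    using int_cases2 by blast
  ultimately show ?thesis
    by (metis summable_on_union)
qed

text \<open>Shifting the index by the floor of \<open>x\<close> compares every such sum with the one
  at \<open>x = 0\<close>. The distance changes by at most 1, which costs a factor 2 inside the
  power and hence \<open>2 powr s\<close> outside.\<close>

lemma int_powr_sum_bound:
  fixes s :: real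
  assumes "1 < s"
  obtains B where "0 \<le> B" "\<And>x A. finite A \<Longrightarrow> (\<Sum>m\<in>A. (1 + \<bar>x - real_of_int m\<bar>) powr (- s)) \<le> B"
proof -
  define g where "g = (\<lambda>k::int. (1 + \<bar>real_of_int k\<bar>) powr (- s))"
  have g: "g summable_on UNIV"
    unfolding g_def by (rule summable_on_int_powr[OF assms])
  have g0: "0 \<le> g k" for k by (simp add: g_def)
  define B where "B = 2 powr s * infsum g UNIV"
  have "(\<Sum>m\<in>A. (1 + \<bar>x - real_of_int m\<bar>) powr (- s)) \<le> B" if A: "finite A" for x A
  proof -
    have le: "(1 + \<bar>x - real_of_int m\<bar>) powr (- s) \<le> 2 powr s * g (m - \<lfloor>x\<rfloor>)" for m
    proof -
      have "(1 + \<bar>real_of_int (m - \<lfloor>x\<rfloor>)\<bar>) / 2 \<le> 1 + \<bar>x - real_of_int m\<bar>"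
      proof -
        have "(1 + \<bar>a - f\<bar>) / 2 \<le> 1 + \<bar>x - a\<bar>" if "f \<le> x" "x < f + 1" for a f :: real
          using that by (simp add: abs_if field_simps)
        from this[OF of_int_floor_le real_of_int_floor_add_one_gt, of "real_of_int m"] show ?thesis
          unfolding of_int_diff .
      qed
      then have "(1 + \<bar>x - real_of_int m\<bar>) powr (- s) \<le> ((1 + \<bar>real_of_int (m - \<lfloor>x\<rfloor>)\<bar>) / 2) powr (- s)"
        using assms by (intro powr_mono2') auto
      also have "\<dots> = 2 powr s * g (m - \<lfloor>x\<rfloor>)"
        unfolding g_def by (subst powr_divide) (auto simp: powr_minus field_simps)
      finally show ?thesis .
    qed
    have "(\<Sum>m\<in>A. (1 + \<bar>x - real_of_int m\<bar>) powr (- s)) \<le> 2 powr s * (\<Sum>m\<in>A. g (m - \<lfloor>x\<rfloor>))"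
      unfolding sum_distrib_left by (intro sum_mono le)
    also have "(\<Sum>m\<in>A. g (m - \<lfloor>x\<rfloor>)) = sum g ((\<lambda>m. m - \<lfloor>x\<rfloor>) ` A)"
      by (subst sum.reindex) (auto simp: inj_on_def)
    also have "\<dots> \<le> infsum g UNIV"
      by (intro finite_sum_le_infsum g) (use A g0 in auto)
    finally show ?thesis unfolding B_def by (simp add: mult_left_mono)
  qed
  moreover have "0 \<le> B" unfolding B_def by (simp add: infsum_nonneg g0)
  ultimately show ?thesis using that by blast
qed

lemma wt_sum_bound:
  fixes c :: real
  assumes "0 < c"
  obtains B where "0 \<le> B" "\<And>x A. finite A \<Longrightarrow> (\<Sum>m\<in>A. wt (c * real_of_int m + x)) \<le> B"
proof -
  obtain B where B: "0 \<le> B" "\<And>x A. finite A \<Longrightarrow> (\<Sum>m\<in>A. (1 + \<bar>x - real_of_int m\<bar>) powr (- 2)) \<le> B"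
    using int_powr_sum_bound[of 2] by auto
  \<comment> \<open>Chosen so that
    \<open>(1 + y)\<^sup>2 \<le> D * (1 + c\<^sup>2 * y\<^sup>2)\<close>: the product
    \<open>(1 + 1 / c\<^sup>2) * (1 + c\<^sup>2 * y\<^sup>2)\<close> contains
    \<open>1 + y\<^sup>2\<close> among its nonnegative terms.\<close>
  define D where "D = 2 * (1 + 1 / c\<^sup>2)"
  have D: "0 \<le> D" by (simp add: D_def)
  have le: "wt (c * real_of_int m + x) \<le> D * (1 + \<bar>(- x / c) - real_of_int m\<bar>) powr (- 2)" for m x
  proof -
    define y where "y = \<bar>(- x / c) - real_of_int m\<bar>"
    have "c * real_of_int m + x = - (c * ((- x / c) - real_of_int m))"
      using assms by (simp add: field_simps)
    then have y: "0 \<le> y" "(c * real_of_int m + x)\<^sup>2 = c\<^sup>2 * y\<^sup>2"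
      by (simp_all only: y_def power2_minus power_mult_distrib power2_abs abs_ge_zero)
    have "2 * (1 + y\<^sup>2) = (1 + y)\<^sup>2 + (1 - y)\<^sup>2"
      by (simp add: power2_eq_square algebra_simps)
    then have "(1 + y)\<^sup>2 \<le> 2 * (1 + y\<^sup>2)" using zero_le_power2[of "1 - y"] by linarith
    also have "\<dots> \<le> 2 * (1 + y\<^sup>2 + (c\<^sup>2 * y\<^sup>2 + 1 / c\<^sup>2))" by simp
    also have "\<dots> = D * (1 + c\<^sup>2 * y\<^sup>2)" using assms by (simp add: D_def field_simps)
    finally have *: "(1 + y)\<^sup>2 \<le> D * (1 + c\<^sup>2 * y\<^sup>2)" .
    have "(1 + y) powr (- 2) = 1 / (1 + y)\<^sup>2"
      using y by (simp add: powr_minus powr_realpow divide_inverse)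
    moreover have "wt (c * real_of_int m + x) \<le> D * (1 / (1 + y)\<^sup>2)"
      unfolding wt_def y using * y by (simp add: divide_simps add_pos_nonneg mult.commute not_less_iff_gr_or_eq)
    ultimately show ?thesis by (simp add: y_def)
  qed
  have "(\<Sum>m\<in>A. wt (c * real_of_int m + x)) \<le> D * B" if "finite A" for x A
  proof -
    have "(\<Sum>m\<in>A. wt (c * real_of_int m + x)) \<le> D * (\<Sum>m\<in>A. (1 + \<bar>(- x / c) - real_of_int m\<bar>) powr (- 2))"
      unfolding sum_distrib_left by (intro sum_mono le)
    also have "\<dots> \<le> D * B" using B(2)[OF that] D by (intro mult_left_mono)
    finally show ?thesis .
  qed
  then show ?thesis using that[of "D * B"] B D by simp
qed

text \<open>A finite set of index functions lies in the product of its coordinate projections, and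
  over that product the sum factorises; nonnegativity permits the enlargement.\<close>

lemma sum_prod_le_prod_bound:
  fixes f :: "'i \<Rightarrow> 'm \<Rightarrow> real"
  assumes J: "finite J" and f: "\<And>j m. 0 \<le> f j m"
    and B: "\<And>j A. j \<in> J \<Longrightarrow> finite A \<Longrightarrow> sum (f j) A \<le> B j"
    and X: "finite X" "X \<subseteq> PiE J (\<lambda>_. UNIV)"
  shows "(\<Sum>m\<in>X. \<Prod>j\<in>J. f j (m j)) \<le> (\<Prod>j\<in>J. B j)"
proof -
  define A where "A j = (\<lambda>m. m j) ` X" for j
  have A: "finite (A j)" for j using X by (simp add: A_def)
  have "X \<subseteq> PiE J A" using X by (auto simp: A_def PiE_iff)
  then have "(\<Sum>m\<in>X. \<Prod>j\<in>J. f j (m j)) \<le> (\<Sum>m\<in>PiE J A. \<Prod>j\<in>J. f j (m j))"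
    by (intro sum_mono2 finite_PiE J A prod_nonneg f) auto
  also have "\<dots> = (\<Prod>j\<in>J. sum (f j) (A j))"
    using prod_sum_PiE[OF J, of A f] A by simp
  also have "\<dots> \<le> (\<Prod>j\<in>J. B j)"
    by (intro prod_mono conjI sum_nonneg f B A)
  finally show ?thesis .
qed

section \<open>Smooth functions of one variable and their Fourier-Laplace transforms\<close>

abbreviation (input) vderiv :: "(real \<Rightarrow> complex) \<Rightarrow> real \<Rightarrow> complex" where
  "vderiv f \<equiv> (\<lambda>x. vector_derivative f (at x))"

text \<open>Built on iterated \<open>vector_derivative\<close>, the operator that
  \<open>partial_real\<close> applies along a coordinate line, so that smoothness of the factors
  passes to \<open>smooth\<close> for tensor products.\<close>

primrec diffk :: "nat \<Rightarrow> (real \<Rightarrow> complex) \<Rightarrow> bool" where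
  "diffk 0 f \<longleftrightarrow> True"
| "diffk (Suc k) f \<longleftrightarrow> (\<forall>x. f differentiable (at x)) \<and> diffk k (vderiv f)"

definition smooth1 :: "(real \<Rightarrow> complex) \<Rightarrow> bool" where
  "smooth1 f \<longleftrightarrow> (\<forall>k. diffk k f)"

lemma vderivI: "(\<And>x. (f has_vector_derivative g x) (at x)) \<Longrightarrow> vderiv f = g"
  by (auto simp: vector_derivative_at)

lemma diffk_SucI:
  assumes "\<And>x. (f has_vector_derivative g x) (at x)" "diffk k g"
  shows "diffk (Suc k) f"
  unfolding diffk.simps vderivI[OF assms(1)]
  using assms(2) differentiableI_vector[OF assms(1)] by blast

lemma diffk_SucD:
  "diffk (Suc k) f \<Longrightarrow> (f has_vector_derivative vderiv f x) (at x)"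
  unfolding diffk.simps vector_derivative_works by blast

lemma diffk_Suc_imp: "diffk (Suc k) f \<Longrightarrow> diffk k f"
proof (induction k arbitrary: f)
  case (Suc k)
  then show ?case unfolding diffk.simps(2)[of "Suc k"] diffk.simps(2)[of k f] by blast
qed simp

lemma smooth1_vderiv: 
  assumes "smooth1 f" shows "smooth1 (vderiv f)"
  unfolding smooth1_def
proof
  fix k
  have "diffk (Suc k) f" using assms by (simp only: smooth1_def)
  then show "diffk k (vderiv f)" by simp
qed

lemma smooth1_has_vderiv: 
  assumes "smooth1 f" shows "(f has_vector_derivative vderiv f x) (at x)"
proof (rule diffk_SucD)
  show "diffk (Suc 0) f" using assms by (simp only: smooth1_def)
qed

lemma smooth1_continuous: 
  assumes "smooth1 f" shows "continuous_on A f"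
proof (rule continuous_at_imp_continuous_on, rule ballI)
  fix x show "isCont f x"
    by (rule has_vector_derivative_continuous[OF smooth1_has_vderiv[OF assms]])
qed

lemma smooth1I:
  assumes "\<And>x. (f has_vector_derivative g x) (at x)" "smooth1 g"
  shows "smooth1 f"
  unfolding smooth1_def
proof
  fix k 
  have "diffk k g" using assms(2) by (simp only: smooth1_def)
  with assms(1) have "diffk (Suc k) f" by (rule diffk_SucI)
  then show "diffk k f" by (rule diffk_Suc_imp)
qed

lemma diffk_add:
  "diffk k f \<Longrightarrow> diffk k g \<Longrightarrow> diffk k (\<lambda>x. f x + g x)"
proof (induction k arbitrary: f g)
  case (Suc k)
  show ?case
    by (rule diffk_SucI[OF has_vector_derivative_add[OF diffk_SucD[OF Suc.prems(1)] diffk_SucD[OF Suc.prems(2)]]])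
      (use Suc in auto)
qed simp

lemma diffk_mult:
  "diffk k f \<Longrightarrow> diffk k g \<Longrightarrow> diffk k (\<lambda>x. f x * g x)"
proof (induction k arbitrary: f g)
  case (Suc k)
  show ?case
    by (rule diffk_SucI[OF has_vector_derivative_mult[OF diffk_SucD[OF Suc.prems(1)] diffk_SucD[OF Suc.prems(2)]]])
      (use Suc diffk_Suc_imp[OF Suc.prems(1)] diffk_Suc_imp[OF Suc.prems(2)] in \<open>auto intro!: diffk_add\<close>)
qed simp

lemma diffk_affine:
  fixes a b :: real
  shows "diffk k f \<Longrightarrow> diffk k (\<lambda>x. f (a * x + b))"
proof (induction k arbitrary: f)
  case (Suc k)
  have c: "diffk k (\<lambda>x. of_real a)" for k
  proof (induction k)
    case (Suc k)
    have "diffk k (\<lambda>x. 0)" by (induction k) auto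
    then show ?case by (intro diffk_SucI[where g="\<lambda>_. 0"]) (auto intro!: derivative_eq_intros)
  qed simp
  have d: "((\<lambda>x. f (a * x + b)) has_vector_derivative (of_real a * vderiv f (a * x + b))) (at x)" for x
  proof -
    have "((\<lambda>x. a * x + b) has_vector_derivative a) (at x)"
      by (auto intro!: derivative_eq_intros simp: has_real_derivative_iff_has_vector_derivative[symmetric])
    from vector_diff_chain_at[OF this diffk_SucD[OF Suc.prems]]
    show ?thesis by (simp add: o_def scaleR_conv_of_real)
  qed
  show ?case
    by (rule diffk_SucI[OF d]) (use Suc in \<open>auto intro!: diffk_mult[OF c]\<close>)
qed simp

lemma diffk_holomorphic:
  "F holomorphic_on UNIV \<Longrightarrow> diffk k (\<lambda>x. F (of_real x))"
proof (induction k arbitrary: F)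
  case (Suc k)
  have "((\<lambda>x. F (of_real x)) has_vector_derivative deriv F (of_real x)) (at x)" for x
    by (rule has_vector_derivative_real_field) (use Suc.prems holomorphic_derivI in blast)
  then show ?case
    using Suc by (intro diffk_SucI) (auto intro: holomorphic_deriv)
qed simp

lemma smooth1_add: "smooth1 f \<Longrightarrow> smooth1 g \<Longrightarrow> smooth1 (\<lambda>x. f x + g x)"
  by (simp add: smooth1_def diffk_add)

lemma smooth1_mult: "smooth1 f \<Longrightarrow> smooth1 g \<Longrightarrow> smooth1 (\<lambda>x. f x * g x)"
  by (simp add: smooth1_def diffk_mult)

lemma smooth1_affine: "smooth1 f \<Longrightarrow> smooth1 (\<lambda>x. f (a * x + b))"
  by (simp add: smooth1_def diffk_affine)

lemma smooth1_holomorphic: "F holomorphic_on UNIV \<Longrightarrow> smooth1 (\<lambda>x. F (of_real x))"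
  by (simp add: smooth1_def diffk_holomorphic)

lemma smooth1_const: "smooth1 (\<lambda>x. c)"
  using smooth1_holomorphic[of "\<lambda>_. c"] by simp

lemma smooth1_diff: 
  assumes "smooth1 f" "smooth1 g" shows "smooth1 (\<lambda>x. f x - g x)"
  using smooth1_add[OF assms(1) smooth1_mult[OF smooth1_const[of "-1"] assms(2)]] by simp

section \<open>Smooth steps and cutoffs\<close>

definition flat :: "real poly \<Rightarrow> real \<Rightarrow> real" where
  "flat p x = (if 0 < x then poly p (1 / x) * exp (- 1 / x) else 0)"

lemma poly_exp_tendsto_0: "((\<lambda>y::real. poly p y * exp (- y)) \<longlongrightarrow> 0) at_top"
proof -
  have "((\<lambda>y::real. \<Sum>i\<le>degree p. coeff p i * (y ^ i / exp y)) \<longlongrightarrow> (\<Sum>i\<le>degree p. coeff p i * 0)) at_top"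
    by (intro tendsto_intros tendsto_power_div_exp_0)
  moreover have "(\<lambda>y::real. \<Sum>i\<le>degree p. coeff p i * (y ^ i / exp y)) = (\<lambda>y. poly p y * exp (- y))"
    by (simp add: poly_altdef sum_distrib_right exp_minus divide_inverse mult.assoc)
  ultimately show ?thesis by simp
qed

text \<open>The family \<open>p(1/x) exp(-1/x)\<close> is closed under differentiation, so all its members are smooth at 0.\<close>

lemma flat_has_derivative:
  "(flat p has_real_derivative flat ([:0,0,1:] * (p - pderiv p)) x) (at x)"
proof (cases x "0::real" rule: linorder_cases)
  case less
  have "((\<lambda>_. 0) has_real_derivative 0) (at x)" by simp
  then have "(flat p has_real_derivative 0) (at x)"
    by (rule has_field_derivative_transform_within_open[where S="{..<0}"]) (use less in \<open>auto simp: flat_def\<close>)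
  then show ?thesis using less by (simp add: flat_def)
next
  case equal
  \<comment> \<open>The difference quotient \<open>flat p h / h\<close> in the variable y = 1/h:
    dividing by h adds one factor y to the polynomial.\<close>
  have "((\<lambda>h. poly [:0,1:] (inverse h) * poly p (inverse h) * exp (- inverse h)) \<longlongrightarrow> 0) (at_right 0)"
    using filterlim_compose[OF poly_exp_tendsto_0[of "[:0,1:] * p"] filterlim_inverse_at_top_right]
    by simp
  then have "((\<lambda>h. flat p h / h) \<longlongrightarrow> 0) (at_right 0)"
    by (rule Lim_transform_eventually)
       (auto simp: flat_def eventually_at_right_field field_simps intro!: exI[of _ 1])
  moreover have "((\<lambda>h. flat p h / h) \<longlongrightarrow> 0) (at_left 0)"
    by (rule Lim_transform_eventually[OF tendsto_const])
       (auto simp: flat_def eventually_at_left_field intro!: exI[of _ "-1"])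
  ultimately have "((\<lambda>h. flat p h / h) \<longlongrightarrow> 0) (at 0)"
    by (simp add: filterlim_at_split)
  then show ?thesis
    using equal by (simp add: has_field_derivative_iff flat_def)
next
  case greater
  \<comment> \<open>With y = 1/x the derivative of p(y) exp(-y) is y^2 (p - p')(y) exp(-y); the
    factor \<open>[:0,0,1:]\<close> is this y^2.\<close>
  have "((\<lambda>x. poly p (1 / x) * exp (- 1 / x)) has_real_derivative flat ([:0,0,1:] * (p - pderiv p)) x) (at x)"
    using greater
    by (auto intro!: derivative_eq_intros DERIV_chain2[OF poly_DERIV] simp: flat_def power2_eq_square)
       (simp add: algebra_simps diff_divide_distrib)
  then show ?thesis
    by (rule has_field_derivative_transform_within_open[where S="{0<..}"]) (use greater in \<open>auto simp: flat_def\<close>)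
qed

lemma smooth1_flat: "smooth1 (\<lambda>x. of_real (flat p x))"
proof -
  have "diffk k (\<lambda>x. of_real (flat p x))" for k
  proof (induction k arbitrary: p)
    case (Suc k)
    have "((\<lambda>x. of_real (flat p x)) has_vector_derivative of_real (flat ([:0,0,1:] * (p - pderiv p)) x)) (at x)" for x
      by (intro has_vector_derivative_of_real flat_has_derivative)
    then show ?case by (rule diffk_SucI) (rule Suc)
  qed simp
  then show ?thesis by (simp add: smooth1_def)
qed

text \<open>The step is the normalised primitive of a smooth bump \<open>b\<close> that is positive
  on the open unit interval and zero elsewhere. By the mean value theorem the primitive is constant
  on either side of the interval and strictly larger on the right.\<close>

lemma smooth_step:
  obtains s :: "real \<Rightarrow> complex" where "smooth1 s" "\<And>t. t \<le> 0 \<Longrightarrow> s t = 0" "\<And>t. 1 \<le> t \<Longrightarrow> s t = 1"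
proof -
  define b where "b t = flat 1 t * flat 1 (1 - t)" for t
  have b0: "b t = 0" if "t \<le> 0 \<or> 1 \<le> t" for t using that by (auto simp: b_def flat_def)
  have b1: "0 < b t" if "0 < t" "t < 1" for t using that by (auto simp: b_def flat_def)
  have cf: "isCont (flat 1) t" for t using flat_has_derivative DERIV_isCont by blast
  have cb: "isCont b t" for t
    unfolding b_def by (intro continuous_intros cf isCont_o2[OF _ cf])
  obtain S where S': "(S has_vector_derivative b x) (at x)" for x
    using einterval_antiderivative[of "-\<infinity>" "\<infinity>" b] cb by auto
  then have S: "(S has_real_derivative b x) (at x)" for x
    by (simp add: has_real_derivative_iff_has_vector_derivative)
  have S0: "S t = S 0" if "t \<le> 0" for t
  proof (cases "t = 0")
    case False
    then have "\<exists>z>t. z < 0 \<and> S 0 - S t = (0 - t) * b z"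
      using S that by (intro MVT2) auto
    then show ?thesis by (auto simp: b0)
  qed simp
  have S1: "S t = S 1" if "1 \<le> t" for t
  proof (cases "t = 1")
    case False
    then have "\<exists>z>1. z < t \<and> S t - S 1 = (t - 1) * b z"
      using S that by (intro MVT2) auto
    then show ?thesis by (auto simp: b0)
  qed simp
  have "\<exists>z>0. z < 1 \<and> S 1 - S 0 = (1 - 0) * b z"
    using S by (intro MVT2) auto
  then have pos: "0 < S 1 - S 0" using b1 by force
  define c where "c = S 1 - S 0"
  define s where "s t = complex_of_real ((S t - S 0) / c)" for t
  have "(s has_vector_derivative of_real (1 / c) * of_real (b x)) (at x)" for x
    unfolding s_def[abs_def] of_real_mult[symmetric]
    by (intro has_vector_derivative_of_real) (use pos in \<open>auto intro!: derivative_eq_intros S simp: c_def\<close>)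
  moreover have "smooth1 (\<lambda>x. of_real (1 / c) * of_real (b x))"
    unfolding b_def of_real_mult
    using smooth1_affine[OF smooth1_flat[of 1], of "-1" 1]
    by (intro smooth1_mult smooth1_const smooth1_flat) simp
  ultimately have "smooth1 s" by (rule smooth1I)
  moreover have "s t = 0" if "t \<le> 0" for t
    unfolding s_def S0[OF that] by simp
  moreover have "s t = 1" if "1 \<le> t" for t
    unfolding s_def S1[OF that] using pos by (simp add: c_def)
  ultimately show ?thesis by (rule that)
qed

lemma smooth_cutoff:
  assumes "r < R"
  obtains \<phi> :: "real \<Rightarrow> complex" where "smooth1 \<phi>" "\<And>t. \<bar>t\<bar> \<le> r \<Longrightarrow> \<phi> t = 1" "\<And>t. R \<le> \<bar>t\<bar> \<Longrightarrow> \<phi> t = 0"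
proof -
  obtain s :: "real \<Rightarrow> complex" where s: "smooth1 s" "\<And>t. t \<le> 0 \<Longrightarrow> s t = 0" "\<And>t. 1 \<le> t \<Longrightarrow> s t = 1"
    using smooth_step by blast
  \<comment> \<open>Scales the transition layer from \<open>r\<close> to \<open>R\<close> to unit
    length, so that each of the two steps in the product rises over exactly one layer.\<close>
  define c where "c = 1 / (R - r)"
  have c: "0 < c" using assms by (simp add: c_def)
  define \<phi> where "\<phi> t = s (c * t + c * R) * s (- c * t + c * R)" for t
  have "smooth1 \<phi>"
    unfolding \<phi>_def by (intro smooth1_mult smooth1_affine s)
  moreover have "\<phi> t = 1" if "\<bar>t\<bar> \<le> r" for t
  proof -
    have "1 = c * (R - r)" using assms by (simp add: c_def)
    moreover have "c * (R - r) \<le> c * (R + t)" "c * (R - r) \<le> c * (R - t)"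
      using c that by (auto intro!: mult_left_mono)
    ultimately have "1 \<le> c * (R + t)" "1 \<le> c * (R - t)" by auto
    then show ?thesis by (simp add: \<phi>_def s(3) algebra_simps)
  qed
  moreover have "\<phi> t = 0" if "R \<le> \<bar>t\<bar>" for t
  proof -
    have "R + t \<le> 0 \<or> R - t \<le> 0"
      using that by arith
    then have "c * (R + t) \<le> 0 \<or> c * (R - t) \<le> 0"
      using c by (simp add: mult_le_0_iff)
    then show ?thesis by (auto simp: \<phi>_def s(2) algebra_simps)
  qed
  ultimately show ?thesis using that by blast
qed

section \<open>Fourier-Laplace transforms as kernels of exponential type\<close>

text \<open>The decay is required along all horizontal lines at once: on the real line it gives
  integrability against functions in L^p, and its uniformity over strips makes the class stable
  under Cauchy estimates, hence under differentiation.\<close>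

definition exp_kernel :: "real \<Rightarrow> (complex \<Rightarrow> complex) \<Rightarrow> bool" where
  "exp_kernel R \<kappa> \<longleftrightarrow> \<kappa> holomorphic_on UNIV \<and> 
     (\<exists>C\<ge>0. \<forall>z. norm (\<kappa> z) \<le> C * exp (R * \<bar>Im z\<bar>) * wt (Re z))"

definition fourier_laplace :: "(real \<Rightarrow> complex) \<Rightarrow> complex \<Rightarrow> complex" where
  "fourier_laplace \<psi> z = (LINT t|lborel. exp (- \<i> * z * of_real t) * \<psi> t)"

text \<open>Passage to the gauge integral over a compact interval, where differentiation under the
  integral and integration by parts are carried out.\<close>

lemma continuous_compact_support_integrable:
  fixes f :: "real \<Rightarrow> 'a::euclidean_space"
  assumes "continuous_on UNIV f" "\<And>t. R \<le> \<bar>t\<bar> \<Longrightarrow> f t = 0"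
  shows "integrable lborel f" "(LINT t|lborel. f t) = integral {-R..R} f"
proof -
  have eq: "(\<lambda>t. indicator {-R..R} t *\<^sub>R f t) = f"
    using assms(2) by (auto simp: indicator_def fun_eq_iff)
  have si: "set_integrable lborel {-R..R} f"
    by (intro borel_integrable_atLeastAtMost' continuous_on_subset[OF assms(1)]) auto
  then show "integrable lborel f" by (simp add: set_integrable_def eq)
  show "(LINT t|lborel. f t) = integral {-R..R} f"
    using set_borel_integral_eq_integral(2)[OF si] by (simp add: set_lebesgue_integral_def eq)
qed

context
  fixes \<psi> :: "real \<Rightarrow> complex" and R :: real
  assumes sm: "smooth1 \<psi>" and supp: "\<And>t. R \<le> \<bar>t\<bar> \<Longrightarrow> \<psi> t = 0"
begin

lemma vderiv_supp: "R < \<bar>t\<bar> \<Longrightarrow> vderiv \<psi> t = 0"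
proof -
  assume "R < \<bar>t\<bar>"
  have "((\<lambda>_. 0) has_vector_derivative 0) (at t)" by simp
  then have "(\<psi> has_vector_derivative 0) (at t)"
    by (rule has_vector_derivative_transform_within_open[where S="{t. R < \<bar>t\<bar>}"])
       (use \<open>R < \<bar>t\<bar>\<close> supp in \<open>auto intro!: open_Collect_less continuous_intros\<close>)
  then show ?thesis by (rule vector_derivative_at)
qed

text \<open>The hypothesis on the support includes the endpoints \<open>\<bar>t\<bar> = R\<close>.
  It reproduces itself for the derivative only after vanishing has been extended to the closure by
  continuity, and this is what allows two integrations by parts.\<close>

lemma vderiv_supp': "R \<le> \<bar>t\<bar> \<Longrightarrow> vderiv \<psi> t = 0"
proof -
  assume *: "R \<le> \<bar>t\<bar>"
  have c: "continuous_on UNIV (vderiv \<psi>)" by (rule smooth1_continuous[OF smooth1_vderiv[OF sm]])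
  have "vderiv \<psi> t = 0" if "R = \<bar>t\<bar>"
  proof -
    have "vderiv \<psi> constant_on closure {s. R < \<bar>s\<bar>}"
      by (rule constant_on_closureI) (use vderiv_supp continuous_on_subset[OF c] in \<open>auto simp: constant_on_def\<close>)
    moreover have "t \<in> closure {s. R < \<bar>s\<bar>}"
    proof -
      have "(\<lambda>n. t + (if 0 \<le> t then 1 else -1) / real (Suc n)) \<longlonglongrightarrow> t + 0"
        by (intro tendsto_add tendsto_const LIMSEQ_Suc[OF lim_const_over_n])
      moreover have "t + (if 0 \<le> t then 1 else -1) / real (Suc n) \<in> {s. R < \<bar>s\<bar>}" for n
        using that by (auto simp: abs_if field_simps)
      ultimately show ?thesis unfolding closure_sequential by (metis add.right_neutral)
    qed
    moreover have "\<bar>t\<bar> + 1 \<in> closure {s. R < \<bar>s\<bar>}"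
      using that by (intro closure_subset[THEN subsetD]) auto
    ultimately have "vderiv \<psi> t = vderiv \<psi> (\<bar>t\<bar> + 1)"
      unfolding constant_on_def by metis
    then show ?thesis using vderiv_supp[of "\<bar>t\<bar> + 1"] that by simp
  qed
  then show ?thesis using vderiv_supp[of t] * by force
qed

lemma fourier_laplace_integrable: "integrable lborel (\<lambda>t. exp (- \<i> * z * of_real t) * \<psi> t)"
  by (rule continuous_compact_support_integrable[where R=R])
     (auto intro!: continuous_intros smooth1_continuous[OF sm] simp: supp)

lemma fourier_laplace_eq_integral: "fourier_laplace \<psi> z = integral {-R..R} (\<lambda>t. exp (- \<i> * z * of_real t) * \<psi> t)"
  unfolding fourier_laplace_def
  by (rule continuous_compact_support_integrable(2))
     (auto intro!: continuous_intros smooth1_continuous[OF sm] simp: supp)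

lemma fourier_laplace_holomorphic: "fourier_laplace \<psi> holomorphic_on UNIV"
proof -
  have "(\<lambda>z. integral (cbox (-R) R) (\<lambda>t. exp (- \<i> * z * of_real t) * \<psi> t)) holomorphic_on UNIV"
    by (rule leibniz_rule_holomorphic[where fx="\<lambda>z t. (- \<i> * of_real t) * exp (- \<i> * z * of_real t) * \<psi> t"])
       (auto intro!: derivative_eq_intros integrable_continuous_real continuous_intros smooth1_continuous[OF sm]
          continuous_on_compose2[OF smooth1_continuous[OF sm, of UNIV] continuous_on_snd[OF continuous_on_id]] simp: split_beta)
  then show ?thesis by (simp add: fourier_laplace_eq_integral[abs_def] cbox_interval)
qed

lemma fourier_laplace_bound: 
  assumes "0 \<le> R"
  shows "\<exists>M\<ge>0. \<forall>z. norm (fourier_laplace \<psi> z) \<le> M * exp (R * \<bar>Im z\<bar>)"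
proof -
  have "compact (\<psi> ` {-R..R})"
    by (intro compact_continuous_image smooth1_continuous[OF sm]) auto
  then have "bounded (\<psi> ` {-R..R})"
    by (rule compact_imp_bounded)
  then obtain B where B: "0 < B" "\<And>t. t \<in> {-R..R} \<Longrightarrow> norm (\<psi> t) \<le> B"
    unfolding bounded_pos by auto
  then have B0: "0 \<le> B" by simp
  have "norm (fourier_laplace \<psi> z) \<le> (B * exp (R * \<bar>Im z\<bar>)) * (R - (-R))" for z
    unfolding fourier_laplace_eq_integral
  proof (rule integral_bound)
    fix t assume t: "t \<in> {-R..R}"
    have "Im z * t \<le> \<bar>Im z * t\<bar>" by (rule abs_ge_self)
    also have "\<dots> = \<bar>Im z\<bar> * \<bar>t\<bar>" by (rule abs_mult)
    also have "\<dots> \<le> \<bar>Im z\<bar> * R" using t by (intro mult_left_mono) auto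
    finally have le: "Im z * t \<le> R * \<bar>Im z\<bar>" by (simp add: mult.commute)
    have "norm (exp (- \<i> * z * of_real t)) = exp (Im z * t)"
      unfolding norm_exp_eq_Re by simp
    also have "\<dots> \<le> exp (R * \<bar>Im z\<bar>)" using le by simp
    finally have "norm (exp (- \<i> * z * of_real t)) * norm (\<psi> t) \<le> exp (R * \<bar>Im z\<bar>) * B"
      using B(2)[OF t] by (intro mult_mono) simp_all
    then show "norm (exp (- \<i> * z * of_real t) * \<psi> t) \<le> B * exp (R * \<bar>Im z\<bar>)"
      by (simp add: norm_mult mult.commute)
  next
    show "continuous_on {-R..R} (\<lambda>t. exp (- \<i> * z * of_real t) * \<psi> t)"
      by (intro continuous_intros smooth1_continuous[OF sm])
    show "- R \<le> R" using assms by simp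
  qed
  then have "\<forall>z. norm (fourier_laplace \<psi> z) \<le> (B * (2 * R)) * exp (R * \<bar>Im z\<bar>)"
    by (simp add: mult.assoc mult.commute mult.left_commute)
  moreover have "0 \<le> B * (2 * R)" using B0 assms by simp
  ultimately show ?thesis by blast
qed

lemma fourier_laplace_vderiv: assumes "0 \<le> R" shows "fourier_laplace (vderiv \<psi>) z = \<i> * z * fourier_laplace \<psi> z"
proof -
  let ?e = "\<lambda>t::real. exp (- \<i> * z * of_real t)"
  have ce: "continuous_on A ?e" for A by (intro continuous_intros)
  have c0: "continuous_on A \<psi>" for A by (rule smooth1_continuous[OF sm])
  have c1: "continuous_on A (vderiv \<psi>)" for A by (rule smooth1_continuous[OF smooth1_vderiv[OF sm]])
  have e: "fourier_laplace (vderiv \<psi>) z = integral {-R..R} (\<lambda>t. ?e t * vderiv \<psi> t)"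
    unfolding fourier_laplace_def
    by (rule continuous_compact_support_integrable(2)) (simp_all only: vderiv_supp' mult_zero_right continuous_on_mult[OF ce c1])
  have d: "(?e has_vector_derivative (- \<i> * z) * ?e t) (at t within {-R..R})" for t
    by (rule has_vector_derivative_real_field[of "\<lambda>w. exp (- \<i> * z * w)"]) (auto intro!: derivative_eq_intros)
  have "((\<lambda>t. ?e t * \<psi> t) has_vector_derivative (?e t * vderiv \<psi> t + (- \<i> * z) * ?e t * \<psi> t)) (at t within {-R..R})" for t
    by (rule has_vector_derivative_mult[OF d has_vector_derivative_at_within[OF smooth1_has_vderiv[OF sm]]])
  \<comment> \<open>Integration by parts as the fundamental theorem for the product; both boundary
    terms vanish because \<open>\<psi>\<close> is zero at \<open>R\<close> and at
    \<open>-R\<close>.\<close>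
  then have "((\<lambda>t. ?e t * vderiv \<psi> t + (- \<i> * z) * ?e t * \<psi> t) has_integral (?e R * \<psi> R - ?e (-R) * \<psi> (-R))) {-R..R}"
    using assms by (intro fundamental_theorem_of_calculus) simp_all
  from integral_unique[OF this]
  have "integral {-R..R} (\<lambda>t. ?e t * vderiv \<psi> t + (- \<i> * z) * (?e t * \<psi> t)) = ?e R * \<psi> R - ?e (-R) * \<psi> (-R)"
    unfolding mult.assoc .
  also have "\<dots> = 0"
    using supp[of R] supp[of "-R"] by simp
  finally have 0: "integral {-R..R} (\<lambda>t. ?e t * vderiv \<psi> t + (- \<i> * z) * (?e t * \<psi> t)) = 0" .
  have "integral {-R..R} (\<lambda>t. ?e t * vderiv \<psi> t + (- \<i> * z) * (?e t * \<psi> t))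
     = integral {-R..R} (\<lambda>t. ?e t * vderiv \<psi> t) + integral {-R..R} (\<lambda>t. (- \<i> * z) * (?e t * \<psi> t))"
    by (intro integral_add integrable_continuous_real continuous_on_mult ce c0 c1 continuous_on_const)
  also have "integral {-R..R} (\<lambda>t. (- \<i> * z) * (?e t * \<psi> t)) = (- \<i> * z) * integral {-R..R} (\<lambda>t. ?e t * \<psi> t)"
    by (rule integral_mult_right)
  finally show ?thesis
    unfolding 0 unfolding e fourier_laplace_eq_integral by (simp add: add_eq_0_iff)
qed

end

text \<open>Two derivatives multiply the transform by a factor of modulus
  \<open>(norm z)\<^sup>2\<close>, which is at least \<open>(Re z)\<^sup>2\<close>. Adding the bound
  for the transform itself turns boundedness into decay like \<open>wt (Re z)\<close>.\<close>

lemma exp_kernel_fourier_laplace: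
  assumes sm: "smooth1 \<psi>" and supp: "\<And>t. R \<le> \<bar>t\<bar> \<Longrightarrow> \<psi> t = 0" and R: "0 \<le> R"
  shows "exp_kernel R (fourier_laplace \<psi>)"
proof -
  have s1: "smooth1 (vderiv \<psi>)" and s2: "smooth1 (vderiv (vderiv \<psi>))"
    by (intro smooth1_vderiv sm)+
  have z1: "vderiv \<psi> t = 0" if "R \<le> \<bar>t\<bar>" for t
    by (rule vderiv_supp'[OF sm _ that]) (rule supp)
  have z2: "vderiv (vderiv \<psi>) t = 0" if "R \<le> \<bar>t\<bar>" for t
    by (rule vderiv_supp'[OF s1 _ that]) (rule z1)
  have "\<exists>M\<ge>0. \<forall>z. norm (fourier_laplace \<psi> z) \<le> M * exp (R * \<bar>Im z\<bar>)"
    by (rule fourier_laplace_bound[OF sm _ R]) (rule supp)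
  then obtain M where M: "0 \<le> M" "\<And>z. norm (fourier_laplace \<psi> z) \<le> M * exp (R * \<bar>Im z\<bar>)"
    by blast
  have "\<exists>N\<ge>0. \<forall>z. norm (fourier_laplace (vderiv (vderiv \<psi>)) z) \<le> N * exp (R * \<bar>Im z\<bar>)"
    by (rule fourier_laplace_bound[OF s2 _ R]) (rule z2)
  then obtain N where N: "0 \<le> N" "\<And>z. norm (fourier_laplace (vderiv (vderiv \<psi>)) z) \<le> N * exp (R * \<bar>Im z\<bar>)"
    by blast
  have "norm (fourier_laplace \<psi> z) \<le> (M + N) * exp (R * \<bar>Im z\<bar>) * wt (Re z)" for z
  proof -
    have "fourier_laplace (vderiv (vderiv \<psi>)) z = (\<i> * z)\<^sup>2 * fourier_laplace \<psi> z"
    proof -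
      have "fourier_laplace (vderiv \<psi>) z = \<i> * z * fourier_laplace \<psi> z"
        by (rule fourier_laplace_vderiv[OF sm _ R]) (rule supp)
      moreover have "fourier_laplace (vderiv (vderiv \<psi>)) z = \<i> * z * fourier_laplace (vderiv \<psi>) z"
        by (rule fourier_laplace_vderiv[OF s1 _ R]) (rule z1)
      ultimately show ?thesis by (simp only: power2_eq_square mult.assoc)
    qed
    then have n: "(norm z)\<^sup>2 * norm (fourier_laplace \<psi> z) \<le> N * exp (R * \<bar>Im z\<bar>)"
      using N(2)[of z] by (simp add: norm_mult norm_power)
    have "(Re z)\<^sup>2 \<le> (norm z)\<^sup>2" by (simp add: cmod_power2)
    then have "(1 + (Re z)\<^sup>2) * norm (fourier_laplace \<psi> z) \<le> norm (fourier_laplace \<psi> z) + (norm z)\<^sup>2 * norm (fourier_laplace \<psi> z)"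
      by (simp add: distrib_right mult_right_mono)
    also have "\<dots> \<le> (M + N) * exp (R * \<bar>Im z\<bar>)"
      using M(2)[of z] n by (simp add: algebra_simps)
    finally have *: "(1 + (Re z)\<^sup>2) * norm (fourier_laplace \<psi> z) \<le> (M + N) * exp (R * \<bar>Im z\<bar>)" .
    have pos: "0 < 1 + (Re z)\<^sup>2" by (simp add: add_pos_nonneg)
    show ?thesis unfolding wt_def times_divide_eq_right pos_le_divide_eq[OF pos] 
      using * by (simp only: mult_1_right mult.commute)
  qed
  then show ?thesis
    unfolding exp_kernel_def using add_nonneg_nonneg[OF M(1) N(1)] fourier_laplace_holomorphic[OF sm] supp by blast
qed

section \<open>Exact exponential type and families bounded by Hoelder's inequality\<close>

text \<open>Phragmen-Lindeloef on the upper half-plane: the quotient of \<open>h(w) exp(i (\<sigma> + e) w)\<close> by \<open>1 - i d w\<close> tends to 0 at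
  infinity, so the maximum principle applies on half discs; then \<open>d\<close> and \<open>e\<close> tend to 0.\<close>

lemma exact_type_upper:
  assumes holo: "h holomorphic_on UNIV" and M: "\<And>x. norm (h (of_real x)) \<le> M"
    and ty: "\<And>e. 0 < e \<Longrightarrow> \<exists>C. \<forall>z. norm (h z) \<le> C * exp ((\<sigma> + e) * \<bar>Im z\<bar>)"
    and z: "0 \<le> Im z"
  shows "norm (h z) \<le> (M + 1) * exp (\<sigma> * Im z)"
proof -
  have M0: "0 \<le> M" using M[of 0] norm_ge_zero order_trans by blast
  have main: "norm (h z) \<le> (M + 1) * exp ((\<sigma> + e) * Im z)" if e: "0 < e" for e
  proof -
    obtain C where C: "\<And>z. norm (h z) \<le> C * exp ((\<sigma> + e) * \<bar>Im z\<bar>)" using ty[OF e] by blast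
    define s where "s = \<sigma> + e"
    define g where "g w = h w * exp (\<i> * of_real s * w)" for w
    have ng: "norm (g w) = norm (h w) * exp (- s * Im w)" for w
      unfolding g_def norm_mult norm_exp_eq_Re by simp
    have gC: "norm (g w) \<le> C" if "0 \<le> Im w" for w
    proof -
      have "norm (g w) \<le> (C * exp (s * Im w)) * exp (- s * Im w)"
        unfolding ng using C[of w] that by (intro mult_right_mono) (simp_all add: s_def)
      also have "\<dots> = C" by (simp add: mult.assoc flip: exp_add)
      finally show ?thesis .
    qed
    have gM: "norm (g w) \<le> M" if "Im w = 0" for w
    proof -
      have "w = of_real (Re w)" using that by (simp add: complex_eq_iff)
      then show ?thesis using M[of "Re w"] that by (simp add: ng)
    qed
    have C0: "0 \<le> C" using order_trans[OF norm_ge_zero gC[of 0]] by simp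
    have hg: "g holomorphic_on A" for A
      unfolding g_def by (intro holomorphic_intros holomorphic_on_subset[OF holo]) auto
    have "norm (g z) \<le> (M + 1) * norm (1 - \<i> * of_real d * z)" if d: "0 < d" for d
    proof -
      \<comment> \<open>The summand \<open>C / d\<close> makes the linear factor at least
        \<open>C\<close> on the arc, since its modulus there is at least \<open>d * r\<close>; the
        summand \<open>norm z\<close> keeps \<open>z\<close> inside the half disc.\<close>
      define r where "r = norm z + C / d + 1"
      have r: "norm z \<le> r" "0 < r" "C \<le> d * r"
      proof -
        have "0 \<le> norm z" "0 \<le> C / d" "d * (C / d) = C" using C0 d by simp_all
        moreover have "0 \<le> d * norm z" using d by simp
        ultimately show "norm z \<le> r" "0 < r" "C \<le> d * r"
          using d unfolding r_def distrib_left by linarith+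
      qed
      let ?D = "\<lambda>w. 1 - \<i> * of_real d * w"
      have D1: "1 \<le> norm (?D w)" if "0 \<le> Im w" for w
      proof -
        have "Re (?D w) = 1 + d * Im w" by simp
        then have "1 \<le> Re (?D w)" using d that by simp
        then show ?thesis using complex_Re_le_cmod order_trans by blast
      qed
      have Dr: "d * norm w \<le> norm (?D w)" if "0 \<le> Im w" for w
      proof -
        have "(d * norm w)\<^sup>2 \<le> (norm (?D w))\<^sup>2"
        proof -
          have "(norm (?D w))\<^sup>2 = (1 + d * Im w)\<^sup>2 + (d * Re w)\<^sup>2"
            unfolding cmod_power2 by simp
          moreover have "0 \<le> d * Im w" using d that by simp
          ultimately show ?thesis
            by (simp add: power_mult_distrib cmod_power2 power2_sum distrib_left)
        qed
        then show ?thesis by (rule power2_le_imp_le) simp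
      qed
      define S where "S = cball (0::complex) r \<inter> {w. 0 \<le> Im w}"
      have clS: "closed S" unfolding S_def by (intro closed_Int closed_cball closed_halfspace_Im_ge)
      have fr: "norm w = r \<or> Im w = 0" "0 \<le> Im w" if "w \<in> frontier S" for w
      proof -
        have "open (ball (0::complex) r \<inter> {w. 0 < Im w})"
          by (intro open_Int open_ball open_halfspace_Im_gt)
        then have "ball (0::complex) r \<inter> {w. 0 < Im w} \<subseteq> interior S"
          by (intro interior_maximal) (auto simp: S_def)
        moreover have w: "w \<in> S" "w \<notin> interior S"
          using that clS by (auto simp: frontier_def)
        ultimately show "norm w = r \<or> Im w = 0" "0 \<le> Im w" unfolding S_def by force+
      qed
      \<comment> \<open>The quotient is at most \<open>M\<close> on the real segment and at most 1
        on the arc; \<open>M + 1\<close> serves for both.\<close>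
      have "norm (g z / ?D z) \<le> M + 1"
      proof (rule maximum_modulus_frontier[where S=S and f="\<lambda>w. g w / ?D w"])
        have nz: "?D w \<noteq> 0" if "w \<in> S" for w using D1[of w] that by (auto simp: S_def)
        show "(\<lambda>w. g w / ?D w) holomorphic_on interior S"
          using nz interior_subset by (intro holomorphic_intros hg) blast
        have "(\<lambda>w. g w / ?D w) holomorphic_on S"
          using nz by (intro holomorphic_intros hg) blast
        then show "continuous_on (closure S) (\<lambda>w. g w / ?D w)"
          using clS by (simp add: holomorphic_on_imp_continuous_on)
        show "bounded S" unfolding S_def by (intro bounded_Int) auto
        show "z \<in> S" using r z by (simp add: S_def)
        fix w assume w: "w \<in> frontier S"
        note f = fr[OF w]
        from f(1) show "norm (g w / ?D w) \<le> M + 1"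
        proof
          assume "Im w = 0"
          then have "norm (g w) \<le> M * norm (?D w)"
            using mult_mono[OF gM[of w] D1[of w]] M0 by simp
          then have "norm (g w / ?D w) \<le> M"
            using D1[OF f(2)] M0 by (simp add: norm_divide divide_le_eq)
          then show ?thesis by simp
        next
          assume "norm w = r"
          then have "C \<le> norm (?D w)" using r Dr[OF f(2)] by simp
          then have "norm (g w) \<le> norm (?D w)" using gC[OF f(2)] by simp
          then have "norm (g w / ?D w) \<le> 1"
            using D1[OF f(2)] by (simp add: norm_divide divide_le_eq)
          then show ?thesis using M0 by simp
        qed
      qed
      moreover have "0 < norm (?D z)" by (rule order.strict_trans2[OF zero_less_one D1[OF z]])
      ultimately show ?thesis by (simp only: norm_divide pos_divide_le_eq)
    qed
    then have "\<forall>\<^sub>F d in at_right 0. norm (g z) \<le> (M + 1) * norm (1 - \<i> * of_real d * z)"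
      by (auto simp: eventually_at_right_field intro!: exI[of _ 1])
    moreover have "((\<lambda>d. (M + 1) * norm (1 - \<i> * of_real d * z)) \<longlongrightarrow> (M + 1) * norm (1 - \<i> * of_real 0 * z)) (at_right 0)"
      by (intro tendsto_intros)
    ultimately have "norm (g z) \<le> (M + 1) * norm (1 - \<i> * of_real 0 * z)"
      by (intro tendsto_lowerbound) auto
    then have "norm (h z) * exp (- s * Im z) \<le> M + 1" by (simp add: ng)
    then have "norm (h z) * exp (- s * Im z) * exp (s * Im z) \<le> (M + 1) * exp (s * Im z)"
      by (intro mult_right_mono) auto
    moreover have "exp (- s * Im z) * exp (s * Im z) = 1" by (simp flip: exp_add)
    ultimately show ?thesis by (simp only: mult.assoc s_def mult_1_right)
  qed
  then have "\<forall>\<^sub>F e in at_right 0. norm (h z) \<le> (M + 1) * exp ((\<sigma> + e) * Im z)"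
    by (auto simp: eventually_at_right_field intro!: exI[of _ 1])
  moreover have "((\<lambda>e. (M + 1) * exp ((\<sigma> + e) * Im z)) \<longlongrightarrow> (M + 1) * exp ((\<sigma> + 0) * Im z)) (at_right 0)"
    by (intro tendsto_intros)
  ultimately have "norm (h z) \<le> (M + 1) * exp ((\<sigma> + 0) * Im z)"
    by (intro tendsto_lowerbound) auto
  then show ?thesis by simp
qed

text \<open>The reflection that sends w to -w preserves all hypotheses and exchanges the two
  half-planes.\<close>

lemma exact_type:
  assumes holo: "h holomorphic_on UNIV" and M: "\<And>x. norm (h (of_real x)) \<le> M"
    and ty: "\<And>e. 0 < e \<Longrightarrow> \<exists>C. \<forall>z. norm (h z) \<le> C * exp ((\<sigma> + e) * \<bar>Im z\<bar>)"
  shows "norm (h z) \<le> (M + 1) * exp (\<sigma> * \<bar>Im z\<bar>)"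
proof (cases "0 \<le> Im z")
  case True
  then show ?thesis using exact_type_upper[of h M \<sigma> z] assms by simp
next
  case False
  have "norm (h (- (- z))) \<le> (M + 1) * exp (\<sigma> * Im (- z))"
  proof (rule exact_type_upper[where h="\<lambda>w. h (- w)"])
    show "(\<lambda>w. h (- w)) holomorphic_on UNIV"
      using holomorphic_on_compose_gen[of uminus UNIV h UNIV] holo
      by (simp add: o_def holomorphic_on_minus[OF holomorphic_on_ident])
    show "norm (h (- complex_of_real x)) \<le> M" for x using M[of "- x"] by simp
    fix e :: real assume "0 < e"
    from ty[OF this] obtain C where "\<And>z. norm (h z) \<le> C * exp ((\<sigma> + e) * \<bar>Im z\<bar>)" by blast
    then have "norm (h (- z)) \<le> C * exp ((\<sigma> + e) * \<bar>Im z\<bar>)" for z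
      by (metis abs_minus_cancel uminus_complex.simps(2))
    then show "\<exists>C. \<forall>z. norm (h (- z)) \<le> C * exp ((\<sigma> + e) * \<bar>Im z\<bar>)" by blast
  qed (use False in simp)
  then show ?thesis using False by simp
qed

text \<open>The free parameter \<open>e\<close> lets the tail of the first sum control the product uniformly in \<open>W\<close>.\<close>

lemma holder_sum_le:
  fixes A W :: "'i \<Rightarrow> real"
  assumes pq: "1 < p" "1 < q" "1 / p + 1 / q = 1"
    and nn: "\<And>i. 0 \<le> A i" "\<And>i. 0 \<le> W i" and e: "0 < e"
  shows "(\<Sum>i\<in>X. A i * W i) \<le> e powr (- p) * (\<Sum>i\<in>X. A i powr p) + e powr q * (\<Sum>i\<in>X. W i powr q)"
  unfolding sum_distrib_left sum.distrib[symmetric]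
proof (rule sum_mono)
  fix i
  have "A i * W i = (A i / e) * (e * W i)" using e by simp
  also have "\<dots> \<le> (A i / e) powr p / p + (e * W i) powr q / q"
    using pq nn e by (intro Youngs_inequality) auto
  also have "\<dots> \<le> (A i / e) powr p + (e * W i) powr q"
    using pq by (intro add_mono) (simp_all add: divide_le_eq mult_le_cancel_left1)
  also have "\<dots> = e powr (- p) * A i powr p + e powr q * W i powr q"
    using nn e by (simp add: powr_divide powr_mult powr_minus divide_inverse inverse_powr mult.commute)
  finally show "A i * W i \<le> e powr (- p) * A i powr p + e powr q * W i powr q" .
qed

section \<open>Uniform tails of families controlled by Hoelder's inequality\<close>

lemma summable_on_tail:
  fixes f :: "'i \<Rightarrow> real"
  assumes f: "f summable_on I" and nn: "\<And>i. 0 \<le> f i" and e: "0 < e"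
  obtains X0 where "finite X0" "X0 \<subseteq> I" "\<And>X. finite X \<Longrightarrow> X \<subseteq> I - X0 \<Longrightarrow> sum f X \<le> e"
proof -
  obtain X0 where X0: "finite X0" "X0 \<subseteq> I" "dist (sum f X0) (infsum f I) \<le> e"
    using has_sum_finite_approximation[OF has_sum_infsum[OF f] e] by blast
  have "sum f X \<le> e" if "finite X" "X \<subseteq> I - X0" for X
  proof -
    have "sum f X0 + sum f X = sum f (X0 \<union> X)"
      using X0 that by (intro sum.union_disjoint[symmetric]) auto
    also have "\<dots> \<le> infsum f I"
      using X0 that f nn by (intro finite_sum_le_infsum) auto
    finally show ?thesis using X0(3) by (simp add: dist_real_def)
  qed
  with X0 show ?thesis using that by blast
qed

context
  fixes p q B :: real and A :: "'i \<Rightarrow> real" and W :: "'z \<Rightarrow> 'i \<Rightarrow> real" and I :: "'i set" and S :: "'z set"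
  assumes pq: "1 < p" "1 < q" "1 / p + 1 / q = 1"
    and A0: "\<And>i. 0 \<le> A i" and W0: "\<And>z i. 0 \<le> W z i"
    and As: "(\<lambda>i. A i powr p) summable_on I"
    and Wb: "\<And>z X. z \<in> S \<Longrightarrow> finite X \<Longrightarrow> X \<subseteq> I \<Longrightarrow> (\<Sum>i\<in>X. W z i powr q) \<le> B"
begin

lemma holder_family_bounded:
  assumes "z \<in> S" "finite X" "X \<subseteq> I"
  shows "(\<Sum>i\<in>X. A i * W z i) \<le> infsum (\<lambda>i. A i powr p) I + B"
proof -
  have "(\<Sum>i\<in>X. A i * W z i) \<le> (\<Sum>i\<in>X. A i powr p) + (\<Sum>i\<in>X. W z i powr q)"
    using holder_sum_le[OF pq A0 W0 zero_less_one, where X=X] by simp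
  also have "(\<Sum>i\<in>X. A i powr p) \<le> infsum (\<lambda>i. A i powr p) I"
    using assms by (intro finite_sum_le_infsum As) auto
  also have "(\<Sum>i\<in>X. W z i powr q) \<le> B" using assms by (rule Wb)
  finally show ?thesis by simp
qed

lemma holder_family_summable:
  assumes "z \<in> S"
  shows "(\<lambda>i. A i * W z i) summable_on I"
  by (rule nonneg_bdd_above_summable_on)
     (use holder_family_bounded[OF assms] in \<open>auto simp: A0 W0 bdd_above_def\<close>)

lemma holder_family_tail:
  assumes e: "0 < e"
  obtains X0 where "finite X0" "X0 \<subseteq> I"
    "\<And>z X. z \<in> S \<Longrightarrow> finite X \<Longrightarrow> X \<subseteq> I - X0 \<Longrightarrow> (\<Sum>i\<in>X. A i * W z i) \<le> e"
proof -
  \<comment> \<open>The order of choices matters: \<open>d\<close> is fixed by the bound alone, so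
    that the \<open>W\<close> part is at most \<open>e / 2\<close> for every \<open>X\<close> and
    \<open>z\<close>, and only then is the tail of \<open>A i powr p\<close> made small relative to
    \<open>d powr p\<close>. The maximum with 1 keeps the divisor positive.\<close>
  define B' where "B' = max B 1"
  have B': "0 < B'" "B \<le> B'" by (auto simp: B'_def)
  define d where "d = (e / (2 * B')) powr (1 / q)"
  have d: "0 < d" "d powr q * B' = e / 2"
    using e B' pq by (auto simp: d_def powr_powr)
  obtain X0 where X0: "finite X0" "X0 \<subseteq> I"
    "\<And>X. finite X \<Longrightarrow> X \<subseteq> I - X0 \<Longrightarrow> (\<Sum>i\<in>X. A i powr p) \<le> d powr p * (e / 2)"
    using summable_on_tail[OF As, of "d powr p * (e / 2)"] d e by auto
  have "(\<Sum>i\<in>X. A i * W z i) \<le> e" if "z \<in> S" "finite X" "X \<subseteq> I - X0" for z X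
  proof -
    have "(\<Sum>i\<in>X. A i * W z i) \<le> d powr (- p) * (\<Sum>i\<in>X. A i powr p) + d powr q * (\<Sum>i\<in>X. W z i powr q)"
      by (rule holder_sum_le[OF pq A0 W0 d(1)])
    also have "d powr (- p) * (\<Sum>i\<in>X. A i powr p) \<le> d powr (- p) * (d powr p * (e / 2))"
      using X0(3) that by (intro mult_left_mono) auto
    also have "d powr (- p) * (d powr p * (e / 2)) = e / 2"
      using d by (simp add: powr_minus)
    also have "d powr q * (\<Sum>i\<in>X. W z i powr q) \<le> d powr q * B'"
      using Wb[of z X] that B' by (intro mult_left_mono) (auto intro: order_trans)
    finally show ?thesis using d(2) by simp
  qed
  then show ?thesis using that X0 by blast
qed

context
  fixes a :: "'i \<Rightarrow> 'z \<Rightarrow> complex"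
  assumes aW: "\<And>z i. z \<in> S \<Longrightarrow> i \<in> I \<Longrightarrow> norm (a i z) \<le> A i * W z i"
begin

lemma holder_family_abs_summable: "z \<in> S \<Longrightarrow> (\<lambda>i. norm (a i z)) summable_on I"
  using aW by (intro Infinite_Sum.abs_summable_on_comparison_test'[OF holder_family_summable]) auto

lemma holder_family_bound:
  assumes "z \<in> S"
  shows "norm (infsum (\<lambda>i. a i z) I) \<le> infsum (\<lambda>i. A i powr p) I + B"
proof -
  have "norm (infsum (\<lambda>i. a i z) I) \<le> infsum (\<lambda>i. A i * W z i) I"
    by (rule norm_infsum_le[OF has_sum_infsum[OF abs_summable_summable[OF holder_family_abs_summable[OF assms]]]
       has_sum_infsum[OF holder_family_summable[OF assms]] aW[OF assms]])
  also have "\<dots> \<le> infsum (\<lambda>i. A i powr p) I + B"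
    by (intro infsum_le_finite_sums holder_family_summable holder_family_bounded assms)
  finally show ?thesis .
qed

text \<open>In the applications \<open>W\<close> is a profile that travels with \<open>z\<close>, so
  on a strip there is no summable majorant independent of \<open>z\<close> and the Weierstrass test
  does not apply. Uniformity comes from the tail of \<open>A\<close> alone, which one finite set
  \<open>X0\<close> controls for all \<open>z\<close>.\<close>

lemma holder_family_uniform_limit:
  "uniform_limit S (\<lambda>X z. \<Sum>i\<in>X. a i z) (\<lambda>z. infsum (\<lambda>i. a i z) I) (finite_subsets_at_top I)"
proof (rule uniform_limitI)
  fix e :: real assume "0 < e"
  then have e: "0 < e / 2" by simp
  obtain X0 where X0: "finite X0" "X0 \<subseteq> I"
    "\<And>z X. z \<in> S \<Longrightarrow> finite X \<Longrightarrow> X \<subseteq> I - X0 \<Longrightarrow> (\<Sum>i\<in>X. A i * W z i) \<le> e / 2"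
    using holder_family_tail[OF e] by blast
  have "dist (\<Sum>i\<in>X. a i z) (infsum (\<lambda>i. a i z) I) < e"
    if X: "finite X" "X0 \<subseteq> X" "X \<subseteq> I" and z: "z \<in> S" for X z
  proof -
    note s = abs_summable_summable[OF holder_family_abs_summable[OF z]]
    have s1: "((\<lambda>i. a i z) has_sum (infsum (\<lambda>i. a i z) I - (\<Sum>i\<in>X. a i z))) (I - X)"
      using X by (intro has_sum_Diff has_sum_infsum s has_sum_finite) auto
    have s2: "(\<lambda>i. A i * W z i) summable_on (I - X)"
      using holder_family_summable[OF z] by (rule summable_on_subset_banach) auto
    have "norm (infsum (\<lambda>i. a i z) I - (\<Sum>i\<in>X. a i z)) \<le> infsum (\<lambda>i. A i * W z i) (I - X)"
      by (rule norm_infsum_le[OF s1 has_sum_infsum[OF s2]]) (use aW[OF z] in auto)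
    also have "\<dots> \<le> e / 2"
      using X X0 z by (intro infsum_le_finite_sums s2 X0(3)) auto
    also have "\<dots> < e" using e by simp
    finally show ?thesis by (simp add: dist_norm norm_minus_commute)
  qed
  then show "\<forall>\<^sub>F X in finite_subsets_at_top I. \<forall>z\<in>S. dist (\<Sum>i\<in>X. a i z) (infsum (\<lambda>i. a i z) I) < e"
    unfolding eventually_finite_subsets_at_top using X0(1,2) by blast
qed

end
end

section \<open>Sampling in one variable\<close>

definition csinc :: "complex \<Rightarrow> complex" where
  "csinc z = (if z = 0 then 1 else sin (of_real pi * z) / (of_real pi * z))"

text \<open>\<open>csinc\<close> is the difference quotient at 0 of sin(pi z)/pi, whose derivative
  there is 1, so the singularity is removable.\<close>

lemma csinc_holomorphic: "csinc holomorphic_on A"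
proof -
  let ?f = "\<lambda>z. sin (of_real pi * z) / complex_of_real pi"
  have "(?f has_field_derivative cos (of_real pi * 0)) (at 0)"
    by (auto intro!: derivative_eq_intros)
  then have d: "deriv ?f 0 = 1" by (simp add: DERIV_imp_deriv)
  have "(\<lambda>z. if z = 0 then deriv ?f 0 else (?f z - ?f 0) / (z - 0)) holomorphic_on UNIV"
    by (rule pole_lemma) (auto intro!: holomorphic_intros)
  moreover have "(\<lambda>z. if z = 0 then deriv ?f 0 else (?f z - ?f 0) / (z - 0)) = csinc"
    unfolding d by (auto simp: csinc_def fun_eq_iff)
  ultimately show ?thesis by (metis holomorphic_on_subset subset_UNIV)
qed

lemma csinc_mult: "of_real pi * z * csinc z = sin (of_real pi * z)"
  by (auto simp: csinc_def)

lemma sin_pi_int [simp]: "sin (complex_of_real pi * of_int m) = 0"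
proof -
  have "complex_of_real pi * of_int m = of_real (of_int m * pi)" by simp
  then show ?thesis unfolding sin_eq_0 by blast
qed

lemma csinc_0 [simp]: "csinc 0 = 1" by (simp add: csinc_def)

lemma csinc_int [simp]: "m \<noteq> 0 \<Longrightarrow> csinc (of_int m) = 0"
  by (simp add: csinc_def)

lemma norm_sin_sq_le: "(norm (sin z))\<^sup>2 \<le> (exp \<bar>Im z\<bar>)\<^sup>2"
proof -
  have "exp (2 * Im z) \<le> exp (2 * \<bar>Im z\<bar>)" "exp (- 2 * Im z) \<le> exp (2 * \<bar>Im z\<bar>)"
    "1 \<le> exp (2 * \<bar>Im z\<bar>)" "- 1 \<le> cos (2 * Re z)" by auto
  then show ?thesis
  proof -
    assume a: "exp (2 * Im z) \<le> exp (2 * \<bar>Im z\<bar>)" "exp (- 2 * Im z) \<le> exp (2 * \<bar>Im z\<bar>)"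
      "1 \<le> exp (2 * \<bar>Im z\<bar>)" "- 1 \<le> cos (2 * Re z)"
    define E where "E = exp (2 * \<bar>Im z\<bar>)"
    have "(norm (sin z))\<^sup>2 \<le> E"
    proof -
      have "(X + Y - 2 * c) / 4 \<le> E" if "X \<le> E" "Y \<le> E" "1 \<le> E" "- 1 \<le> c" for X Y c :: real
        using that by simp
      from this[OF a[folded E_def]] show ?thesis
        unfolding norm_sin_squared by (simp add: exp_minus)
    qed
    then show ?thesis by (simp add: E_def exp_double)
  qed
qed

lemma norm_sin_le': "norm (sin z) \<le> exp \<bar>Im z\<bar>"
  using norm_sin_sq_le by (rule power2_le_imp_le) simp

text \<open>Compactness covers the unit disc with the removable singularity; outside it the sine
  bound is divided by pi |z|, which exceeds 1 + |Re z|.\<close>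

lemma csinc_bound:
  obtains C where "1 \<le> C" "\<And>z. norm (csinc z) \<le> C * exp (pi * \<bar>Im z\<bar>) / (1 + \<bar>Re z\<bar>)"
proof -
  have "compact (csinc ` cball 0 1)"
    by (intro compact_continuous_image holomorphic_on_imp_continuous_on csinc_holomorphic) simp
  then obtain B where B: "0 < B" "\<And>z. norm z \<le> 1 \<Longrightarrow> norm (csinc z) \<le> B"
    using compact_imp_bounded[of "csinc ` cball 0 1"] unfolding bounded_pos by auto
  define C where "C = max 1 (2 * B)"
  have C: "1 \<le> C" "2 * B \<le> C" by (auto simp: C_def)
  have "(1 + \<bar>Re z\<bar>) * norm (csinc z) \<le> C * exp (pi * \<bar>Im z\<bar>)" for z
  proof (cases "norm z \<le> 1")
    case True
    have "1 + \<bar>Re z\<bar> \<le> 2" using abs_Re_le_cmod[of z] True by simp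
    then have "(1 + \<bar>Re z\<bar>) * norm (csinc z) \<le> 2 * B"
      using B(2)[OF True] by (intro mult_mono) auto
    also have "\<dots> \<le> C * 1" using C by simp
    also have "\<dots> \<le> C * exp (pi * \<bar>Im z\<bar>)" using C by (intro mult_left_mono) auto
    finally show ?thesis .
  next
    case False
    have "1 + \<bar>Re z\<bar> \<le> 2 * norm z" using abs_Re_le_cmod[of z] False by simp
    also have "\<dots> \<le> pi * norm z" using pi_ge_two by (intro mult_right_mono) auto
    finally have "(1 + \<bar>Re z\<bar>) * norm (csinc z) \<le> (pi * norm z) * norm (csinc z)"
      by (rule mult_right_mono) simp
    also have "\<dots> = norm (sin (of_real pi * z))"
      by (simp add: norm_mult flip: csinc_mult)
    also have "\<dots> \<le> exp (pi * \<bar>Im z\<bar>)"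
      using norm_sin_le'[of "of_real pi * z"] by (simp add: abs_mult)
    also have "\<dots> \<le> C * exp (pi * \<bar>Im z\<bar>)" using C by simp
    finally show ?thesis .
  qed
  then have "norm (csinc z) \<le> C * exp (pi * \<bar>Im z\<bar>) / (1 + \<bar>Re z\<bar>)" for z
    by (simp add: pos_le_divide_eq mult.commute)
  with C show ?thesis using that by blast
qed

text \<open>For \<open>l\<close> = 0 and \<open>l\<close> = 1 these are the Hermite cardinal
  functions: value 1, respectively derivative 1, at the origin, while all other values and first
  derivatives at integers vanish.\<close>

definition sampling_kernel :: "nat \<Rightarrow> complex \<Rightarrow> complex" where "sampling_kernel l z = z ^ l * (csinc z)\<^sup>2"

lemma sampling_kernel_holomorphic: "sampling_kernel l holomorphic_on A"
  unfolding sampling_kernel_def by (intro holomorphic_intros csinc_holomorphic)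

text \<open>For \<open>l\<close> = 1 the factor z uses up one of the two powers of decay. What
  remains is not summable over the integers, which is why the series has to be controlled by
  Hoelder's inequality against the samples.\<close>

lemma sampling_kernel_bound:
  obtains C where "0 \<le> C" 
    "\<And>l z. l \<le> 1 \<Longrightarrow> norm (sampling_kernel l z) \<le> C * exp (2 * pi * \<bar>Im z\<bar>) / (1 + \<bar>Re z\<bar>)"
proof -
  obtain C where C: "1 \<le> C" "\<And>z. norm (csinc z) \<le> C * exp (pi * \<bar>Im z\<bar>) / (1 + \<bar>Re z\<bar>)"
    using csinc_bound by blast
  have "norm (sampling_kernel l z) \<le> C * C * exp (2 * pi * \<bar>Im z\<bar>) / (1 + \<bar>Re z\<bar>)" if "l \<le> 1" for l z
  proof -
    let ?e = "exp (pi * \<bar>Im z\<bar>)"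
    have "norm (z ^ l * csinc z) \<le> C * ?e"
    proof (cases "l = 0")
      case True
      have "C * ?e / (1 + \<bar>Re z\<bar>) \<le> C * ?e / 1"
        using C by (intro divide_left_mono) auto
      then show ?thesis using C(2)[of z] True by simp
    next
      case False
      then have l: "l = 1" using that by simp
      have "pi * norm (z * csinc z) = norm (sin (of_real pi * z))"
        by (simp add: norm_mult flip: csinc_mult)
      also have "\<dots> \<le> ?e"
        using norm_sin_le'[of "of_real pi * z"] by (simp add: abs_mult)
      finally have "pi * norm (z * csinc z) \<le> ?e" .
      moreover have "1 * norm (z * csinc z) \<le> pi * norm (z * csinc z)"
        using pi_ge_two by (intro mult_right_mono) auto
      moreover have "1 * ?e \<le> C * ?e" using C by (intro mult_right_mono) auto
      ultimately have "norm (z * csinc z) \<le> C * ?e" unfolding mult_1 by (meson order_trans)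
      then show ?thesis using l by simp
    qed
    then have "norm (z ^ l * csinc z) * norm (csinc z) \<le> (C * ?e) * (C * ?e / (1 + \<bar>Re z\<bar>))"
      using C by (intro mult_mono) auto
    also have "\<dots> = C * C * (?e * ?e) / (1 + \<bar>Re z\<bar>)" by simp
    also have "?e * ?e = exp (2 * pi * \<bar>Im z\<bar>)" by (simp flip: exp_add)
    finally show ?thesis by (simp add: sampling_kernel_def norm_mult power2_eq_square mult.assoc)
  qed
  then show ?thesis using that[of "C * C"] C by simp
qed

lemma sampling_kernel_int: "m \<noteq> 0 \<Longrightarrow> sampling_kernel l (of_int m) = 0"
  by (simp add: sampling_kernel_def)

lemma sampling_kernel_0: "sampling_kernel l 0 = (if l = 0 then 1 else 0)"
  by (simp add: sampling_kernel_def)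

text \<open>\<open>csinc\<close> is even.\<close>

lemma deriv_sinc_0: "deriv csinc 0 = 0"
proof -
  have d: "(csinc has_field_derivative deriv csinc 0) (at (- 0))"
    using csinc_holomorphic[of UNIV] by (simp add: holomorphic_derivI)
  have "((\<lambda>z. csinc (- z)) has_field_derivative deriv csinc 0 * (- 1)) (at 0)"
    by (rule DERIV_chain2[where f=csinc and g=uminus and x=0, OF d]) (auto intro!: derivative_eq_intros)
  moreover have "(\<lambda>z. csinc (- z)) = csinc" by (auto simp: csinc_def)
  ultimately have "(csinc has_field_derivative - deriv csinc 0) (at 0)" by simp
  with d have "deriv csinc 0 = - deriv csinc 0" by (simp add: DERIV_unique)
  then show ?thesis by simp
qed

lemma sampling_kernel_deriv_int:
  "(sampling_kernel l has_field_derivative (if l = 1 \<and> m = 0 then 1 else 0)) (at (of_int m))" if "l \<le> 1"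
proof -
  have d: "(csinc has_field_derivative deriv csinc (of_int m)) (at (of_int m))"
    using csinc_holomorphic[of UNIV] by (simp add: holomorphic_derivI)
  have *: "(sampling_kernel l has_field_derivative (of_nat l * of_int m ^ (l - 1) * (csinc (of_int m))\<^sup>2 
      + of_int m ^ l * (2 * csinc (of_int m) * deriv csinc (of_int m)))) (at (of_int m))"
    unfolding sampling_kernel_def by (auto intro!: derivative_eq_intros d)
  have "(of_nat l * of_int m ^ (l - 1) * (csinc (of_int m))\<^sup>2 
      + of_int m ^ l * (2 * csinc (of_int m) * deriv csinc (of_int m))) = (if l = 1 \<and> m = 0 then 1 else 0)"
    using that by (cases "m = 0"; cases "l = 0") (auto simp: deriv_sinc_0 le_Suc_eq)
  with * show ?thesis by simp
qed

section \<open>Division by the sine, and bounds propagated from a grid\<close>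

text \<open>The zeros of the sine are simple. Near an integer \<open>z0\<close> both functions are
  divided by \<open>z - z0\<close>; the quotient of the sine has no zero in the unit disc around
  \<open>z0\<close>, because that disc contains no other integer. At the integers \<open>G\<close>
  takes the value given by l'Hopital's rule.\<close>

lemma divide_sin_pi:
  assumes F: "F holomorphic_on UNIV" and z: "\<And>m::int. F (of_int m) = 0"
  obtains G where "G holomorphic_on UNIV" "\<And>z. F z = sin (of_real pi * z) * G z"
proof -
  define G where "G z = (if z \<in> \<int> then deriv F z / (of_real pi * cos (of_real pi * z)) else F z / sin (of_real pi * z))" for z
  have sin0: "sin (of_real pi * z) = 0 \<longleftrightarrow> z \<in> \<int>" for z :: complex
  proof
    assume "sin (of_real pi * z) = 0"
    then obtain n :: int where "of_real pi * z = of_real (n * pi)" using sin_eq_0 by blast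
    then have "z = of_int n" by (simp add: mult.commute)
    then show "z \<in> \<int>" by simp
  qed (auto elim!: Ints_cases)
  have "G field_differentiable at z0" for z0
  proof (cases "z0 \<in> \<int>")
    case False
    have "(\<lambda>z. F z / sin (of_real pi * z)) holomorphic_on - \<int>"
      using sin0 by (intro holomorphic_intros holomorphic_on_subset[OF F]) auto
    then have "G holomorphic_on - \<int>"
      by (rule holomorphic_transform) (auto simp: G_def)
    moreover have "open (- \<int> :: complex set)" using closed_Ints by (rule open_Compl)
    ultimately show ?thesis using False by (simp add: holomorphic_on_imp_differentiable_at)
  next
    case True
    then obtain m :: int where m: "z0 = of_int m" by (auto elim: Ints_cases)
    let ?s = "\<lambda>z. sin (of_real pi * z) :: complex"
    let ?F1 = "\<lambda>z. if z = z0 then deriv F z0 else (F z - F z0) / (z - z0)"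
    let ?S1 = "\<lambda>z. if z = z0 then deriv ?s z0 else (?s z - ?s z0) / (z - z0)"
    have "(?s has_field_derivative of_real pi * cos (of_real pi * z0)) (at z0)"
      by (auto intro!: derivative_eq_intros)
    then have ds: "deriv ?s z0 = of_real pi * cos (of_real pi * z0)" by (rule DERIV_imp_deriv)
    have "(?s z0)\<^sup>2 + (cos (of_real pi * z0))\<^sup>2 = 1" by (rule sin_cos_squared_add)
    then have c: "cos (of_real pi * z0) \<noteq> 0" using m by auto
    have F1: "?F1 holomorphic_on UNIV" by (rule pole_lemma) (use F in auto)
    have S1: "?S1 holomorphic_on UNIV" by (rule pole_lemma) (auto intro!: holomorphic_intros)
    have notint: "z \<notin> \<int>" if "z \<in> ball z0 1" "z \<noteq> z0" for z
    proof
      assume "z \<in> \<int>"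
      then obtain k :: int where k: "z = of_int k" by (auto elim: Ints_cases)
      then have "norm (of_int (k - m) :: complex) < 1" using that by (simp add: m dist_norm norm_minus_commute)
      then have "k = m" unfolding norm_of_int by simp
      then show False using that k m by simp
    qed
    have nz: "?S1 z \<noteq> 0" if "z \<in> ball z0 1" for z
    proof (cases "z = z0")
      case True
      then show ?thesis using c by (simp add: ds)
    next
      case False
      have "?s z0 = 0" using m by simp
      moreover have "?s z \<noteq> 0" using notint[OF that False] sin0[of z] by blast
      ultimately show ?thesis using False by simp
    qed
    have "(\<lambda>z. ?F1 z / ?S1 z) holomorphic_on ball z0 1"
      using nz by (intro holomorphic_on_divide holomorphic_on_subset[OF F1] holomorphic_on_subset[OF S1]) auto
    then have "G holomorphic_on ball z0 1"
    proof (rule holomorphic_transform)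
      fix w assume w: "w \<in> ball z0 1"
      have "F z0 = 0" "?s z0 = 0" using m z by simp_all
      show "?F1 w / ?S1 w = G w"
      proof (cases "w = z0")
        case True
        then show ?thesis using \<open>z0 \<in> \<int>\<close> by (simp add: G_def ds)
      next
        case False
        then show ?thesis using notint[OF w False] \<open>F z0 = 0\<close> \<open>?s z0 = 0\<close> by (simp add: G_def)
      qed
    qed
    then show ?thesis by (rule holomorphic_on_imp_differentiable_at) auto
  qed
  then have "G holomorphic_on UNIV" by (simp add: holomorphic_on_def field_differentiable_at_within)
  moreover have "F z = sin (of_real pi * z) * G z" for z
    using sin0[of z] assms(2) by (cases "z \<in> \<int>") (auto simp: G_def elim!: Ints_cases)
  ultimately show ?thesis using that by blast
qed

text \<open>After one division the derivative of the product at an integer m is pi cos(pi m) G(m).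
  Its vanishing forces G(m) = 0, so a second division is possible.\<close>

lemma divide_sin_pi_sq:
  assumes F: "F holomorphic_on UNIV" and z: "\<And>m::int. F (of_int m) = 0" and z': "\<And>m::int. deriv F (of_int m) = 0"
  obtains G where "G holomorphic_on UNIV" "\<And>z. F z = (sin (of_real pi * z))\<^sup>2 * G z"
proof -
  obtain G where G: "G holomorphic_on UNIV" "\<And>z. F z = sin (of_real pi * z) * G z"
    using divide_sin_pi[OF F z] by blast
  have "G (of_int m) = 0" for m :: int
  proof -
    let ?m = "of_int m :: complex"
    have "((\<lambda>z. sin (of_real pi * z) * G z) has_field_derivative 
       of_real pi * cos (of_real pi * ?m) * G ?m + deriv G ?m * sin (of_real pi * ?m)) (at ?m)"
      using holomorphic_derivI[OF G(1), of ?m] by (auto intro!: derivative_eq_intros)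
    moreover have "F = (\<lambda>z. sin (of_real pi * z) * G z)" using G(2) by auto
    ultimately have "of_real pi * cos (of_real pi * ?m) * G ?m = 0"
      using z'[of m] by (simp add: DERIV_imp_deriv)
    moreover have "(sin (of_real pi * ?m))\<^sup>2 + (cos (of_real pi * ?m))\<^sup>2 = 1" by (rule sin_cos_squared_add)
    then have "cos (of_real pi * ?m) \<noteq> 0" by auto
    ultimately show ?thesis by simp
  qed
  then obtain H where H: "H holomorphic_on UNIV" "\<And>z. G z = sin (of_real pi * z) * H z"
    using divide_sin_pi[OF G(1)] by blast
  then show ?thesis using that[of H] G by (simp add: power2_eq_square mult.assoc)
qed

text \<open>The squared modulus of the sine is a quarter of a sum of two exponentials minus 2 cos(2
  pi Re z). On the lines Re z = n + 1/2 the cosine is -1 and helps; for |Im z| at least 1 the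
  dominant exponential \<open>E\<close> is at least 4, and then (E - 2)/4 is at least E/8.\<close>

lemma sin_pi_lower:
  assumes "1 \<le> \<bar>Im z\<bar> \<or> Re z - 1/2 \<in> \<int>"
  shows "exp (2 * pi * \<bar>Im z\<bar>) / 8 \<le> (norm (sin (of_real pi * z)))\<^sup>2"
proof -
  define E where "E = exp (2 * pi * \<bar>Im z\<bar>)"
  have n: "(norm (sin (of_real pi * z)))\<^sup>2 = (exp (2 * (pi * Im z)) + exp (- (2 * (pi * Im z))) - 2 * cos (2 * (pi * Re z))) / 4"
    using norm_sin_squared[of "of_real pi * z"] by (simp add: exp_minus)
  have E: "E \<le> exp (2 * (pi * Im z)) + exp (- (2 * (pi * Im z)))"
    by (cases "0 \<le> Im z") (simp_all add: E_def mult.assoc)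
  have E0: "0 < E" by (simp add: E_def)
  from assms show ?thesis
  proof
    assume "1 \<le> \<bar>Im z\<bar>"
    then have "2 * 2 * 1 \<le> 2 * pi * \<bar>Im z\<bar>" using pi_ge_two by (intro mult_mono) auto
    then have "1 + 2 * pi * \<bar>Im z\<bar> \<ge> 5" by simp
    then have "4 \<le> E" using exp_ge_add_one_self[of "2 * pi * \<bar>Im z\<bar>"] unfolding E_def by linarith
    moreover have "cos (2 * (pi * Re z)) \<le> 1" by simp
    moreover have aux: "E / 8 \<le> (X - 2 * c) / 4" if "E \<le> X" "4 \<le> E" "c \<le> 1" for X c
      using that by simp
    ultimately show ?thesis unfolding n E_def[symmetric] using aux[OF E] by blast
  next
    assume "Re z - 1/2 \<in> \<int>"
    then obtain k :: int where "Re z - 1 / 2 = of_int k" by (auto elim: Ints_cases)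
    then have "2 * (pi * Re z) = (2 * pi) * of_int k + pi" by (simp add: field_simps)
    then have "cos (2 * (pi * Re z)) = - 1"
      by (simp only: cos_add cos_int_2pin sin_int_2pin) simp
    then show ?thesis unfolding n E_def[symmetric] using E E0 by (simp add: field_simps)
  qed
qed


lemma powr_add_le:
  fixes a b p :: real
  assumes "0 \<le> a" "0 \<le> b" "0 \<le> p"
  shows "(a + b) powr p \<le> 2 powr p * (a powr p + b powr p)"
proof -
  have "(a + b) powr p \<le> (2 * max a b) powr p"
    using assms by (intro powr_mono2) auto
  also have "\<dots> = 2 powr p * max a b powr p"
    using assms by (simp add: powr_mult)
  also have "max a b powr p \<le> a powr p + b powr p"
    by (auto simp: max_def)
  finally show ?thesis by simp
qed

lemma inverse_weight_powr: "(1 / (1 + \<bar>x\<bar>)) powr q = (1 + \<bar>x\<bar>) powr (- q)" for x q :: real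
  by (simp add: powr_divide powr_minus_divide)

lemma frontier_int_rect:
  assumes "w \<in> frontier (cbox (Complex (of_int n - 1/2) (-1)) (Complex (of_int n + 1/2) 1))"
  shows "1 \<le> \<bar>Im w\<bar> \<or> Re w - 1/2 \<in> \<int>"
proof -
  have c: "Re w = of_int n - 1/2 \<or> Re w = of_int n + 1/2 \<or> \<bar>Im w\<bar> = 1"
    using assms unfolding frontier_cbox by (auto simp: in_cbox_complex_iff in_box_complex_iff)
  have "of_int n - 1/2 - 1/2 = (of_int (n - 1) :: real)" "of_int n + 1/2 - 1/2 = (of_int n :: real)"
    by simp_all
  then have "Re w - 1/2 \<in> \<int>" if "Re w = of_int n - 1/2 \<or> Re w = of_int n + 1/2"
    using that by (metis Ints_of_int)
  with c show ?thesis by auto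
qed

text \<open>Maximum principle on the rectangle of width 1 centred at the integer nearest to
  \<open>Re z\<close>: its vertical sides lie on the half-integer lines and its horizontal sides on
  |Im z| = 1, where the bound is assumed.\<close>

lemma bounded_from_grid:
  assumes G: "G holomorphic_on UNIV" and b: "\<And>z. 1 \<le> \<bar>Im z\<bar> \<or> Re z - 1/2 \<in> \<int> \<Longrightarrow> norm (G z) \<le> K"
  shows "norm (G z) \<le> K"
proof (cases "1 \<le> \<bar>Im z\<bar>")
  case False
  define n where "n = round (Re z)"
  let ?R = "cbox (Complex (of_int n - 1/2) (-1)) (Complex (of_int n + 1/2) 1)"
  show ?thesis
  proof (rule maximum_modulus_frontier[where S="?R" and f=G and \<xi>=z])
    show "G holomorphic_on interior ?R" "continuous_on (closure ?R) G"
      using G holomorphic_on_subset holomorphic_on_imp_continuous_on continuous_on_subset by blast+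
    show "norm (G w) \<le> K" if "w \<in> frontier ?R" for w
      using frontier_int_rect[OF that] by (rule b)
    have "\<bar>of_int n - Re z\<bar> \<le> 1/2" unfolding n_def by (rule of_int_round_abs_le)
    then have "of_int n - Re z \<le> 1/2" "Re z - of_int n \<le> 1/2" by (simp_all only: abs_le_iff minus_diff_eq)
    moreover have "Im z < 1" "- Im z < 1" using False by (simp_all only: not_le abs_less_iff)
    ultimately show "z \<in> ?R" by (simp add: in_cbox_complex_iff)
  qed auto
qed (use b in auto)

text \<open>The difference of \<open>h\<close> and its sampling series has double zeros at the integers, so it is \<open>sin\<^sup>2(\<pi> z)\<close> times an
  entire function. That function is bounded, hence constant, and vanishes in the limit along \<open>n + 1/2\<close>.\<close>

lemma sampling_integers:
  fixes h :: "complex \<Rightarrow> complex" and p :: real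
  assumes h: "h holomorphic_on UNIV" and ty: "\<And>z. norm (h z) \<le> M * exp (2 * pi * \<bar>Im z\<bar>)" and p: "1 < p"
    and s0: "(\<lambda>m::int. norm (h (of_int m)) powr p) summable_on UNIV"
    and s1: "(\<lambda>m::int. norm (deriv h (of_int m)) powr p) summable_on UNIV"
    and lim: "(\<lambda>n. h (of_nat n + 1/2)) \<longlonglongrightarrow> 0"
  shows "((\<lambda>m::int. h (of_int m) * sampling_kernel 0 (z - of_int m) + deriv h (of_int m) * sampling_kernel 1 (z - of_int m)) has_sum h z) UNIV"
proof -
  obtain C where C: "0 \<le> C" "\<And>l z. l \<le> 1 \<Longrightarrow> norm (sampling_kernel l z) \<le> C * exp (2 * pi * \<bar>Im z\<bar>) / (1 + \<bar>Re z\<bar>)"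
    using sampling_kernel_bound by blast
  define q where "q = p / (p - 1)"
  have q: "1 < q" "1 / p + 1 / q = 1" using p by (simp_all add: q_def field_simps)
  obtain B where B: "0 \<le> B" "\<And>x A. finite A \<Longrightarrow> (\<Sum>m\<in>A. (1 + \<bar>x - real_of_int m\<bar>) powr (- q)) \<le> B"
    using int_powr_sum_bound[OF q(1)] by blast
  define A where "A m = C * (norm (h (of_int m)) + norm (deriv h (of_int m)))" for m :: int
  have A0: "0 \<le> A m" for m using C by (simp add: A_def)
  have As: "(\<lambda>m. A m powr p) summable_on UNIV"
  proof (rule summable_on_comparison_test)
    show "(\<lambda>m::int. C powr p * (2 powr p * (norm (h (of_int m)) powr p + norm (deriv h (of_int m)) powr p))) summable_on UNIV"
      by (intro summable_on_cmult_right summable_on_add s0 s1)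
    show "A m powr p \<le> C powr p * (2 powr p * (norm (h (of_int m)) powr p + norm (deriv h (of_int m)) powr p))" for m
      unfolding A_def using C p by (subst powr_mult) (auto intro!: mult_left_mono powr_add_le)
  qed auto
  have As': "(\<lambda>m. (A m * c) powr p) summable_on UNIV" if "0 \<le> c" for c
    using summable_on_cmult_left[OF As, of "c powr p"] A0 that by (simp add: powr_mult)
  define W :: "complex \<Rightarrow> int \<Rightarrow> real" where "W z m = 1 / (1 + \<bar>Re z - of_int m\<bar>)" for z m
  have W0: "0 \<le> W z m" for z m by (simp add: W_def)
  have Wb: "(\<Sum>m\<in>X. W z m powr q) \<le> B" if "finite X" for z X
    using B(2)[OF that, of "Re z"] by (simp add: W_def inverse_weight_powr)
  define a where "a m z = h (of_int m) * sampling_kernel 0 (z - of_int m) + deriv h (of_int m) * sampling_kernel 1 (z - of_int m)" for m :: int and z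
  have a_le: "norm (a m z) \<le> A m * exp (2 * pi * \<bar>Im z\<bar>) * W z m" for m z
  proof -
    let ?b = "C * exp (2 * pi * \<bar>Im z\<bar>) * W z m"
    have g: "norm (sampling_kernel l (z - of_int m)) \<le> ?b" if "l \<le> 1" for l
      using C(2)[OF that, of "z - of_int m"] by (simp add: W_def)
    have "norm (a m z) \<le> norm (h (of_int m)) * norm (sampling_kernel 0 (z - of_int m)) + norm (deriv h (of_int m)) * norm (sampling_kernel 1 (z - of_int m))"
      unfolding a_def by (rule order_trans[OF norm_triangle_ineq]) (simp add: norm_mult)
    also have "\<dots> \<le> norm (h (of_int m)) * ?b + norm (deriv h (of_int m)) * ?b"
      by (intro add_mono mult_left_mono g) auto
    also have "\<dots> = A m * exp (2 * pi * \<bar>Im z\<bar>) * W z m" by (simp add: A_def algebra_simps)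
    finally show ?thesis .
  qed
  define S where "S z = infsum (\<lambda>m. a m z) UNIV" for z
  define T where "T Y = {z. \<bar>Im z\<bar> \<le> Y}" for Y
  define D where "D Y = exp (2 * pi * Y)" for Y
  have aT: "norm (a m z) \<le> (A m * D Y) * W z m" if "z \<in> T Y" for m z Y
    using that by (intro order_trans[OF a_le] mult_right_mono mult_left_mono W0 A0) (auto simp: T_def D_def)
  have D0: "0 \<le> D Y" for Y by (simp add: D_def)
  have AD0: "0 \<le> A m * D Y" for m Y by (simp add: A0 D0)
  have ul: "uniform_limit (T Y) (\<lambda>X z. \<Sum>m\<in>X. a m z) S (finite_subsets_at_top UNIV)" for Y
    unfolding S_def
    by (rule holder_family_uniform_limit[where p=p and q=q and A="\<lambda>m. A m * D Y" and W=W and B=B])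
       (use p q AD0 W0 As'[OF D0] Wb aT in auto)
  have sm: "(\<lambda>m. norm (a m z)) summable_on UNIV" for z
    by (rule holder_family_abs_summable[where p=p and q=q and A="\<lambda>m. A m * D \<bar>Im z\<bar>" and W=W and B=B and S="T \<bar>Im z\<bar>"])
       (use p q AD0 W0 As'[OF D0] Wb aT in \<open>auto simp: T_def\<close>)
  have hs: "((\<lambda>m. a m z) has_sum S z) UNIV" for z
    unfolding S_def by (rule has_sum_infsum[OF abs_summable_summable[OF sm]])
  define K where "K = infsum (\<lambda>m. A m powr p) UNIV + B"
  have S_le: "norm (S z) \<le> K * exp (2 * pi * \<bar>Im z\<bar>)" for z
  proof -
    let ?e = "exp (2 * pi * \<bar>Im z\<bar>)"
    \<comment> \<open>Division by the exponential leaves a family majorised by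
      \<open>A m * W z m\<close>, whose constants do not depend on \<open>z\<close>; thus
      \<open>S\<close> grows no faster than \<open>h\<close> is assumed to.\<close>
    have "norm (infsum (\<lambda>m. a m z / of_real ?e) UNIV) \<le> K"
      unfolding K_def
    proof (rule holder_family_bound[where p=p and q=q and A=A and W=W and B=B and S="{z}" and a="\<lambda>m z. a m z / of_real (exp (2 * pi * \<bar>Im z\<bar>))"])
      show "norm (a m z' / of_real (exp (2 * pi * \<bar>Im z'\<bar>))) \<le> A m * W z' m" for m z'
        using a_le[of m z'] by (simp add: norm_divide divide_le_eq mult_ac)
    qed (use p q A0 W0 As Wb in auto)
    moreover have "((\<lambda>m. a m z / of_real ?e) has_sum (S z / of_real ?e)) UNIV"
      using has_sum_cmult_left[OF hs[of z], of "1 / of_real ?e"] by simp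
    ultimately have "norm (S z / of_real ?e) \<le> K" by (simp add: infsumI)
    then show ?thesis by (simp add: norm_divide divide_le_eq)
  qed
  define a' where "a' m z = h (of_int m) * deriv (sampling_kernel 0) (z - of_int m) + deriv h (of_int m) * deriv (sampling_kernel 1) (z - of_int m)" for m :: int and z
  have da: "(a m has_field_derivative a' m z) (at z)" for m z
  proof -
    have g: "((\<lambda>z. sampling_kernel l (z - of_int m)) has_field_derivative deriv (sampling_kernel l) (z - of_int m)) (at z)" for l
    proof -
      have "(sampling_kernel l has_field_derivative deriv (sampling_kernel l) (z - of_int m)) (at (z - of_int m))"
        using sampling_kernel_holomorphic[of l UNIV] by (simp add: holomorphic_derivI)
      moreover have "((\<lambda>z. z - of_int m) has_field_derivative 1) (at z)"
        by (auto intro!: derivative_eq_intros)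
      ultimately show ?thesis using DERIV_chain2 by fastforce
    qed
    show ?thesis unfolding a_def a'_def by (intro DERIV_add DERIV_cmult g)
  qed
  \<comment> \<open>The partial sums are holomorphic and converge uniformly on the closed unit disc
    around \<open>z\<close>, so the series may be differentiated term by term. This gives the
    interpolation of first derivatives.\<close>
  have dS: "\<exists>S'. (S has_field_derivative S') (at z) \<and> ((\<lambda>X. \<Sum>m\<in>X. a' m z) \<longlongrightarrow> S') (finite_subsets_at_top UNIV)" for z
  proof -
    have sub: "cball z 1 \<subseteq> T (\<bar>Im z\<bar> + 1)"
    proof
      fix w assume "w \<in> cball z 1"
      then have "norm (w - z) \<le> 1" by (simp add: dist_norm norm_minus_commute)
      then have "\<bar>Im w - Im z\<bar> \<le> 1" using abs_Im_le_cmod[of "w - z"] by simp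
      then show "w \<in> T (\<bar>Im z\<bar> + 1)" by (simp add: T_def)
    qed
    have dX: "((\<lambda>z. \<Sum>m\<in>X. a m z) has_field_derivative (\<Sum>m\<in>X. a' m w)) (at w)" for X w
      by (intro DERIV_sum da)
    obtain g' where "\<And>w. w \<in> ball z 1 \<Longrightarrow> (S has_field_derivative g' w) (at w) \<and>
        ((\<lambda>X. \<Sum>m\<in>X. a' m w) \<longlongrightarrow> g' w) (finite_subsets_at_top UNIV)"
    proof (rule has_complex_derivative_uniform_limit[where z=z and r=1 and f="\<lambda>X z. \<Sum>m\<in>X. a m z" and f'="\<lambda>X w. \<Sum>m\<in>X. a' m w" and g=S and F="finite_subsets_at_top UNIV"])
      show "uniform_limit (cball z 1) (\<lambda>X z. \<Sum>m\<in>X. a m z) S (finite_subsets_at_top UNIV)"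
        using uniform_limit_on_subset[OF ul sub] .
      show "\<forall>\<^sub>F X in finite_subsets_at_top UNIV. continuous_on (cball z 1) (\<lambda>z. \<Sum>m\<in>X. a m z) \<and>
         (\<forall>w\<in>ball z 1. ((\<lambda>z. \<Sum>m\<in>X. a m z) has_field_derivative (\<Sum>m\<in>X. a' m w)) (at w))"
        using dX by (intro always_eventually allI conjI ballI continuous_at_imp_continuous_on) (auto intro: DERIV_isCont)
    qed auto
    then show ?thesis by (meson centre_in_ball zero_less_one)
  qed
  have Shol: "S holomorphic_on UNIV"
    using dS by (subst holomorphic_on_open) blast+
  have Sint: "S (of_int n) = h (of_int n)" for n
  proof -
    have "((\<lambda>m. a m (of_int n)) has_sum h (of_int n)) UNIV"
    proof (rule has_sum_finite_neutralI[where B="{n}"])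
      fix m assume "m \<in> UNIV - {n}"
      then have "n - m \<noteq> 0" by simp
      then show "a m (of_int n) = 0" unfolding a_def of_int_diff[symmetric] by (simp only: sampling_kernel_int[OF \<open>n - m \<noteq> 0\<close>] mult_zero_right add_0)
    qed (simp_all add: a_def sampling_kernel_0)
    then show ?thesis using hs[of "of_int n"] has_sum_unique by blast
  qed
  have dSint: "deriv S (of_int n) = deriv h (of_int n)" for n
  proof -
    obtain S' where S': "(S has_field_derivative S') (at (of_int n))" "((\<lambda>X. \<Sum>m\<in>X. a' m (of_int n)) \<longlongrightarrow> S') (finite_subsets_at_top UNIV)"
      using dS by blast
    have "((\<lambda>m. a' m (of_int n)) has_sum deriv h (of_int n)) UNIV"
    proof (rule has_sum_finite_neutralI[where B="{n}"])
      have g: "deriv (sampling_kernel l) (of_int n - of_int m) = (if l = 1 \<and> m = n then 1 else 0)" if "l \<le> 1" for l m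
        using DERIV_imp_deriv[OF sampling_kernel_deriv_int[OF that, of "n - m"]] by auto
      then show "deriv h (of_int n) = (\<Sum>m\<in>{n}. a' m (of_int n))" 
        "\<And>m. m \<in> UNIV - {n} \<Longrightarrow> a' m (of_int n) = 0" by (simp_all only: sum.insert finite.emptyI a'_def g[of 0] g[of 1]) auto
    qed simp_all
    then have "S' = deriv h (of_int n)"
      unfolding has_sum_def by (rule tendsto_unique[OF finite_subsets_at_top_neq_bot S'(2)])
    then show ?thesis using S'(1) by (simp add: DERIV_imp_deriv)
  qed
  have Dh: "(\<lambda>z. h z - S z) holomorphic_on UNIV" by (intro holomorphic_intros h Shol)
  have dd: "deriv (\<lambda>z. h z - S z) (of_int n) = 0" for n
    using h Shol dSint by (simp add: deriv_diff holomorphic_on_imp_differentiable_at)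
  obtain G where G: "G holomorphic_on UNIV" "\<And>z. h z - S z = (sin (of_real pi * z))\<^sup>2 * G z"
    using divide_sin_pi_sq[OF Dh _ dd] Sint by auto
  have "norm (G z) \<le> 8 * (M + K)" for z
  proof (rule bounded_from_grid[OF G(1)])
    fix z :: complex assume z: "1 \<le> \<bar>Im z\<bar> \<or> Re z - 1/2 \<in> \<int>"
    let ?e = "exp (2 * pi * \<bar>Im z\<bar>)"
    have "(?e / 8) * norm (G z) \<le> (norm (sin (of_real pi * z)))\<^sup>2 * norm (G z)"
      by (intro mult_right_mono sin_pi_lower z) simp
    also have "\<dots> = norm (h z - S z)" by (simp add: G(2) norm_mult norm_power)
    also have "\<dots> \<le> norm (h z) + norm (S z)" by (rule norm_triangle_ineq4)
    also have "\<dots> \<le> M * ?e + K * ?e" by (intro add_mono ty S_le)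
    also have "\<dots> = (?e / 8) * (8 * (M + K))" by (simp add: algebra_simps)
    finally show "norm (G z) \<le> 8 * (M + K)" by (simp add: mult_le_cancel_left)
  qed
  then have "bounded (range G)" unfolding bounded_iff by auto
  then obtain c where c: "\<And>z. G z = c" using Liouville_theorem[OF G(1)] unfolding constant_on_def by auto
  have c': "h (of_nat n + 1/2) - S (of_nat n + 1/2) = c" for n :: nat
  proof -
    have "complex_of_real pi * (of_nat n + 1/2) = of_real (pi * real n + pi / 2)" by (simp add: field_simps)
    then have "(sin (complex_of_real pi * (of_nat n + 1/2)))\<^sup>2 = of_real ((sin (pi * real n + pi / 2))\<^sup>2)"
      by (simp only: sin_of_real of_real_power)
    also have "(sin (pi * real n + pi / 2))\<^sup>2 = 1"
      unfolding sin_add cos_pi_half sin_pi_half cos_npi2 by (cases "even n") auto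
    finally show ?thesis using G(2)[of "of_nat n + 1/2"] c by simp
  qed
  \<comment> \<open>At half-integers the squared sine is 1, so \<open>c\<close> is the difference of
    \<open>h\<close> and \<open>S\<close> there. On the real line, which is \<open>T 0\<close>,
    finitely many terms approximate \<open>S\<close> within \<open>e\<close> uniformly; each of
    these terms tends to 0 along the half-integers, and so does \<open>h\<close>.\<close>
  have "norm c \<le> 2 * e" if e: "0 < e" for e
  proof -
    obtain X where X': "\<forall>z\<in>T 0. dist (\<Sum>m\<in>X. a m z) (S z) < e"
      using eventually_happens'[OF finite_subsets_at_top_neq_bot uniform_limitD[OF ul e]] ..
    then have X: "dist (\<Sum>m\<in>X. a m z) (S z) < e" if "z \<in> T 0" for z using that by (rule bspec)
    have "(\<lambda>n. a m (of_nat n + 1/2)) \<longlonglongrightarrow> 0" for m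
    proof (rule Lim_null_comparison)
      have "filterlim (\<lambda>n. 1 + \<bar>real n + 1/2 - of_int m\<bar>) at_top sequentially"
      proof (rule filterlim_at_top_mono)
        show "filterlim (\<lambda>n. (1/2 - of_int m) + real n) at_top sequentially"
          by (intro filterlim_tendsto_add_at_top[OF tendsto_const] filterlim_real_sequentially)
      qed (intro always_eventually, auto)
      then show "(\<lambda>n. A m * (1 / (1 + \<bar>real n + 1/2 - of_int m\<bar>))) \<longlonglongrightarrow> 0"
        by (intro tendsto_mult_right_zero tendsto_divide_0[OF tendsto_const] filterlim_at_top_imp_at_infinity)
      show "\<forall>\<^sub>F n in sequentially. norm (a m (of_nat n + 1/2)) \<le> A m * (1 / (1 + \<bar>real n + 1/2 - of_int m\<bar>))"
        using a_le[of m "of_nat _ + 1/2"] by (intro always_eventually) (simp add: W_def)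
    qed
    then have "(\<lambda>n. h (of_nat n + 1/2) - (\<Sum>m\<in>X. a m (of_nat n + 1/2))) \<longlonglongrightarrow> 0 - (\<Sum>m\<in>X. 0)"
      by (intro tendsto_diff lim tendsto_sum)
    then have "(\<lambda>n. h (of_nat n + 1/2) - (\<Sum>m\<in>X. a m (of_nat n + 1/2))) \<longlonglongrightarrow> 0" by simp
    from LIMSEQ_D[OF this e] obtain n where n: "norm (h (of_nat n + 1/2) - (\<Sum>m\<in>X. a m (of_nat n + 1/2))) < e" by auto
    have "of_nat n + 1/2 \<in> T 0" by (simp add: T_def)
    from X[OF this] n have "norm ((h (of_nat n + 1/2) - (\<Sum>m\<in>X. a m (of_nat n + 1/2))) + ((\<Sum>m\<in>X. a m (of_nat n + 1/2)) - S (of_nat n + 1/2))) \<le> e + e"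
      by (intro norm_triangle_mono) (auto simp: dist_norm)
    then show ?thesis using c'[of n] by simp
  qed
  from this[of "norm c / 4"] have "norm c \<le> 0" by (cases "norm c = 0") simp_all
  then have "h z = S z" using G(2)[of z] c by simp
  then show ?thesis using hs[of z] by (simp add: a_def)
qed

text \<open>Rescaling by \<open>2 * pi / s\<close> turns type \<open>s\<close> into
  \<open>2 * pi\<close>, the type of the squared sine. The spacing is twice that of sampling by
  values alone; the derivative at each node supplies the other half of the data.\<close>

lemma sampling_1d:
  fixes h :: "complex \<Rightarrow> complex" and p s :: real
  defines "u \<equiv> \<lambda>x::complex. of_real (2 * pi / s) * x"
  assumes s: "0 < s" and h: "h holomorphic_on UNIV" and ty: "\<And>z. norm (h z) \<le> M * exp (s * \<bar>Im z\<bar>)" and p: "1 < p"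
    and s0: "(\<lambda>m::int. norm (h (u (of_int m))) powr p) summable_on UNIV"
    and s1: "(\<lambda>m::int. norm (deriv h (u (of_int m))) powr p) summable_on UNIV"
    and lim: "(\<lambda>n. h (u (of_nat n + 1/2))) \<longlonglongrightarrow> 0"
  shows "((\<lambda>m::int. h (u (of_int m)) * sampling_kernel 0 (of_real (s / (2 * pi)) * z - of_int m) 
     + deriv h (u (of_int m)) * (of_real (2 * pi / s) * sampling_kernel 1 (of_real (s / (2 * pi)) * z - of_int m))) has_sum h z) UNIV"
proof -
  let ?g = "\<lambda>w. h (u w)"
  have d: "(?g has_field_derivative of_real (2 * pi / s) * deriv h (u w)) (at w)" for w
  proof -
    have "(h has_field_derivative deriv h (u w)) (at (u w))" using h by (simp add: holomorphic_derivI)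
    moreover have "(u has_field_derivative of_real (2 * pi / s)) (at w)"
      unfolding u_def using s by (auto intro!: derivative_eq_intros)
    ultimately have "(?g has_field_derivative deriv h (u w) * of_real (2 * pi / s)) (at w)"
      by (rule DERIV_chain2)
    then show ?thesis by (simp only: mult.commute)
  qed
  have dg: "deriv ?g w = of_real (2 * pi / s) * deriv h (u w)" for w using d by (rule DERIV_imp_deriv)
  have "((\<lambda>m::int. ?g (of_int m) * sampling_kernel 0 (of_real (s / (2 * pi)) * z - of_int m) 
     + deriv ?g (of_int m) * sampling_kernel 1 (of_real (s / (2 * pi)) * z - of_int m)) has_sum ?g (of_real (s / (2 * pi)) * z)) UNIV"
  proof (rule sampling_integers[OF _ _ p s0 _ lim])
    show "?g holomorphic_on UNIV" using d by (subst holomorphic_on_open) blast+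
    show "norm (h (u w)) \<le> M * exp (2 * pi * \<bar>Im w\<bar>)" for w
      using ty[of "u w"] s by (simp add: u_def abs_mult)
    have "norm (deriv ?g (of_int m)) powr p = (2 * pi / s) powr p * norm (deriv h (u (of_int m))) powr p" for m :: int
      unfolding dg norm_mult norm_of_real using s by (subst powr_mult) auto
    then show "(\<lambda>m::int. norm (deriv ?g (of_int m)) powr p) summable_on UNIV"
      using summable_on_cmult_right[OF s1] by presburger
  qed
  moreover have "u (of_real (s / (2 * pi)) * z) = z"
    unfolding u_def mult.assoc[symmetric] of_real_mult[symmetric] using s by simp
  ultimately show ?thesis unfolding dg by (simp only: mult_ac)
qed

section \<open>Integral transforms with kernels of exponential type\<close>

lemma exp_kernelD:
  assumes "exp_kernel R \<kappa>"
  shows "\<kappa> holomorphic_on UNIV" "\<exists>C\<ge>0. \<forall>z. norm (\<kappa> z) \<le> C * exp (R * \<bar>Im z\<bar>) * wt (Re z)"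
  using assms unfolding exp_kernel_def by auto

lemma exp_kernel_deriv:
  assumes \<kappa>: "exp_kernel R \<kappa>" and R: "0 \<le> R"
  shows "exp_kernel R (deriv \<kappa>)"
proof -
  obtain C where C: "0 \<le> C" "\<And>z. norm (\<kappa> z) \<le> C * exp (R * \<bar>Im z\<bar>) * wt (Re z)"
    using exp_kernelD(2)[OF \<kappa>] by blast
  note h = exp_kernelD(1)[OF \<kappa>]
  \<comment> \<open>On the unit circle around \<open>z\<close> the imaginary part moves by at most
    1, which costs \<open>exp R\<close>, and Peetre's inequality with shift at most 1 costs 2 (1 +
    1) = 4.\<close>
  define K where "K = C * exp R * 4"
  have "norm (deriv \<kappa> z) \<le> K * exp (R * \<bar>Im z\<bar>) * wt (Re z)" for z
  proof -
    have "norm ((deriv ^^ 1) \<kappa> z) \<le> fact 1 * (K * exp (R * \<bar>Im z\<bar>) * wt (Re z)) / 1 ^ 1"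
    proof (rule Cauchy_inequality)
      show "\<kappa> holomorphic_on ball z 1" "continuous_on (cball z 1) \<kappa>"
        using h holomorphic_on_subset holomorphic_on_imp_continuous_on by blast+
      fix x assume "norm (z - x) = 1"
      then have x: "norm (x - z) = 1" by (simp add: norm_minus_commute)
      have "\<bar>Im x\<bar> \<le> \<bar>Im z\<bar> + \<bar>Im (x - z)\<bar>" by simp
      also have "\<dots> \<le> \<bar>Im z\<bar> + 1" using abs_Im_le_cmod[of "x - z"] x by simp
      finally have "R * \<bar>Im x\<bar> \<le> R * (\<bar>Im z\<bar> + 1)" using R by (intro mult_left_mono)
      then have e: "exp (R * \<bar>Im x\<bar>) \<le> exp R * exp (R * \<bar>Im z\<bar>)"
        by (simp add: distrib_left flip: exp_add)
      have "\<bar>Re (x - z)\<bar> \<le> 1" using abs_Re_le_cmod[of "x - z"] x by simp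
      then have "(Re (x - z))\<^sup>2 \<le> 1" by (simp add: abs_square_le_1)
      then have "2 * (1 + (Re (x - z))\<^sup>2) * wt (Re z) \<le> 4 * wt (Re z)"
        by (intro mult_right_mono) auto
      then have w: "wt (Re x) \<le> 4 * wt (Re z)"
        using wt_shift[of "Re z" "Re (x - z)"] by simp
      have "norm (\<kappa> x) \<le> C * exp (R * \<bar>Im x\<bar>) * wt (Re x)" by (rule C)
      also have "\<dots> \<le> C * (exp R * exp (R * \<bar>Im z\<bar>)) * (4 * wt (Re z))"
        using C(1) by (intro mult_mono e w mult_left_mono) auto
      finally show "norm (\<kappa> x) \<le> K * exp (R * \<bar>Im z\<bar>) * wt (Re z)" by (simp add: K_def mult_ac)
    qed simp
    then show ?thesis by simp
  qed
  moreover have "0 \<le> K" using C by (simp add: K_def)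
  moreover have "deriv \<kappa> holomorphic_on UNIV" using h by (rule holomorphic_deriv) simp
  ultimately show ?thesis unfolding exp_kernel_def by blast
qed

lemma exp_kernel_higher_deriv: "exp_kernel R \<kappa> \<Longrightarrow> 0 \<le> R \<Longrightarrow> exp_kernel R ((deriv ^^ k) \<kappa>)"
  by (induction k) (auto intro: exp_kernel_deriv)

lemma exp_kernel_mult_left:
  assumes "exp_kernel R \<kappa>" shows "exp_kernel R (\<lambda>z. c * \<kappa> z)"
proof -
  obtain C where C: "0 \<le> C" "\<And>z. norm (\<kappa> z) \<le> C * exp (R * \<bar>Im z\<bar>) * wt (Re z)"
    using exp_kernelD(2)[OF assms] by blast
  have "norm (c * \<kappa> z) \<le> (norm c * C) * exp (R * \<bar>Im z\<bar>) * wt (Re z)" for z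
    using mult_left_mono[OF C(2), of "norm c" z] by (simp add: norm_mult mult.assoc)
  then show ?thesis unfolding exp_kernel_def
    using C exp_kernelD(1)[OF assms] by (intro conjI holomorphic_intros exI[of _ "norm c * C"]) auto
qed

definition re_vec :: "complex^'n \<Rightarrow> real^'n" where "re_vec z = (\<chi> j. Re (z $ j))"

definition kernel_prod :: "('n \<Rightarrow> complex \<Rightarrow> complex) \<Rightarrow> complex^'n \<Rightarrow> real^'n \<Rightarrow> complex" where
  "kernel_prod \<kappa> z x = (\<Prod>j\<in>UNIV. \<kappa> j (z $ j - of_real (x $ j)))"

lemma kernel_prod_bound:
  assumes "\<And>j. exp_kernel (R j) (\<kappa> j)"
  obtains C where "0 \<le> C"
    "\<And>z x. norm (kernel_prod \<kappa> z x) \<le> C * exp (\<Sum>j\<in>UNIV. R j * \<bar>Im (z $ j)\<bar>) * wtn (re_vec z - x)"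
proof -
  have "\<exists>C. \<forall>j. 0 \<le> C j \<and> (\<forall>z. norm (\<kappa> j z) \<le> C j * exp (R j * \<bar>Im z\<bar>) * wt (Re z))"
    using exp_kernelD(2)[OF assms] by metis
  then obtain C where C: "\<And>j. 0 \<le> C j" "\<And>j z. norm (\<kappa> j z) \<le> C j * exp (R j * \<bar>Im z\<bar>) * wt (Re z)"
    by blast
  have "norm (kernel_prod \<kappa> z x) \<le> (\<Prod>j\<in>UNIV. C j) * exp (\<Sum>j\<in>UNIV. R j * \<bar>Im (z $ j)\<bar>) * wtn (re_vec z - x)" for z x
  proof -
    have "norm (kernel_prod \<kappa> z x) \<le> (\<Prod>j\<in>UNIV. C j * exp (R j * \<bar>Im (z $ j)\<bar>) * wt (Re (z $ j) - x $ j))"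
      unfolding kernel_prod_def prod_norm[symmetric]
      using C(2)[of _ "z $ _ - of_real (x $ _)"] by (intro prod_mono) auto
    also have "\<dots> = (\<Prod>j\<in>UNIV. C j) * exp (\<Sum>j\<in>UNIV. R j * \<bar>Im (z $ j)\<bar>) * wtn (re_vec z - x)"
      by (simp add: prod.distrib exp_sum wtn_def re_vec_def)
    finally show ?thesis .
  qed
  moreover have "0 \<le> (\<Prod>j\<in>UNIV. C j)" using C by (simp add: prod_nonneg)
  ultimately show ?thesis using that by blast
qed

lemma borel_measurable_kernel_prod:
  assumes "\<And>j. exp_kernel (R j) (\<kappa> j)"
  shows "kernel_prod \<kappa> z \<in> borel_measurable borel"
proof -
  have c: "continuous_on UNIV (\<kappa> j)" for j
    using exp_kernelD(1)[OF assms] by (rule holomorphic_on_imp_continuous_on)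
  show ?thesis
    unfolding kernel_prod_def
    by (intro borel_measurable_continuous_onI continuous_intros continuous_on_compose2[OF c]) auto
qed

definition kernel_integral :: "(real^'n \<Rightarrow> complex) \<Rightarrow> ('n \<Rightarrow> complex \<Rightarrow> complex) \<Rightarrow> complex^'n \<Rightarrow> complex" where
  "kernel_integral f \<kappa> z = (LINT x|lborel. f x * kernel_prod \<kappa> z x)"

text \<open>The convolution of |f| with the weight: the common majorant on real points of all kernel
  integrals and of their derivatives.\<close>

definition wconv :: "(real^'n \<Rightarrow> complex) \<Rightarrow> real^'n \<Rightarrow> real" where
  "wconv f x = (LINT t|lborel. norm (f t) * wtn (x - t))"

lemma 
  fixes x :: "real^'n"
  shows integrable_wtn_shift: "integrable lborel (\<lambda>t. wtn (x - t))"
    and integral_wtn_shift: "(LINT t|lborel. wtn (x - t)) = (LINT t|lborel. wtn (t::real^'n))"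
proof -
  have i: "integrable lborel (\<lambda>t. wt (x $ j - t))" for j
    using lborel_integrable_real_affine[OF integrable_wt, of "-1" "x $ j"] by simp
  have e: "(LINT t|lborel. wt (x $ j - t)) = (LINT t|lborel. wt t)" for j
    using lborel_integral_real_affine[of "-1" wt "x $ j"] by simp
  show "integrable lborel (\<lambda>t. wtn (x - t))"
    unfolding wtn_def using integrable_prod_vec[of "\<lambda>j t. wt (x $ j - t)", OF i] by simp
  show "(LINT t|lborel. wtn (x - t)) = (LINT t|lborel. wtn (t::real^'n))"
    unfolding wtn_def using integral_prod_vec[of "\<lambda>j t. wt (x $ j - t)", OF i] 
      integral_prod_vec[of "\<lambda>j::'n. wt", OF integrable_wt] by (simp add: e)
qed

lemma le_one_plus_powr: "0 \<le> s \<Longrightarrow> 1 \<le> p \<Longrightarrow> s \<le> 1 + s powr p" for s p :: real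
proof (cases "s \<le> 1")
  case False
  assume "1 \<le> p"
  then have "s powr 1 \<le> s powr p" using False by (intro powr_mono) auto
  then show ?thesis using False by simp
qed (simp add: add_increasing2)

section \<open>Convolution bounds for functions in L^p\<close>

text \<open>Borel measurability gives joint measurability on products of \<open>lborel\<close>, as
  Fubini's theorem requires. The theorem replaces its Lebesgue measurable function by a Borel one
  that agrees almost everywhere.\<close>

locale Lp_function =
  fixes f :: "real^'n \<Rightarrow> complex" and p :: real
  assumes p: "1 \<le> p" and f_meas [measurable]: "f \<in> borel_measurable borel"
    and f_int: "integrable lborel (\<lambda>x. norm (f x) powr p)"
begin

lemma integrable_wconv: "integrable lborel (\<lambda>t. norm (f t) * wtn (x - t))"
proof (rule Bochner_Integration.integrable_bound)
  show "integrable lborel (\<lambda>t. wtn (x - t) + norm (f t) powr p)"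
    by (intro Bochner_Integration.integrable_add integrable_wtn_shift f_int)
  have "norm (f t) * wtn (x - t) \<le> (1 + norm (f t) powr p) * wtn (x - t)" for t
    by (intro mult_right_mono le_one_plus_powr p) auto
  also have "(1 + norm (f t) powr p) * wtn (x - t) \<le> wtn (x - t) + norm (f t) powr p" for t
    using mult_left_mono[OF wtn_le_1, of "norm (f t) powr p" "x - t"] by (simp add: distrib_right)
  finally show "AE t in lborel. norm (norm (f t) * wtn (x - t)) \<le> norm (wtn (x - t) + norm (f t) powr p)"
    by (intro always_eventually allI) (simp add: abs_mult)
qed measurable

lemma wconv_nonneg: "0 \<le> wconv f x"
  unfolding wconv_def by (intro integral_nonneg_AE always_eventually) simp

lemma integrable_powr_wtn: "integrable lborel (\<lambda>t. norm (f t) powr p * wtn (x - t))"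
proof (rule Bochner_Integration.integrable_bound[OF f_int])
  show "AE t in lborel. norm (norm (f t) powr p * wtn (x - t)) \<le> norm (norm (f t) powr p)"
    using mult_left_mono[OF wtn_le_1, of "norm (f _) powr p" "x - _"] by (intro always_eventually allI) (simp add: abs_mult)
qed measurable

lemma wconv_bounded:
  obtains N where "0 \<le> N" "\<And>x. wconv f x \<le> N"
proof -
  have "wconv f x \<le> (LINT t|lborel. wtn (t::real^'n)) + (LINT t|lborel. norm (f t) powr p)" for x
  proof -
    have "wconv f x \<le> (LINT t|lborel. wtn (x - t) + norm (f t) powr p)"
      unfolding wconv_def
    proof (rule integral_mono)
      show "integrable lborel (\<lambda>t. norm (f t) * wtn (x - t))" by (rule integrable_wconv)
      show "integrable lborel (\<lambda>t. wtn (x - t) + norm (f t) powr p)"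
        by (intro Bochner_Integration.integrable_add integrable_wtn_shift f_int)
      fix t
      have "norm (f t) * wtn (x - t) \<le> (1 + norm (f t) powr p) * wtn (x - t)"
        by (intro mult_right_mono le_one_plus_powr p) auto
      also have "\<dots> \<le> wtn (x - t) + norm (f t) powr p"
        using mult_left_mono[OF wtn_le_1, of "norm (f t) powr p" "x - t"] by (simp add: distrib_right)
      finally show "norm (f t) * wtn (x - t) \<le> wtn (x - t) + norm (f t) powr p" .
    qed
    also have "\<dots> = (LINT t|lborel. wtn (t::real^'n)) + (LINT t|lborel. norm (f t) powr p)"
      by (subst Bochner_Integration.integral_add) (auto simp: integrable_wtn_shift f_int integral_wtn_shift)
    finally show ?thesis .
  qed
  then show ?thesis using that wconv_nonneg order_trans by meson
qed

text \<open>Jensen's inequality for the finite measure with density \<open>wtn (x - t)\<close> and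
  total mass \<open>V\<close>. For \<open>p\<close> > 1 it is obtained by integrating Young's
  inequality for the product of |f| and \<open>A powr (p - 1)\<close>, with \<open>A\<close>
  free.\<close>

lemma wconv_powr_le:
  obtains K where "0 \<le> K" "\<And>x. wconv f x powr p \<le> K * (LINT t|lborel. norm (f t) powr p * wtn (x - t))"
proof -
  define V where "V = (LINT t|lborel. wtn (t::real^'n))"
  have V0: "0 \<le> V" unfolding V_def by (intro integral_nonneg_AE always_eventually) simp
  show ?thesis
  proof (cases "p = 1")
    case True
    then show ?thesis
      using wconv_nonneg by (intro that[of 1]) (simp_all add: wconv_def)
  next
    case False
    then have p1: "1 < p" using p by simp
    define q where "q = p / (p - 1)"
    have q: "1 < q" "1 / p + 1 / q = 1" using p1 by (simp_all add: q_def field_simps)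
    have "wconv f x powr p \<le> V powr (p - 1) * (LINT t|lborel. norm (f t) powr p * wtn (x - t))" for x
    proof (cases "wconv f x = 0")
      case True
      have "0 \<le> (LINT t|lborel. norm (f t) powr p * wtn (x - t))"
        by (intro integral_nonneg_AE always_eventually) simp
      then show ?thesis using True p by simp
    next
      case False
      then have N: "0 < wconv f x" using wconv_nonneg[of x] by simp
      let ?N = "wconv f x" and ?P = "LINT t|lborel. norm (f t) powr p * wtn (x - t)"
      have key: "?N * A powr (p - 1) \<le> ?P / p + A powr p / q * V" if A: "0 < A" for A
      proof -
        have "?N * A powr (p - 1) = (LINT t|lborel. (norm (f t) * wtn (x - t)) * A powr (p - 1))"
          unfolding wconv_def by (rule integral_mult_left_zero[symmetric])
        also have "\<dots> \<le> (LINT t|lborel. (norm (f t) powr p * wtn (x - t)) / p + A powr p / q * wtn (x - t))"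
        proof (rule integral_mono)
          show "integrable lborel (\<lambda>t. norm (f t) * wtn (x - t) * A powr (p - 1))"
            by (intro integrable_mult_left integrable_wconv)
          show "integrable lborel (\<lambda>t. norm (f t) powr p * wtn (x - t) / p + A powr p / q * wtn (x - t))"
            by (intro Bochner_Integration.integrable_add integrable_divide integrable_mult_right integrable_powr_wtn integrable_wtn_shift)
          fix t
          have pq: "(p - 1) * q = p" using p1 by (simp add: q_def)
          have "norm (f t) * A powr (p - 1) \<le> norm (f t) powr p / p + (A powr (p - 1)) powr q / q"
            by (intro Youngs_inequality p1 q) auto
          also have "(A powr (p - 1)) powr q = A powr p" by (simp add: powr_powr pq)
          finally have "(norm (f t) * A powr (p - 1)) * wtn (x - t) \<le> (norm (f t) powr p / p + A powr p / q) * wtn (x - t)"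
            by (rule mult_right_mono) simp
          then show "norm (f t) * wtn (x - t) * A powr (p - 1) \<le> norm (f t) powr p * wtn (x - t) / p + A powr p / q * wtn (x - t)"
            by (simp add: algebra_simps)
        qed
        also have "\<dots> = ?P / p + A powr p / q * V"
          by (subst Bochner_Integration.integral_add)
             (auto simp: integrable_powr_wtn integrable_wtn_shift integral_wtn_shift V_def)
        finally show ?thesis .
      qed
      have V: "0 < V"
      proof (rule ccontr)
        assume "\<not> 0 < V"
        then have "V = 0" using V0 by simp
        moreover have "AE t in lborel. wtn (t::real^'n) = 0"
          using \<open>V = 0\<close> integral_nonneg_eq_0_iff_AE[of lborel "wtn :: real^'n \<Rightarrow> real"] integrable_wtn unfolding V_def by auto
        ultimately have "AE t in (lborel::(real^'n) measure). False"
          using wtn_pos by (metis (mono_tags, lifting) eventually_mono less_irrefl)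
        then show False
          by (subst (asm) AE_iff_null) (auto simp: null_sets_def)
      qed
      \<comment> \<open>The weighted mean of |f|. With this choice the left side becomes
        \<open>A powr p * V\<close>, and the Young term with \<open>1 / q\<close> can be absorbed
        into it.\<close>
      define A where "A = ?N / V"
      have A: "0 < A" "?N = A * V" using N V by (simp_all add: A_def)
      have Ap: "A * A powr (p - 1) = A powr p" using A by (simp add: powr_mult_base)
      have "A powr p * V \<le> ?P / p + A powr p * V * (1 / q)"
      proof -
        have "?N * A powr (p - 1) = (A * A powr (p - 1)) * V" unfolding A(2) by (simp only: mult_ac)
        then show ?thesis using key[OF A(1)] unfolding Ap by (simp only: times_divide_eq_right times_divide_eq_left mult_1_right)
      qed
      moreover have "1 / q = 1 - 1 / p" using q by simp
      ultimately have "A powr p * V * (1 / p) \<le> ?P * (1 / p)" by (simp add: right_diff_distrib)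
      then have "A powr p * V \<le> ?P" using p1 by (simp add: mult_le_cancel_right divide_le_cancel)
      then have "V powr (p - 1) * (A powr p * V) \<le> V powr (p - 1) * ?P" by (intro mult_left_mono) auto
      moreover have "V * V powr (p - 1) = V powr p" using V by (simp add: powr_mult_base)
      then have "V powr (p - 1) * (A powr p * V) = ?N powr p"
        using A V by (simp add: powr_mult mult_ac)
      ultimately show ?thesis by simp
    qed
    then show ?thesis by (intro that[of "V powr (p - 1)"]) auto
  qed
qed

text \<open>Only the coordinates in \<open>J\<close> run through a lattice, the others stay at
  \<open>x\<close>, as the induction over coordinates demands. The offset \<open>d\<close> also
  admits the midpoints, along which the function has to tend to 0.\<close>

definition real_lattice_vec :: "('n \<Rightarrow> real) \<Rightarrow> ('n \<Rightarrow> real) \<Rightarrow> 'n set \<Rightarrow> real^'n \<Rightarrow> ('n \<Rightarrow> int) \<Rightarrow> real^'n" where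
  "real_lattice_vec c d J x m = (\<chi> j. if j \<in> J then c j * of_int (m j) + d j else x $ j)"

text \<open>An estimate of Plancherel-Polya type. By Jensen's inequality a finite sum of
  \<open>p\<close>-th powers is at most a constant times the integral of |f|^p against the sum of
  the translated weights. That sum is bounded uniformly: a product of one-variable lattice sums over
  \<open>J\<close>, with the remaining factors at most 1.\<close>

lemma summable_wconv_lat:
  assumes c: "\<And>j. 0 < c j"
  shows "(\<lambda>m. wconv f (real_lattice_vec c d J x m) powr p) summable_on (PiE J (\<lambda>_. UNIV))"
proof -
  have "\<exists>B. 0 \<le> B \<and> (\<forall>x A. finite A \<longrightarrow> (\<Sum>m\<in>A. wt (c j * real_of_int m + x)) \<le> B)" for j
    by (rule wt_sum_bound[OF c[of j]]) blast
  then have "\<exists>B. \<forall>j. 0 \<le> B j \<and> (\<forall>x A. finite A \<longrightarrow> (\<Sum>m\<in>A. wt (c j * real_of_int m + x)) \<le> B j)"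
    by (intro choice allI)
  then obtain B where B: "\<And>j. 0 \<le> B j" "\<And>j x A. finite A \<Longrightarrow> (\<Sum>m\<in>A. wt (c j * real_of_int m + x)) \<le> B j"
    by blast
  define D where "D = (\<Prod>j\<in>J. B j)"
  have D0: "0 \<le> D" unfolding D_def by (intro prod_nonneg B)
  have sumw: "(\<Sum>m\<in>M. wtn (real_lattice_vec c d J x m - t)) \<le> D" if M: "finite M" "M \<subseteq> PiE J (\<lambda>_. UNIV)" for M t
  proof -
    have "(\<Sum>m\<in>M. wtn (real_lattice_vec c d J x m - t)) \<le> (\<Sum>m\<in>M. \<Prod>j\<in>J. wt (c j * real_of_int (m j) + (d j - t $ j)))"
    proof (rule sum_mono)
      fix m
      have "wtn (real_lattice_vec c d J x m - t) = (\<Prod>j\<in>J. wt (real_lattice_vec c d J x m $ j - t $ j)) * (\<Prod>j\<in>-J. wt (real_lattice_vec c d J x m $ j - t $ j))"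
        unfolding wtn_def vector_minus_component by (subst prod.union_disjoint[symmetric]) (auto simp: Un_commute)
      also have "\<dots> \<le> (\<Prod>j\<in>J. wt (real_lattice_vec c d J x m $ j - t $ j)) * 1"
        by (intro mult_left_mono prod_le_1 prod_nonneg) (auto simp: wt_le_1)
      also have "\<dots> = (\<Prod>j\<in>J. wt (c j * real_of_int (m j) + (d j - t $ j)))"
        by (simp add: real_lattice_vec_def algebra_simps)
      finally show "wtn (real_lattice_vec c d J x m - t) \<le> (\<Prod>j\<in>J. wt (c j * real_of_int (m j) + (d j - t $ j)))" .
    qed
    also have "\<dots> \<le> D" unfolding D_def
      by (rule sum_prod_le_prod_bound[where f="\<lambda>j m. wt (c j * real_of_int m + (d j - t $ j))"]) (use B M in auto)
    finally show ?thesis .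
  qed
  obtain K where K: "0 \<le> K" "\<And>x. wconv f x powr p \<le> K * (LINT t|lborel. norm (f t) powr p * wtn (x - t))"
    using wconv_powr_le by blast
  let ?b = "K * (LINT t|lborel. norm (f t) powr p * D)"
  show ?thesis
  proof (rule nonneg_bdd_above_summable_on)
    have "(\<Sum>m\<in>M. wconv f (real_lattice_vec c d J x m) powr p) \<le> ?b" if M: "finite M" "M \<subseteq> PiE J (\<lambda>_. UNIV)" for M
    proof -
      have "(\<Sum>m\<in>M. wconv f (real_lattice_vec c d J x m) powr p) \<le> (\<Sum>m\<in>M. K * (LINT t|lborel. norm (f t) powr p * wtn (real_lattice_vec c d J x m - t)))"
        by (intro sum_mono K)
      also have "\<dots> = K * (LINT t|lborel. (\<Sum>m\<in>M. norm (f t) powr p * wtn (real_lattice_vec c d J x m - t)))"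
        by (subst Bochner_Integration.integral_sum) (auto intro: integrable_powr_wtn simp: sum_distrib_left)
      also have "\<dots> \<le> ?b"
      proof (intro mult_left_mono K integral_mono)
        show "integrable lborel (\<lambda>t. \<Sum>m\<in>M. norm (f t) powr p * wtn (real_lattice_vec c d J x m - t))"
          by (intro Bochner_Integration.integrable_sum integrable_powr_wtn)
        show "integrable lborel (\<lambda>t. norm (f t) powr p * D)" by (intro integrable_mult_left f_int)
        show "(\<Sum>m\<in>M. norm (f t) powr p * wtn (real_lattice_vec c d J x m - t)) \<le> norm (f t) powr p * D" for t
          unfolding sum_distrib_left[symmetric] by (intro mult_left_mono sumw M) auto
      qed
      finally show ?thesis .
    qed
    then show "bdd_above (sum (\<lambda>m. wconv f (real_lattice_vec c d J x m) powr p) ` {F. F \<subseteq> PiE J (\<lambda>_. UNIV) \<and> finite F})"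
      unfolding bdd_above_def by (intro exI[of _ ?b]) auto
  qed simp
qed

lemma kernel_integral_integrable:
  assumes \<kappa>: "\<And>j. exp_kernel (R j) (\<kappa> j)"
  shows "integrable lborel (\<lambda>x. f x * kernel_prod \<kappa> z x)"
proof -
  obtain C where C: "0 \<le> C"
    "\<And>z x. norm (kernel_prod \<kappa> z x) \<le> C * exp (\<Sum>j\<in>UNIV. R j * \<bar>Im (z $ j)\<bar>) * wtn (re_vec z - x)"
    using kernel_prod_bound[where R=R and \<kappa>=\<kappa>, OF \<kappa>] by blast
  let ?E = "C * exp (\<Sum>j\<in>UNIV. R j * \<bar>Im (z $ j)\<bar>)"
  note [measurable] = borel_measurable_kernel_prod[where R=R and \<kappa>=\<kappa>, OF \<kappa>]
  show ?thesis
  proof (rule Bochner_Integration.integrable_bound)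
    show "integrable lborel (\<lambda>x. ?E * (norm (f x) * wtn (re_vec z - x)))"
      by (intro integrable_mult_right integrable_wconv)
    have "norm (f x * kernel_prod \<kappa> z x) \<le> ?E * (norm (f x) * wtn (re_vec z - x))" for x
      using mult_left_mono[OF C(2)[of z x], of "norm (f x)"] by (simp add: norm_mult mult_ac)
    then show "AE x in lborel. norm (f x * kernel_prod \<kappa> z x) \<le> norm (?E * (norm (f x) * wtn (re_vec z - x)))"
      using C(1) by (intro always_eventually allI) (simp add: abs_mult)
  qed measurable
qed

lemma kernel_integral_bound:
  assumes \<kappa>: "\<And>j. exp_kernel (R j) (\<kappa> j)"
  obtains C where "0 \<le> C"
    "\<And>z. norm (kernel_integral f \<kappa> z) \<le> C * exp (\<Sum>j\<in>UNIV. R j * \<bar>Im (z $ j)\<bar>) * wconv f (re_vec z)"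
proof -
  obtain C where C: "0 \<le> C"
    "\<And>z x. norm (kernel_prod \<kappa> z x) \<le> C * exp (\<Sum>j\<in>UNIV. R j * \<bar>Im (z $ j)\<bar>) * wtn (re_vec z - x)"
    using kernel_prod_bound[where R=R and \<kappa>=\<kappa>, OF \<kappa>] by blast
  have "norm (kernel_integral f \<kappa> z) \<le> C * exp (\<Sum>j\<in>UNIV. R j * \<bar>Im (z $ j)\<bar>) * wconv f (re_vec z)" for z
  proof -
    let ?E = "C * exp (\<Sum>j\<in>UNIV. R j * \<bar>Im (z $ j)\<bar>)"
    have "norm (kernel_integral f \<kappa> z) \<le> (LINT x|lborel. ?E * (norm (f x) * wtn (re_vec z - x)))"
      unfolding kernel_integral_def
    proof (rule Bochner_Integration.integral_norm_bound_integral)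
      show "norm (f x * kernel_prod \<kappa> z x) \<le> ?E * (norm (f x) * wtn (re_vec z - x))" for x
        using mult_left_mono[OF C(2)[of z x], of "norm (f x)"] by (simp add: norm_mult mult_ac)
    qed (intro kernel_integral_integrable[where R=R and \<kappa>=\<kappa>, OF \<kappa>] integrable_mult_right integrable_wconv)+
    then show ?thesis by (simp add: wconv_def)
  qed
  then show ?thesis using that C by blast
qed

end

section \<open>Entire extensions\<close>

lemma prod_fun_upd:
  fixes \<kappa> :: "'n::finite \<Rightarrow> 'a \<Rightarrow> 'b::comm_monoid_mult"
  shows "(\<Prod>i\<in>UNIV. (\<kappa>(j := g)) i (y i)) = g (y j) * (\<Prod>i\<in>UNIV - {j}. \<kappa> i (y i))"
  by (subst prod.remove[of UNIV j]) (auto intro!: prod.cong)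

lemma kernel_prod_upd:
  "kernel_prod (\<kappa>(j := g)) z x = g (z $ j - of_real (x $ j)) * (\<Prod>i\<in>UNIV - {j}. \<kappa> i (z $ i - of_real (x $ i)))"
  unfolding kernel_prod_def by (rule prod_fun_upd)

lemma norm_component_le_complex: "norm (v $ j) \<le> norm (v :: complex^'n)"
  by (rule Finite_Cartesian_Product.norm_nth_le)

text \<open>The remainder is estimated along the complex line through \<open>z\<close> in the direction \<open>v\<close>.\<close>

lemma kernel_prod_taylor:
  fixes z :: "complex^'n"
  assumes \<kappa>: "\<And>j. exp_kernel (R j) (\<kappa> j)" and R: "\<And>j. 0 \<le> R j"
  obtains K where "0 \<le> K" "\<And>v x. norm v \<le> 1 \<Longrightarrow> norm (kernel_prod \<kappa> (z + v) x - kernel_prod \<kappa> z x 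
      - (\<Sum>j\<in>UNIV. v $ j * kernel_prod (\<kappa>(j := deriv (\<kappa> j))) z x)) \<le> K * (norm v)\<^sup>2 * wtn (re_vec z - x)"
proof -
  obtain C where C: "0 \<le> C"
    "\<And>z x. norm (kernel_prod \<kappa> z x) \<le> C * exp (\<Sum>j\<in>UNIV. R j * \<bar>Im (z $ j)\<bar>) * wtn (re_vec z - x)"
    using kernel_prod_bound[where R=R and \<kappa>=\<kappa>, OF \<kappa>] by blast
  \<comment> \<open>Bounds the kernel product on the complex disc of radius 2 in a normalised
    direction: each imaginary part grows by at most 2, and Peetre's inequality with shift at most 2
    costs 2 (1 + 4) = 10 in each coordinate.\<close>
  define L where "L = C * exp (\<Sum>j\<in>UNIV. R j * (\<bar>Im (z $ j)\<bar> + 2)) * 10 ^ CARD('n)"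
  have L0: "0 \<le> L" using C by (simp add: L_def)
  have main: "norm (kernel_prod \<kappa> (z + v) x - kernel_prod \<kappa> z x 
      - (\<Sum>j\<in>UNIV. v $ j * kernel_prod (\<kappa>(j := deriv (\<kappa> j))) z x)) \<le> (2 * L) * (norm v)\<^sup>2 * wtn (re_vec z - x)" 
    if v: "norm v \<le> 1" for v x
  proof (cases "v = 0")
    case False
    define r where "r = norm v"
    have r: "0 < r" "r \<le> 1" using False v by (auto simp: r_def)
    define e where "e j = v $ j / of_real r" for j
    have e: "norm (e j) \<le> 1" for j
      using norm_component_le_complex[of v j] r by (simp add: e_def norm_divide divide_le_eq r_def)
    define \<phi> where "\<phi> s = kernel_prod \<kappa> (\<chi> j. z $ j + s * e j) x" for s
    have d\<phi>: "(\<phi> has_field_derivative (\<Sum>j\<in>UNIV. (e j * deriv (\<kappa> j) (z $ j + s * e j - of_real (x $ j)))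
        * (\<Prod>i\<in>UNIV - {j}. \<kappa> i (z $ i + s * e i - of_real (x $ i))))) (at s)" for s
    proof -
      have "((\<lambda>s. \<kappa> j (z $ j + s * e j - of_real (x $ j))) has_field_derivative 
         e j * deriv (\<kappa> j) (z $ j + s * e j - of_real (x $ j))) (at s)" for j
      proof -
        have "(\<kappa> j has_field_derivative deriv (\<kappa> j) (z $ j + s * e j - of_real (x $ j))) (at (z $ j + s * e j - of_real (x $ j)))"
          using exp_kernelD(1)[OF \<kappa>[of j]] by (simp add: holomorphic_derivI)
        moreover have "((\<lambda>s. z $ j + s * e j - of_real (x $ j)) has_field_derivative e j) (at s)"
          by (auto intro!: derivative_eq_intros)
        ultimately have "((\<lambda>s. \<kappa> j (z $ j + s * e j - of_real (x $ j))) has_field_derivative 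
           deriv (\<kappa> j) (z $ j + s * e j - of_real (x $ j)) * e j) (at s)"
          by (rule DERIV_chain2)
        then show ?thesis by (simp only: mult.commute)
      qed
      then show ?thesis unfolding \<phi>_def kernel_prod_def vec_lambda_beta
        by (intro has_field_derivative_prod) auto
    qed
    have hol: "\<phi> holomorphic_on A" for A
      using d\<phi> by (meson holomorphic_on_subset holomorphic_on_open open_UNIV subset_UNIV)
    have b\<phi>: "norm (\<phi> s) \<le> L * wtn (re_vec z - x)" if s: "norm s \<le> 2" for s
    proof -
      have se: "norm (s * e j) \<le> 2" for j
        using mult_mono[OF s e[of j]] by (simp add: norm_mult)
      have "norm (\<phi> s) \<le> C * exp (\<Sum>j\<in>UNIV. R j * \<bar>Im (z $ j + s * e j)\<bar>) * wtn (re_vec (\<chi> j. z $ j + s * e j) - x)"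
        unfolding \<phi>_def using C(2)[of "\<chi> j. z $ j + s * e j" x] by simp
      also have "\<dots> \<le> C * exp (\<Sum>j\<in>UNIV. R j * (\<bar>Im (z $ j)\<bar> + 2)) * (10 ^ CARD('n) * wtn (re_vec z - x))"
      proof (intro mult_mono mult_left_mono C)
        have "\<bar>Im (z $ j + s * e j)\<bar> \<le> \<bar>Im (z $ j)\<bar> + 2" for j
        proof -
          have "\<bar>Im (z $ j + s * e j)\<bar> \<le> \<bar>Im (z $ j)\<bar> + \<bar>Im (s * e j)\<bar>" unfolding plus_complex.sel by (rule abs_triangle_ineq)
          also have "\<bar>Im (s * e j)\<bar> \<le> 2" using abs_Im_le_cmod se order_trans by blast
          finally show ?thesis by simp
        qed
        then show "exp (\<Sum>j\<in>UNIV. R j * \<bar>Im (z $ j + s * e j)\<bar>) \<le> exp (\<Sum>j\<in>UNIV. R j * (\<bar>Im (z $ j)\<bar> + 2))"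
          by (simp add: sum_mono mult_left_mono R)
        have "wt (Re (z $ j + s * e j) - x $ j) \<le> 10 * wt (Re (z $ j) - x $ j)" for j
        proof -
          have "\<bar>Re (s * e j)\<bar> \<le> 2" using abs_Re_le_cmod se order_trans by blast
          then have "(Re (s * e j))\<^sup>2 \<le> 2\<^sup>2" by (rule power2_le_iff_abs_le[THEN iffD2, rotated]) simp
          then have a: "2 * (1 + (Re (s * e j))\<^sup>2) * wt (Re (z $ j) - x $ j) \<le> 10 * wt (Re (z $ j) - x $ j)"
            by (intro mult_right_mono) auto
          have b: "Re (z $ j + s * e j) - x $ j = (Re (z $ j) - x $ j) + Re (s * e j)" by simp
          show ?thesis unfolding b by (rule order_trans[OF wt_shift a])
        qed
        then have "(\<Prod>j\<in>UNIV. wt (Re (z $ j + s * e j) - x $ j)) \<le> (\<Prod>j\<in>UNIV. 10 * wt (Re (z $ j) - x $ j))"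
          by (intro prod_mono) auto
        then show "wtn (re_vec (\<chi> j. z $ j + s * e j) - x) \<le> 10 ^ CARD('n) * wtn (re_vec z - x)"
          by (simp add: wtn_def re_vec_def prod.distrib)
      qed (use C in auto)
      finally show ?thesis by (simp add: L_def mult_ac)
    qed
    \<comment> \<open>Cauchy circles of radius 1 around points of the unit disc stay within radius
      2, and the Taylor point \<open>r\<close> lies in the unit disc because \<open>norm v\<close>
      is at most 1.\<close>
    have b2: "norm ((deriv ^^ 2) \<phi> w) \<le> 2 * (L * wtn (re_vec z - x))" if w: "w \<in> cball 0 1" for w
    proof -
      have "norm ((deriv ^^ 2) \<phi> w) \<le> fact 2 * (L * wtn (re_vec z - x)) / 1 ^ 2"
      proof (rule Cauchy_inequality)
        fix y assume "norm (w - y) = 1"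
        then have "norm y \<le> 2" using w norm_triangle_ineq2[of y w] by (simp add: norm_minus_commute)
        then show "norm (\<phi> y) \<le> L * wtn (re_vec z - x)" by (rule b\<phi>)
      qed (use hol in \<open>auto intro: holomorphic_on_imp_continuous_on\<close>)
      then show ?thesis by simp
    qed
    have "norm ((deriv ^^ 0) \<phi> (of_real r) - (\<Sum>i\<le>1. (deriv ^^ i) \<phi> 0 * (of_real r - 0) ^ i / fact i)) 
        \<le> (2 * (L * wtn (re_vec z - x))) * norm (of_real r - (0::complex)) ^ Suc 1 / fact 1"
    proof (rule complex_Taylor[where S="cball 0 1" and f="\<lambda>i. (deriv ^^ i) \<phi>"])
      fix i x assume "x \<in> cball (0::complex) 1"
      have "(deriv ^^ i) \<phi> holomorphic_on UNIV" by (rule holomorphic_higher_deriv[OF hol]) simp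
      then show "((deriv ^^ i) \<phi> has_field_derivative (deriv ^^ Suc i) \<phi> x) (at x within cball 0 1)"
        by (simp add: holomorphic_derivI has_field_derivative_at_within)
    qed (use b2 r in \<open>auto simp: numeral_2_eq_2\<close>)
    moreover have "\<phi> (of_real r) = kernel_prod \<kappa> (z + v) x"
    proof -
      have "(\<chi> j. z $ j + of_real r * e j) = z + v" using r by (simp add: e_def vec_eq_iff)
      then show ?thesis by (simp add: \<phi>_def)
    qed
    moreover have "\<phi> 0 = kernel_prod \<kappa> z x" by (simp add: \<phi>_def)
    moreover have "deriv \<phi> 0 * of_real r = (\<Sum>j\<in>UNIV. v $ j * kernel_prod (\<kappa>(j := deriv (\<kappa> j))) z x)"
      using r unfolding DERIV_imp_deriv[OF d\<phi>] kernel_prod_upd sum_distrib_right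
      by (intro sum.cong) (auto simp: e_def)
    ultimately show ?thesis using r by (simp add: r_def[symmetric] mult_ac power2_eq_square diff_diff_eq)
  qed (simp add: L0)
  show ?thesis by (rule that[of "2 * L"]) (use main L0 in auto)
qed

lemma bounded_linear_scale_axis: "bounded_linear (\<lambda>w::complex. w *s axis j (1::complex))"
proof -
  have "linear (\<lambda>w::complex. w *s axis j (1::complex))"
    by (rule linearI) (simp_all add: vec_eq_iff distrib_right)
  then show ?thesis by (simp only: linear_conv_bounded_linear)
qed

context Lp_function
begin

lemma exp_kernel_upd:
  assumes \<kappa>: "\<And>j. exp_kernel (R j) (\<kappa> j)" and R: "\<And>j. 0 \<le> R j"
  shows "exp_kernel (R i) ((\<kappa>(j := deriv (\<kappa> j))) i)"
  using \<kappa> exp_kernel_deriv[OF \<kappa> R] by simp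

text \<open>The Taylor remainder of the kernel is quadratic in \<open>v\<close> with the weight as
  profile in \<open>x\<close>; integrated against |f| it stays quadratic, with constant
  \<open>K * wconv f (re_vec z)\<close>.\<close>

lemma kernel_integral_has_derivative:
  assumes \<kappa>: "\<And>j. exp_kernel (R j) (\<kappa> j)" and R: "\<And>j. 0 \<le> R j"
  shows "(kernel_integral f \<kappa> has_derivative (\<lambda>v. \<Sum>j\<in>UNIV. v $ j * kernel_integral f (\<kappa>(j := deriv (\<kappa> j))) z)) (at z)"
proof -
  obtain K where K: "0 \<le> K" "\<And>v x. norm v \<le> 1 \<Longrightarrow> norm (kernel_prod \<kappa> (z + v) x - kernel_prod \<kappa> z x 
      - (\<Sum>j\<in>UNIV. v $ j * kernel_prod (\<kappa>(j := deriv (\<kappa> j))) z x)) \<le> K * (norm v)\<^sup>2 * wtn (re_vec z - x)"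
    using kernel_prod_taylor[where R=R and \<kappa>=\<kappa> and z=z, OF \<kappa> R] by blast
  have \<kappa>': "exp_kernel (R i) ((\<kappa>(j := deriv (\<kappa> j))) i)" for i j
    by (rule exp_kernel_upd[where R=R and \<kappa>=\<kappa>, OF \<kappa> R])
  let ?D = "\<lambda>v. \<Sum>j\<in>UNIV. v $ j * kernel_integral f (\<kappa>(j := deriv (\<kappa> j))) z"
  have est: "norm (kernel_integral f \<kappa> (z + v) - kernel_integral f \<kappa> z - ?D v) \<le> K * wconv f (re_vec z) * (norm v)\<^sup>2" if v: "norm v \<le> 1" for v
  proof -
    let ?g = "\<lambda>x. f x * (kernel_prod \<kappa> (z + v) x - kernel_prod \<kappa> z x 
      - (\<Sum>j\<in>UNIV. v $ j * kernel_prod (\<kappa>(j := deriv (\<kappa> j))) z x))"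
    have eq: "?g x = f x * kernel_prod \<kappa> (z + v) x - f x * kernel_prod \<kappa> z x
       - (\<Sum>j\<in>UNIV. v $ j * (f x * kernel_prod (\<kappa>(j := deriv (\<kappa> j))) z x))" for x
      by (simp add: right_diff_distrib sum_distrib_left mult_ac)
    have i: "integrable lborel (\<lambda>x. f x * kernel_prod \<kappa> w x)" for w by (rule kernel_integral_integrable[where R=R and \<kappa>=\<kappa>, OF \<kappa>])
    have i': "integrable lborel (\<lambda>x. v $ j * (f x * kernel_prod (\<kappa>(j := deriv (\<kappa> j))) z x))" for j
      by (intro integrable_mult_right kernel_integral_integrable[where R=R, OF \<kappa>'[of _ j]])
    have int: "integrable lborel ?g"
      unfolding eq by (intro Bochner_Integration.integrable_diff Bochner_Integration.integrable_sum i i')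
    have "kernel_integral f \<kappa> (z + v) - kernel_integral f \<kappa> z - ?D v = (LINT x|lborel. ?g x)"
      unfolding eq kernel_integral_def
      by (simp add: Bochner_Integration.integral_diff Bochner_Integration.integral_sum i i' Bochner_Integration.integrable_diff Bochner_Integration.integrable_sum)
    also have "norm \<dots> \<le> (LINT x|lborel. K * (norm v)\<^sup>2 * (norm (f x) * wtn (re_vec z - x)))"
    proof (rule Bochner_Integration.integral_norm_bound_integral[OF int])
      show "integrable lborel (\<lambda>x. K * (norm v)\<^sup>2 * (norm (f x) * wtn (re_vec z - x)))"
        by (intro integrable_mult_right integrable_wconv)
      show "norm (?g x) \<le> K * (norm v)\<^sup>2 * (norm (f x) * wtn (re_vec z - x))" for x
        using mult_left_mono[OF K(2)[OF v, of x], of "norm (f x)"] by (simp add: norm_mult mult_ac)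
    qed
    also have "\<dots> = K * wconv f (re_vec z) * (norm v)\<^sup>2" by (simp add: wconv_def)
    finally show ?thesis .
  qed
  show ?thesis
  proof (rule has_derivativeI_sandwich[of 1])
    show "bounded_linear ?D"
      by (intro bounded_linear_sum bounded_linear_mult_const bounded_linear_vec_nth)
    show "((\<lambda>y. K * wconv f (re_vec z) * norm (y - z)) \<longlongrightarrow> 0) (at z)"
      by (auto intro!: tendsto_eq_intros)
    fix y assume y: "y \<noteq> z" "dist y z < 1"
    then have "norm (kernel_integral f \<kappa> y - kernel_integral f \<kappa> z - ?D (y - z)) \<le> K * wconv f (re_vec z) * (norm (y - z))\<^sup>2"
      using est[of "y - z"] by (simp add: dist_norm)
    then show "norm (kernel_integral f \<kappa> y - kernel_integral f \<kappa> z - ?D (y - z)) / norm (y - z) \<le> K * wconv f (re_vec z) * norm (y - z)"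
      using y by (simp add: divide_le_eq power2_eq_square mult_ac)
  qed simp
qed

lemma kernel_integral_entire:
  assumes "\<And>j. exp_kernel (R j) (\<kappa> j)" and "\<And>j. 0 \<le> R j"
  shows "entire (kernel_integral f \<kappa>)"
  unfolding entire_def
  using kernel_integral_has_derivative[where R=R and \<kappa>=\<kappa>, OF assms] by (fastforce simp: sum_distrib_left mult_ac)

lemma kernel_integral_coordinate_derivative:
  assumes "\<And>j. exp_kernel (R j) (\<kappa> j)" and "\<And>j. 0 \<le> R j"
  shows "((\<lambda>w. kernel_integral f \<kappa> (z + w *s axis j 1)) has_field_derivative kernel_integral f (\<kappa>(j := deriv (\<kappa> j))) z) (at 0)"
proof -
  have d: "((\<lambda>w::complex. z + w *s axis j 1) has_derivative (\<lambda>w. w *s axis j 1)) (at 0)"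
  proof -
    have "bounded_linear (\<lambda>w::complex. w *s axis j (1::complex))"
      by (rule bounded_linear_scale_axis)
    then show ?thesis by (auto intro!: derivative_eq_intros bounded_linear_imp_has_derivative)
  qed
  have "(kernel_integral f \<kappa> has_derivative (\<lambda>v. \<Sum>j\<in>UNIV. v $ j * kernel_integral f (\<kappa>(j := deriv (\<kappa> j))) z)) (at (z + 0 *s axis j 1))"
    using kernel_integral_has_derivative[where R=R and \<kappa>=\<kappa>, OF assms] by simp
  from has_derivative_compose[OF d this]
  have "((\<lambda>w. kernel_integral f \<kappa> (z + w *s axis j 1)) has_derivative (\<lambda>w. \<Sum>i\<in>UNIV. (w *s axis j 1) $ i * kernel_integral f (\<kappa>(i := deriv (\<kappa> i))) z)) (at 0)" .
  moreover have "(\<Sum>i\<in>UNIV. (w *s axis j 1) $ i * kernel_integral f (\<kappa>(i := deriv (\<kappa> i))) z) = kernel_integral f (\<kappa>(j := deriv (\<kappa> j))) z * w" for w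
    by (subst sum.remove[of UNIV j]) (auto simp: axis_def intro!: sum.neutral)
  ultimately show ?thesis by (simp add: has_field_derivative_def)
qed

lemma partial_kernel_integral:
  assumes "\<And>j. exp_kernel (R j) (\<kappa> j)" and "\<And>j. 0 \<le> R j"
  shows "partial_complex j (kernel_integral f \<kappa>) = kernel_integral f (\<kappa>(j := deriv (\<kappa> j)))"
  unfolding partial_complex_def using DERIV_imp_deriv[OF kernel_integral_coordinate_derivative[where R=R and \<kappa>=\<kappa>, OF assms]] by auto

lemma partial_iter_kernel_integral:
  assumes \<kappa>: "\<And>j. exp_kernel (R j) (\<kappa> j)" and R: "\<And>j. 0 \<le> R j"
  shows "(partial_complex j ^^ k) (kernel_integral f \<kappa>) = kernel_integral f (\<kappa>(j := (deriv ^^ k) (\<kappa> j)))"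
proof (induction k)
  case (Suc k)
  have "exp_kernel (R i) ((\<kappa>(j := (deriv ^^ k) (\<kappa> j))) i)" for i
    using \<kappa> exp_kernel_higher_deriv[OF \<kappa> R] by simp
  from partial_kernel_integral[where R=R and \<kappa>="\<kappa>(j := (deriv ^^ k) (\<kappa> j))" and j=j, OF this R]
  have "partial_complex j (kernel_integral f (\<kappa>(j := (deriv ^^ k) (\<kappa> j)))) = kernel_integral f (\<kappa>(j := deriv ((deriv ^^ k) (\<kappa> j))))"
    by (simp only: fun_upd_upd fun_upd_same)
  then show ?case by (simp only: funpow.simps o_def Suc)
qed simp

lemma coordinates_props: "distinct (coordinates :: 'a::finite list)" "set (coordinates :: 'a list) = UNIV"
proof -
  have "\<exists>js :: 'a list. distinct js \<and> set js = UNIV"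
    using finite_distinct_list[of "UNIV :: 'a set"] by auto
  from someI_ex[OF this] show "distinct (coordinates :: 'a::finite list)" "set (coordinates :: 'a list) = UNIV"
    unfolding coordinates_def by auto
qed

text \<open>Each derivative acts on the kernel of its own coordinate, so the listing order does not
  show in the result. Distinctness of the list guarantees that a kernel is still undifferentiated
  when its coordinate is reached.\<close>

lemma multi_deriv_kernel_integral:
  assumes \<kappa>: "\<And>j. exp_kernel (R j) (\<kappa> j)" and R: "\<And>j. 0 \<le> R j"
  shows "multi_deriv k (kernel_integral f \<kappa>) = kernel_integral f (\<lambda>j. (deriv ^^ (k $ j)) (\<kappa> j))"
proof -
  have "foldr (\<lambda>j. partial_complex j ^^ (k $ j)) js (kernel_integral f \<kappa>) 
      = kernel_integral f (\<lambda>j. if j \<in> set js then (deriv ^^ (k $ j)) (\<kappa> j) else \<kappa> j)" if "distinct js" for js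
    using that
  proof (induction js)
    case (Cons a js)
    let ?\<kappa> = "\<lambda>j. if j \<in> set js then (deriv ^^ (k $ j)) (\<kappa> j) else \<kappa> j"
    have "exp_kernel (R i) (?\<kappa> i)" for i using \<kappa> exp_kernel_higher_deriv[OF \<kappa> R] by simp
    from partial_iter_kernel_integral[where R=R and \<kappa>="?\<kappa>" and j=a and k="k $ a", OF this R] Cons
    have "foldr (\<lambda>j. partial_complex j ^^ (k $ j)) (a # js) (kernel_integral f \<kappa>) = kernel_integral f (?\<kappa>(a := (deriv ^^ (k $ a)) (?\<kappa> a)))" by simp
    also have "?\<kappa>(a := (deriv ^^ (k $ a)) (?\<kappa> a)) = (\<lambda>j. if j \<in> set (a # js) then (deriv ^^ (k $ j)) (\<kappa> j) else \<kappa> j)"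
      using Cons.prems by auto
    finally show ?case .
  qed simp
  from this[OF coordinates_props(1)] show ?thesis
    unfolding multi_deriv_def by (simp add: coordinates_props)
qed

end

section \<open>Uniqueness of the entire extension\<close>

text \<open>On the real subspace the difference is continuous and zero almost everywhere, hence
  zero, because a nonempty open set is not negligible. The coordinates are then released from the
  real line one at a time, each by the identity theorem in one variable.\<close>

lemma entire_eq:
  fixes F G :: "complex^'n \<Rightarrow> complex"
  assumes F: "entire F" and G: "entire G" and eq: "AE x in lebesgue. F (complex_vec x) = G (complex_vec x)"
  shows "F = G"
proof -
  have D: "\<exists>D. ((\<lambda>z. F z - G z) has_derivative D) (at z) \<and> (\<forall>c v. D (c *s v) = c * D v)" for z
  proof -
    obtain D1 where D1: "(F has_derivative D1) (at z)" "\<forall>c v. D1 (c *s v) = c * D1 v"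
    proof -
      have "\<exists>D. (F has_derivative D) (at z) \<and> (\<forall>c v. D (c *s v) = c * D v)"
        using F unfolding entire_def by (rule spec)
      then show ?thesis by (elim exE conjE) (rule that)
    qed
    obtain D2 where D2: "(G has_derivative D2) (at z)" "\<forall>c v. D2 (c *s v) = c * D2 v"
    proof -
      have "\<exists>D. (G has_derivative D) (at z) \<and> (\<forall>c v. D (c *s v) = c * D v)"
        using G unfolding entire_def by (rule spec)
      then show ?thesis by (elim exE conjE) (rule that)
    qed
    show ?thesis
      by (intro exI[of _ "\<lambda>v. D1 v - D2 v"]) (simp add: right_diff_distrib D1 D2 has_derivative_diff)
  qed
  define H where "H z = F z - G z" for z
  have Hcont: "continuous_on UNIV H"
    unfolding H_def using D by (intro continuous_at_imp_continuous_on ballI) (metis has_derivative_continuous)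
  have ccv: "continuous_on UNIV (complex_vec :: real^'n \<Rightarrow> complex^'n)"
    unfolding complex_vec_def by (intro continuous_intros)
  have cont: "continuous_on UNIV (\<lambda>x. H (complex_vec x))"
    by (rule continuous_on_compose2[OF Hcont ccv]) auto
  have real0: "H (complex_vec x) = 0" for x
  proof (rule ccontr)
    assume "H (complex_vec x) \<noteq> 0"
    define U where "U = {x. H (complex_vec x) \<noteq> 0}"
    have "open U" unfolding U_def by (intro open_Collect_neq cont continuous_on_const)
    moreover have "U \<in> null_sets lebesgue"
    proof -
      have "AE x in lebesgue. x \<notin> U" using eq by eventually_elim (simp add: U_def H_def)
      then show ?thesis using \<open>open U\<close> AE_iff_null_sets[of U lebesgue] by (auto intro: borel_open)
    qed
    then have "negligible U" by (simp add: negligible_iff_null_sets)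
    ultimately have "U = {}" using open_not_negligible by blast
    then show False using \<open>H (complex_vec x) \<noteq> 0\<close> by (auto simp: U_def)
  qed
  \<comment> \<open>\<open>J\<close> is the set of coordinates already allowed to be
    complex.\<close>
  have "\<forall>z. (\<forall>j. j \<notin> J \<longrightarrow> Im (z $ j) = 0) \<longrightarrow> H z = 0" if "finite J" for J :: "'n set"
    using that
  proof induction
    case empty
    show ?case
    proof (intro allI impI)
      fix z :: "complex^'n" assume "\<forall>j. j \<notin> {} \<longrightarrow> Im (z $ j) = 0"
      then have "z = complex_vec (re_vec z)" by (simp add: vec_eq_iff complex_vec_def re_vec_def complex_eq_iff)
      then show "H z = 0" using real0 by metis
    qed
  next
    case (insert j J)
    show ?case
    proof (intro allI impI)
      fix z :: "complex^'n" assume z: "\<forall>i. i \<notin> insert j J \<longrightarrow> Im (z $ i) = 0"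
      define c where "c w = (\<chi> i. if i = j then w else z $ i)" for w
      have c: "c w = (c 0) + w *s axis j 1" for w by (auto simp: c_def vec_eq_iff axis_def)
      have dc: "(c has_derivative (\<lambda>w. w *s axis j 1)) (at w)" for w
      proof -
        have bl: "bounded_linear (\<lambda>w::complex. w *s axis j (1::complex))"
          by (rule bounded_linear_scale_axis)
        have "((\<lambda>w. c 0 + w *s axis j 1) has_derivative (\<lambda>w. w *s axis j 1)) (at w)"
          using bl by (auto intro!: derivative_eq_intros bounded_linear_imp_has_derivative)
        moreover have "c = (\<lambda>w. c 0 + w *s axis j 1)" by (rule ext) (rule c)
        ultimately show ?thesis by (rule ssubst[rotated])
      qed
      have hol: "(\<lambda>w. H (c w)) holomorphic_on UNIV"
        unfolding holomorphic_on_open[OF open_UNIV]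
      proof
        fix w
        obtain D' where D': "(H has_derivative D') (at (c w))" "\<forall>a v. D' (a *s v) = a * D' v"
          using D[of "c w"] unfolding H_def by blast
        have "((\<lambda>w. H (c w)) has_derivative (\<lambda>w. D' (w *s axis j 1))) (at w)"
          by (rule has_derivative_compose[OF dc D'(1)])
        then have "((\<lambda>w. H (c w)) has_field_derivative D' (axis j 1)) (at w)"
          unfolding has_field_derivative_def D'(2)[rule_format] by (simp only: mult_commute_abs)
        then show "\<exists>f'. ((\<lambda>w. H (c w)) has_field_derivative f') (at w)" by blast
      qed
      have zero: "H (c w) = 0" if "w \<in> \<real>" for w
        using insert.IH z that by (auto simp: c_def complex_is_Real_iff)
      have "H (c (z $ j)) = 0"
      proof (rule analytic_continuation[OF hol, of "\<real>" 0])
        show "0 islimpt (\<real> :: complex set)"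
        proof -
          have "(\<lambda>n. complex_of_real (1 / real (Suc n))) \<longlonglongrightarrow> of_real 0"
            by (intro tendsto_of_real LIMSEQ_Suc[OF lim_const_over_n])
          moreover have "complex_of_real (1 / real (Suc n)) \<in> \<real> - {0}" for n
            by (simp del: of_nat_Suc)
          ultimately show ?thesis
            unfolding islimpt_sequential by (intro exI[of _ "\<lambda>n. complex_of_real (1 / real (Suc n))"]) auto
        qed
      qed (use zero in auto)
      moreover have "c (z $ j) = z" by (auto simp: c_def vec_eq_iff)
      ultimately show "H z = 0" by simp
    qed
  qed
  from this[of UNIV] show ?thesis by (auto simp: H_def)
qed

lemma entire_extension_eqI:
  assumes "entire F" "AE x in lebesgue. F (complex_vec x) = f x"
  shows "entire_extension f = F"
  unfolding entire_extension_def
proof (rule the_equality)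
  fix G assume G: "entire G \<and> (AE x in lebesgue. G (complex_vec x) = f x)"
  then have "AE x in lebesgue. G (complex_vec x) = F (complex_vec x)"
    using assms(2) by (auto elim: eventually_elim2)
  then show "G = F" using G assms(1) entire_eq by blast
qed (use assms in auto)

section \<open>Sampling in several variables\<close>

definition vset :: "'a^'n \<Rightarrow> 'n \<Rightarrow> 'a \<Rightarrow> 'a^'n" where
  "vset z j w = (\<chi> i. if i = j then w else z $ i)"

lemma vset_nth [simp]: "vset z j w $ i = (if i = j then w else z $ i)"
  by (simp add: vset_def)

definition lattice_vec :: "('n \<Rightarrow> real) \<Rightarrow> ('n \<Rightarrow> real) \<Rightarrow> 'n set \<Rightarrow> complex^'n \<Rightarrow> ('n \<Rightarrow> int) \<Rightarrow> complex^'n" where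
  "lattice_vec c d J z m = (\<chi> j. if j \<in> J then of_real (c j * of_int (m j) + d j) else z $ j)"

text \<open>\<open>index_cube\<close> restricted to the sampled coordinates;
  \<open>cube UNIV\<close> is the whole of it.\<close>

definition cube :: "'n set \<Rightarrow> (nat^'n) set" where
  "cube J = {l. \<forall>j. l $ j \<in> {0, 1} \<and> (j \<notin> J \<longrightarrow> l $ j = 0)}"

lemma cubeD: "l \<in> cube J \<Longrightarrow> l $ j = 0 \<or> l $ j = 1" "l \<in> cube J \<Longrightarrow> j \<notin> J \<Longrightarrow> l $ j = 0"
  by (auto simp: cube_def)

lemma cubeI: "(\<And>j. l $ j = 0 \<or> l $ j = 1) \<Longrightarrow> (\<And>j. j \<notin> J \<Longrightarrow> l $ j = 0) \<Longrightarrow> l \<in> cube J"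
  by (simp add: cube_def)

lemma finite_cube: "finite (cube J)"
proof (rule finite_subset)
  show "cube J \<subseteq> vec_lambda ` (PiE UNIV (\<lambda>_. {0, 1}))"
  proof
    fix l assume "l \<in> cube J"
    then have "l $ j = 0 \<or> l $ j = 1" for j by (rule cubeD(1))
    then have "vec_nth l \<in> PiE UNIV (\<lambda>_. {0, 1})" unfolding PiE_UNIV_domain Pi_iff by simp
    then show "l \<in> vec_lambda ` (PiE UNIV (\<lambda>_. {0, 1}))" by (metis image_eqI vec_nth_inverse)
  qed
  show "finite (vec_lambda ` (PiE UNIV (\<lambda>_. {0::nat, 1})))" by (intro finite_imageI finite_PiE) auto
qed

lemma cube_empty: "cube {} = {0}"
  by (auto simp: cube_def vec_eq_iff)

lemma sum_cube_insert:
  assumes "j \<notin> J"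
  shows "(\<Sum>l\<in>cube (insert j J). g l) = (\<Sum>a\<in>{0, 1}. \<Sum>l\<in>cube J. g (vset l j a))"
proof -
  have inj: "inj_on (\<lambda>(a, l). vset l j a) ({0, 1} \<times> cube J)"
  proof (rule inj_onI)
    fix x y assume x: "x \<in> {0, 1} \<times> cube J" "y \<in> {0, 1} \<times> cube J"
      and eq: "(\<lambda>(a, l). vset l j a) x = (\<lambda>(a, l). vset l j a) y"
    obtain a l b m where xy: "x = (a, l)" "y = (b, m)" by (cases x; cases y) auto
    have e: "vset l j a $ i = vset m j b $ i" for i using eq xy by simp
    have "a = b" using e[of j] by simp
    moreover have "l $ i = m $ i" for i
      using e[of i] x xy assms by (cases "i = j") (auto simp: cube_def)
    ultimately show "x = y" using xy by (simp add: vec_eq_iff)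
  qed
  have img: "(\<lambda>(a, l). vset l j a) ` ({0, 1} \<times> cube J) = cube (insert j J)"
  proof (intro equalityI subsetI)
    fix l assume l: "l \<in> cube (insert j J)"
    have "l = (\<lambda>(a, l). vset l j a) (l $ j, vset l j 0)" by (simp add: vec_eq_iff)
    moreover have "(l $ j, vset l j 0) \<in> {0, 1} \<times> cube J" using l assms unfolding cube_def by auto
    ultimately show "l \<in> (\<lambda>(a, l). vset l j a) ` ({0, 1} \<times> cube J)" by blast
  next
    fix l assume "l \<in> (\<lambda>(a, l). vset l j a) ` ({0, 1} \<times> cube J)"
    then obtain a l' where l: "l = vset l' j a" "a \<in> {0, 1}" "l' \<in> cube J" by auto
    show "l \<in> cube (insert j J)"
      using l(2) cubeD[OF l(3)] unfolding l(1) by (intro cubeI) auto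
  qed
  have "(\<Sum>l\<in>cube (insert j J). g l) = (\<Sum>x\<in>{0, 1} \<times> cube J. g ((\<lambda>(a, l). vset l j a) x))"
    unfolding img[symmetric] by (rule sum.reindex[OF inj, unfolded o_def])
  also have "\<dots> = (\<Sum>a\<in>{0, 1}. \<Sum>l\<in>cube J. g (vset l j a))"
    by (simp only: sum.cartesian_product split_def fst_conv snd_conv)
  finally show ?thesis .
qed

lemma has_sum_finite_sum:
  fixes f :: "'a \<Rightarrow> 'b \<Rightarrow> 'c::{topological_comm_monoid_add, t2_space}"
  assumes "finite L" "\<And>l. l \<in> L \<Longrightarrow> (f l has_sum s l) A"
  shows "((\<lambda>m. \<Sum>l\<in>L. f l m) has_sum (\<Sum>l\<in>L. s l)) A"
  using assms by (induction L) (auto intro: has_sum_add)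

text \<open>The kernels may depend on \<open>e\<close>, while \<open>F\<close> is the same for all
  \<open>e\<close>; so the growth bounds for every \<open>e\<close> concern one function, as the
  sharpening of the type requires.\<close>

locale sampling = Lp_function f p for f :: "real^'n \<Rightarrow> complex" and p +
  fixes \<sigma> :: "real^'n" and F :: "complex^'n \<Rightarrow> complex"
  assumes \<sigma>: "\<And>j. 0 < \<sigma> $ j"
    and repr: "\<And>e. 0 < e \<Longrightarrow> \<exists>\<kappa>. (\<forall>j. exp_kernel (\<sigma> $ j + e) (\<kappa> j)) \<and> F = kernel_integral f \<kappa>"
begin

abbreviation H :: "nat^'n \<Rightarrow> complex^'n \<Rightarrow> complex" where "H k \<equiv> multi_deriv k F"

definition step :: "'n \<Rightarrow> real" where "step j = 2 * pi / \<sigma> $ j"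

lemma step_pos: "0 < step j" using \<sigma> by (simp add: step_def)

lemma H_repr:
  assumes e: "0 < e"
  obtains \<kappa> where "\<And>j. exp_kernel (\<sigma> $ j + e) (\<kappa> j)" "\<And>k. H k = kernel_integral f (\<lambda>j. (deriv ^^ (k $ j)) (\<kappa> j))"
    "\<And>k j. exp_kernel (\<sigma> $ j + e) ((deriv ^^ (k $ j)) (\<kappa> j))"
proof -
  obtain \<kappa> where \<kappa>: "\<And>j. exp_kernel (\<sigma> $ j + e) (\<kappa> j)" "F = kernel_integral f \<kappa>" using repr[OF e] by blast
  have R: "0 \<le> \<sigma> $ j + e" for j using \<sigma>[of j] e by simp
  have "H k = kernel_integral f (\<lambda>j. (deriv ^^ (k $ j)) (\<kappa> j))" for k
    unfolding \<kappa>(2) by (rule multi_deriv_kernel_integral[where R="\<lambda>j. \<sigma> $ j + e" and \<kappa>=\<kappa>, OF \<kappa>(1) R])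
  moreover have "exp_kernel (\<sigma> $ j + e) ((deriv ^^ (k $ j)) (\<kappa> j))" for k :: "nat^'n" and j
    by (rule exp_kernel_higher_deriv[OF \<kappa>(1) R])
  ultimately show ?thesis using that \<kappa>(1) by blast
qed

lemma H_bound:
  assumes e: "0 < e"
  obtains C where "0 \<le> C"
    "\<And>z. norm (H k z) \<le> C * exp (\<Sum>j\<in>UNIV. (\<sigma> $ j + e) * \<bar>Im (z $ j)\<bar>) * wconv f (re_vec z)"
proof -
  obtain \<kappa> where \<kappa>: "\<And>j. exp_kernel (\<sigma> $ j + e) (\<kappa> j)" "\<And>k. H k = kernel_integral f (\<lambda>j. (deriv ^^ (k $ j)) (\<kappa> j))"
    "\<And>k j. exp_kernel (\<sigma> $ j + e) ((deriv ^^ (k $ j)) (\<kappa> j))"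
    by (rule H_repr[OF e]) (rule that)
  show ?thesis
    unfolding \<kappa>(2)
    by (rule kernel_integral_bound[where R="\<lambda>j. \<sigma> $ j + e" and \<kappa>="\<lambda>j. (deriv ^^ (k $ j)) (\<kappa> j)", OF \<kappa>(3)])
       (rule that, unfold \<kappa>(2), assumption+)
qed

text \<open>In the representation a further derivative in coordinate \<open>j\<close> raises the
  order on the \<open>j\<close>-th kernel only, so it merges with the listed derivatives wherever
  \<open>j\<close> stands in \<open>coordinates\<close>. The representation with \<open>e\<close> =
  1 is enough for this.\<close>

lemma H_coordinate_derivative:
  "((\<lambda>w. H k (vset z j w)) has_field_derivative H (vset k j (Suc (k $ j))) (vset z j w)) (at w)"
proof -
  obtain \<kappa> where \<kappa>: "\<And>j. exp_kernel (\<sigma> $ j + 1) (\<kappa> j)" "\<And>k. H k = kernel_integral f (\<lambda>j. (deriv ^^ (k $ j)) (\<kappa> j))"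
    "\<And>k j. exp_kernel (\<sigma> $ j + 1) ((deriv ^^ (k $ j)) (\<kappa> j))"
    by (rule H_repr[OF zero_less_one]) (rule that)
  have R: "0 \<le> \<sigma> $ j + 1" for j using \<sigma>[of j] by simp
  let ?\<kappa> = "\<lambda>j. (deriv ^^ (k $ j)) (\<kappa> j)"
  have d: "((\<lambda>v. kernel_integral f ?\<kappa> (vset z j w + v *s axis j 1)) has_field_derivative kernel_integral f (?\<kappa>(j := deriv (?\<kappa> j))) (vset z j w)) (at 0)"
    by (rule kernel_integral_coordinate_derivative[where R="\<lambda>j. \<sigma> $ j + 1" and \<kappa>="?\<kappa>", OF \<kappa>(3) R])
  have u: "?\<kappa>(j := deriv (?\<kappa> j)) = (\<lambda>i. (deriv ^^ (vset k j (Suc (k $ j)) $ i)) (\<kappa> i))"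
    by (auto simp: fun_eq_iff)
  have v: "vset z j w + v *s axis j 1 = vset z j (w + v)" for v
    by (auto simp: vec_eq_iff axis_def)
  have "((\<lambda>v. H k (vset z j (w + v))) has_field_derivative H (vset k j (Suc (k $ j))) (vset z j w)) (at 0)"
    using d unfolding u v \<kappa>(2) .
  then have "((\<lambda>v. H k (vset z j (v + w))) has_field_derivative H (vset k j (Suc (k $ j))) (vset z j w)) (at 0)"
    by (simp only: add.commute)
  then show ?thesis
    using DERIV_shift[of "\<lambda>v. H k (vset z j v)" _ 0 w] by simp
qed

text \<open>The exponent \<open>p + 1\<close> instead of \<open>p\<close> gives a finite conjugate exponent also for \<open>p = 1\<close>.\<close>

definition P :: real where "P = p + 1"

lemma P: "1 < P" using p by (simp add: P_def)

lemma summable_H_lat: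
  "(\<lambda>m. norm (H k (lattice_vec step d J z m)) powr P) summable_on (PiE J (\<lambda>_. UNIV))"
proof -
  obtain C where C: "0 \<le> C"
    "\<And>z. norm (H k z) \<le> C * exp (\<Sum>j\<in>UNIV. (\<sigma> $ j + 1) * \<bar>Im (z $ j)\<bar>) * wconv f (re_vec z)"
    by (rule H_bound[OF zero_less_one, where k=k]) (rule that)
  obtain N where N: "0 \<le> N" "\<And>x. wconv f x \<le> N" by (rule wconv_bounded) (rule that)
  define E where "E = C * exp (\<Sum>j\<in>UNIV. (\<sigma> $ j + 1) * \<bar>Im (z $ j)\<bar>)"
  have E0: "0 \<le> E" using C by (simp add: E_def)
  have H_le: "norm (H k (lattice_vec step d J z m)) \<le> E * wconv f (real_lattice_vec step d J (re_vec z) m)" for m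
  proof -
    have re: "re_vec (lattice_vec step d J z m) = real_lattice_vec step d J (re_vec z) m"
      by (simp add: re_vec_def lattice_vec_def real_lattice_vec_def vec_eq_iff)
    have "\<bar>Im (lattice_vec step d J z m $ j)\<bar> \<le> \<bar>Im (z $ j)\<bar>" for j by (simp add: lattice_vec_def)
    then have "(\<Sum>j\<in>UNIV. (\<sigma> $ j + 1) * \<bar>Im (lattice_vec step d J z m $ j)\<bar>) \<le> (\<Sum>j\<in>UNIV. (\<sigma> $ j + 1) * \<bar>Im (z $ j)\<bar>)"
    proof (intro sum_mono mult_left_mono)
      show "0 \<le> \<sigma> $ j + 1" for j using \<sigma>[of j] by simp
    qed
    then have "C * exp (\<Sum>j\<in>UNIV. (\<sigma> $ j + 1) * \<bar>Im (lattice_vec step d J z m $ j)\<bar>) \<le> E"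
      unfolding E_def using C(1) by (intro mult_left_mono) auto
    then have "C * exp (\<Sum>j\<in>UNIV. (\<sigma> $ j + 1) * \<bar>Im (lattice_vec step d J z m $ j)\<bar>) * wconv f (re_vec (lattice_vec step d J z m))
       \<le> E * wconv f (re_vec (lattice_vec step d J z m))"
      by (intro mult_right_mono wconv_nonneg)
    then show ?thesis using C(2)[of "lattice_vec step d J z m"] unfolding re by (rule order_trans[rotated])
  qed
  show ?thesis
  proof (rule summable_on_comparison_test)
    show "(\<lambda>m. (E powr P * N) * wconv f (real_lattice_vec step d J (re_vec z) m) powr p) summable_on (PiE J (\<lambda>_. UNIV))"
      by (intro summable_on_cmult_right summable_wconv_lat step_pos)
    fix m
    let ?x = "wconv f (real_lattice_vec step d J (re_vec z) m)"
    have "norm (H k (lattice_vec step d J z m)) powr P \<le> (E * ?x) powr P"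
      using H_le P by (intro powr_mono2) auto
    \<comment> \<open>Of the \<open>P = p + 1\<close> powers one is spent on the uniform bound
      \<open>N\<close>; the remaining \<open>p\<close>-th powers are summable over the
      lattice.\<close>
    also have "\<dots> = E powr P * (?x * ?x powr p)"
      using E0 p wconv_nonneg by (simp add: powr_mult P_def powr_mult_base add.commute)
    also have "\<dots> \<le> E powr P * (N * ?x powr p)"
      by (intro mult_left_mono mult_right_mono N) auto
    finally show "norm (H k (lattice_vec step d J z m)) powr P \<le> (E powr P * N) * ?x powr p" by (simp add: mult.assoc)
  qed auto
qed

lemma summable_H_coordinate:
  "(\<lambda>m::int. norm (H k (vset z j (of_real (step j * of_int m + d)))) powr P) summable_on UNIV"
proof -
  have bij: "bij_betw (\<lambda>m::int. restrict (\<lambda>_. m) {j}) UNIV (PiE {j} (\<lambda>_. UNIV))"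
    by (rule bij_betwI[where g="\<lambda>g. g j"]) (auto simp: PiE_def extensional_def fun_eq_iff)
  have "(\<lambda>m. norm (H k (lattice_vec step (\<lambda>_. d) {j} z (restrict (\<lambda>_. m) {j}))) powr P) summable_on UNIV"
    using summable_on_reindex_bij_betw[OF bij, of "\<lambda>m. norm (H k (lattice_vec step (\<lambda>_. d) {j} z m)) powr P"]
      summable_H_lat by blast
  moreover have "lattice_vec step (\<lambda>_. d) {j} z (restrict (\<lambda>_. m) {j}) = vset z j (of_real (step j * of_int m + d))" for m
    by (auto simp: lattice_vec_def vec_eq_iff)
  ultimately show ?thesis by simp
qed

text \<open>With u = \<open>step j * of_int m\<close> the argument of the kernel is (w - u) divided
  by the step. The power of the step cancels this scaling, so that \<open>G\<close> is (w - u)^l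
  times the squared cardinal sine, as in the sampling term.\<close>

definition G :: "nat \<Rightarrow> 'n \<Rightarrow> complex \<Rightarrow> int \<Rightarrow> complex" where
  "G l j w m = of_real (step j) ^ l * sampling_kernel l (of_real (\<sigma> $ j / (2 * pi)) * w - of_int m)"

text \<open>The one-variable formula for \<open>H k\<close> along the complex line in direction
  \<open>j\<close>, the other coordinates being fixed at complex values. Their exponential factors
  are constants there, so the bounds of type \<open>\<sigma> $ j + e\<close> for all
  \<open>e\<close> sharpen to type \<open>\<sigma> $ j\<close>.\<close>

lemma sampling_coordinate:
  assumes k: "k $ j = 0"
  shows "((\<lambda>m. \<Sum>l\<in>{0, 1}. H (vset k j l) (vset z j (of_real (step j * of_int m))) * G l j (z $ j) m) has_sum H k z) UNIV"
proof -
  define h where "h w = H k (vset z j w)" for w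
  have k0: "vset k j 0 = k" using k by (simp add: vec_eq_iff)
  have dh: "(h has_field_derivative H (vset k j 1) (vset z j w)) (at w)" for w
    unfolding h_def using H_coordinate_derivative[of k z j w] k by simp
  then have hol: "h holomorphic_on UNIV" by (subst holomorphic_on_open) blast+
  have dhe: "deriv h w = H (vset k j 1) (vset z j w)" for w using dh by (rule DERIV_imp_deriv)
  obtain N where N: "0 \<le> N" "\<And>x. wconv f x \<le> N" by (rule wconv_bounded) (rule that)
  have ty: "\<exists>C. \<forall>w. norm (h w) \<le> C * exp ((\<sigma> $ j + e) * \<bar>Im w\<bar>)" if e: "0 < e" for e
  proof -
    obtain C where C: "0 \<le> C"
      "\<And>z. norm (H k z) \<le> C * exp (\<Sum>j\<in>UNIV. (\<sigma> $ j + e) * \<bar>Im (z $ j)\<bar>) * wconv f (re_vec z)"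
      by (rule H_bound[OF e, where k=k]) (rule that)
    define S where "S = (\<Sum>i\<in>UNIV - {j}. (\<sigma> $ i + e) * \<bar>Im (z $ i)\<bar>)"
    have "norm (h w) \<le> (C * exp S * N) * exp ((\<sigma> $ j + e) * \<bar>Im w\<bar>)" for w
    proof -
      have "(\<Sum>i\<in>UNIV. (\<sigma> $ i + e) * \<bar>Im (vset z j w $ i)\<bar>) = (\<sigma> $ j + e) * \<bar>Im w\<bar> + S"
        unfolding S_def by (subst sum.remove[of UNIV j]) (auto intro!: sum.cong)
      then have "norm (h w) \<le> C * exp ((\<sigma> $ j + e) * \<bar>Im w\<bar> + S) * wconv f (re_vec (vset z j w))"
        using C(2)[of "vset z j w"] by (simp only: h_def)
      also have "\<dots> \<le> C * exp ((\<sigma> $ j + e) * \<bar>Im w\<bar> + S) * N"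
        using C(1) by (intro mult_left_mono N) simp
      finally show ?thesis by (simp add: exp_add mult_ac)
    qed
    then show ?thesis by blast
  qed
  obtain C1 where "\<And>w. norm (h w) \<le> C1 * exp ((\<sigma> $ j + 1) * \<bar>Im w\<bar>)" using ty[of 1] by auto
  from this[of "of_real _"] have C1: "norm (h (of_real x)) \<le> C1" for x by simp
  have bound: "norm (h w) \<le> (C1 + 1) * exp (\<sigma> $ j * \<bar>Im w\<bar>)" for w
    by (rule exact_type[OF hol C1 ty])
  have st: "complex_of_real (2 * pi / \<sigma> $ j) * of_int m = of_real (step j * of_int m)" for m
    by (simp add: step_def)
  have st2: "complex_of_real (2 * pi / \<sigma> $ j) * (of_nat n + 1/2) = of_real (step j * of_int (int n) + step j / 2)" for n
    by (simp add: step_def distrib_left)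
  have "((\<lambda>m::int. h (of_real (2 * pi / \<sigma> $ j) * of_int m) * sampling_kernel 0 (of_real (\<sigma> $ j / (2 * pi)) * z $ j - of_int m) 
     + deriv h (of_real (2 * pi / \<sigma> $ j) * of_int m) * (of_real (2 * pi / \<sigma> $ j) * sampling_kernel 1 (of_real (\<sigma> $ j / (2 * pi)) * z $ j - of_int m))) has_sum h (z $ j)) UNIV"
  proof (rule sampling_1d[OF \<sigma> hol bound P])
    show "(\<lambda>m::int. norm (h (of_real (2 * pi / \<sigma> $ j) * of_int m)) powr P) summable_on UNIV"
      unfolding st h_def using summable_H_coordinate[of k z j 0] by simp
    show "(\<lambda>m::int. norm (deriv h (of_real (2 * pi / \<sigma> $ j) * of_int m)) powr P) summable_on UNIV"
      unfolding st dhe using summable_H_coordinate[of "vset k j 1" z j 0] by simp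
    \<comment> \<open>The samples on the lattice shifted by half a step are summable in
      \<open>P\<close>-th power and therefore tend to 0; this is the limit that excludes a constant
      multiple of the squared sine.\<close>
    have "(\<lambda>m::int. norm (h (of_real (step j * of_int m + step j / 2))) powr P) summable_on (range int)"
      unfolding h_def using summable_H_coordinate by (rule summable_on_subset_banach) simp
    then have "(\<lambda>n::nat. norm (h (of_real (step j * of_int (int n) + step j / 2))) powr P) summable_on UNIV"
      by (subst (asm) summable_on_reindex) (simp_all add: o_def)
    then have "summable (\<lambda>n::nat. norm (h (of_real (step j * of_int (int n) + step j / 2))) powr P)"
      by (rule summable_on_imp_summable)
    then have "(\<lambda>n::nat. norm (h (of_real (step j * of_int (int n) + step j / 2))) powr P) \<longlonglongrightarrow> 0"
      by (rule summable_LIMSEQ_zero)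
    then have "(\<lambda>n::nat. (norm (h (of_real (step j * of_int (int n) + step j / 2))) powr P) powr (1 / P)) \<longlonglongrightarrow> 0"
      by (rule tendsto_zero_powrI) (use P in auto)
    then have "(\<lambda>n::nat. norm (h (of_real (step j * of_int (int n) + step j / 2)))) \<longlonglongrightarrow> 0"
      using P by (simp add: powr_powr)
    then show "(\<lambda>n. h (of_real (2 * pi / \<sigma> $ j) * (of_nat n + 1/2))) \<longlonglongrightarrow> 0"
      unfolding st2 by (rule tendsto_norm_zero_cancel)
  qed
  moreover have "h (z $ j) = H k z"
  proof -
    have "vset z j (z $ j) = z" by (simp add: vec_eq_iff)
    then show ?thesis by (simp add: h_def)
  qed
  ultimately show ?thesis
    unfolding st dhe by (simp add: k0 G_def h_def step_def)
qed

section \<open>The multiple series over a set of coordinates\<close>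

definition lterm :: "'n set \<Rightarrow> nat^'n \<Rightarrow> complex^'n \<Rightarrow> ('n \<Rightarrow> int) \<Rightarrow> complex" where
  "lterm J k z m = (\<Sum>l\<in>cube J. H (k + l) (lattice_vec step (\<lambda>_. 0) J z m) * (\<Prod>j\<in>J. G (l $ j) j (z $ j) (m j)))"

definition weight :: "'n set \<Rightarrow> complex^'n \<Rightarrow> ('n \<Rightarrow> int) \<Rightarrow> real" where
  "weight J z m = (\<Prod>j\<in>J. 1 / (1 + \<bar>\<sigma> $ j / (2 * pi) * Re (z $ j) - of_int (m j)\<bar>))"

definition Q :: real where "Q = P / (P - 1)"

lemma Q: "1 < Q" "1 / P + 1 / Q = 1"
  using P by (simp_all add: Q_def field_simps)

lemma weight_nonneg: "0 \<le> weight J z m"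
  unfolding weight_def by (intro prod_nonneg) auto

lemma weight_sum_bound:
  obtains B where "\<forall>z X. finite X \<longrightarrow> X \<subseteq> PiE J (\<lambda>_. UNIV) \<longrightarrow> (\<Sum>m\<in>X. weight J z m powr Q) \<le> B"
proof -
  obtain B where B: "0 \<le> B" "\<And>x A. finite A \<Longrightarrow> (\<Sum>m\<in>A. (1 + \<bar>x - real_of_int m\<bar>) powr (- Q)) \<le> B"
    using int_powr_sum_bound[OF Q(1)] by blast
  have "(\<Sum>m\<in>X. weight J z m powr Q) \<le> (\<Prod>j\<in>J. B)" if X: "finite X" "X \<subseteq> PiE J (\<lambda>_. UNIV)" for z X
  proof -
    have "weight J z m powr Q = (\<Prod>j\<in>J. (1 + \<bar>\<sigma> $ j / (2 * pi) * Re (z $ j) - of_int (m j)\<bar>) powr (- Q))" for m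
      unfolding weight_def by (simp add: prod_powr_distrib inverse_weight_powr)
    then have "(\<Sum>m\<in>X. weight J z m powr Q) = (\<Sum>m\<in>X. \<Prod>j\<in>J. (1 + \<bar>\<sigma> $ j / (2 * pi) * Re (z $ j) - of_int (m j)\<bar>) powr (- Q))"
      by simp
    also have "\<dots> \<le> (\<Prod>j\<in>J. B)"
      by (rule sum_prod_le_prod_bound[where f="\<lambda>j m. (1 + \<bar>\<sigma> $ j / (2 * pi) * Re (z $ j) - of_int m\<bar>) powr (- Q)"])
         (simp, simp, rule B(2), simp, rule X(1), rule X(2))
    finally show ?thesis .
  qed
  then have "\<forall>z X. finite X \<longrightarrow> X \<subseteq> PiE J (\<lambda>_. UNIV) \<longrightarrow> (\<Sum>m\<in>X. weight J z m powr Q) \<le> (\<Prod>j\<in>J. B)"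
    by simp
  then show ?thesis by (rule that)
qed

lemma G_prod_bound:
  obtains D where "0 \<le> D" "\<forall>l z m. l \<in> cube J \<longrightarrow> (\<forall>j. \<bar>Im (z $ j)\<bar> \<le> Y) \<longrightarrow>
     norm (\<Prod>j\<in>J. G (l $ j) j (z $ j) (m j)) \<le> D * weight J z m"
proof -
  obtain C where C: "0 \<le> C" "\<And>l z. l \<le> 1 \<Longrightarrow> norm (sampling_kernel l z) \<le> C * exp (2 * pi * \<bar>Im z\<bar>) / (1 + \<bar>Re z\<bar>)"
    using sampling_kernel_bound by blast
  define d where "d j = (1 + step j) * C * exp (\<sigma> $ j * \<bar>Y\<bar>)" for j
  have d0: "0 \<le> d j" for j using C(1) less_imp_le[OF step_pos[of j]] by (simp add: d_def)
  have "norm (\<Prod>j\<in>J. G (l $ j) j (z $ j) (m j)) \<le> (\<Prod>j\<in>J. d j) * weight J z m"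
    if l: "l \<in> cube J" and z: "\<And>j. \<bar>Im (z $ j)\<bar> \<le> Y" for l z m
  proof -
    have "norm (G (l $ j) j (z $ j) (m j)) \<le> d j * (1 / (1 + \<bar>\<sigma> $ j / (2 * pi) * Re (z $ j) - of_int (m j)\<bar>))" for j
    proof -
      let ?w = "of_real (\<sigma> $ j / (2 * pi)) * z $ j - of_int (m j)"
      have lj: "l $ j = 0 \<or> l $ j = 1" using l by (auto simp: cube_def)
      have s: "step j ^ (l $ j) \<le> 1 + step j" using lj step_pos[of j] by auto
      have "2 * pi * \<bar>Im ?w\<bar> = \<sigma> $ j * \<bar>Im (z $ j)\<bar>" using \<sigma>[of j] by (simp add: abs_mult)
      also have "\<dots> \<le> \<sigma> $ j * \<bar>Y\<bar>" using z[of j] \<sigma>[of j] by (intro mult_left_mono) auto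
      finally have ex: "exp (2 * pi * \<bar>Im ?w\<bar>) \<le> exp (\<sigma> $ j * \<bar>Y\<bar>)" by simp
      have re: "Re ?w = \<sigma> $ j / (2 * pi) * Re (z $ j) - of_int (m j)" by simp
      have "norm (sampling_kernel (l $ j) ?w) \<le> C * exp (2 * pi * \<bar>Im ?w\<bar>) / (1 + \<bar>Re ?w\<bar>)"
        using lj by (intro C(2)) auto
      also have "\<dots> \<le> C * exp (\<sigma> $ j * \<bar>Y\<bar>) / (1 + \<bar>Re ?w\<bar>)"
        using C(1) ex by (intro divide_right_mono mult_left_mono) auto
      finally have g: "norm (sampling_kernel (l $ j) ?w) \<le> C * exp (\<sigma> $ j * \<bar>Y\<bar>) / (1 + \<bar>Re ?w\<bar>)" .
      have "norm (G (l $ j) j (z $ j) (m j)) = step j ^ (l $ j) * norm (sampling_kernel (l $ j) ?w)"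
        using step_pos[of j] by (simp add: G_def norm_mult norm_power)
      also have "\<dots> \<le> (1 + step j) * (C * exp (\<sigma> $ j * \<bar>Y\<bar>) / (1 + \<bar>Re ?w\<bar>))"
        using s g step_pos[of j] by (intro mult_mono) auto
      finally show ?thesis unfolding re d_def by (simp add: mult.assoc)
    qed
    then have "norm (\<Prod>j\<in>J. G (l $ j) j (z $ j) (m j)) \<le> (\<Prod>j\<in>J. d j * (1 / (1 + \<bar>\<sigma> $ j / (2 * pi) * Re (z $ j) - of_int (m j)\<bar>)))"
      unfolding prod_norm[symmetric] by (intro prod_mono) auto
    then show ?thesis unfolding weight_def prod.distrib .
  qed
  moreover have "0 \<le> (\<Prod>j\<in>J. d j)" by (intro prod_nonneg d0)
  ultimately show ?thesis by (intro that[of "\<Prod>j\<in>J. d j"]) simp_all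
qed

text \<open>The factor of the majorant that is summable in \<open>P\<close>-th power; for
  \<open>J = UNIV\<close> it is independent of \<open>z\<close>, whose influence is then carried by
  \<open>weight\<close> alone.\<close>

definition sample_size :: "'n set \<Rightarrow> nat^'n \<Rightarrow> complex^'n \<Rightarrow> ('n \<Rightarrow> int) \<Rightarrow> real" where
  "sample_size J k z m = (\<Sum>l\<in>cube J. norm (H (k + l) (lattice_vec step (\<lambda>_. 0) J z m)))"

lemma sample_size_nonneg: "0 \<le> sample_size J k z m"
  unfolding sample_size_def by (intro sum_nonneg) auto

lemma summable_sample_size:
  assumes "0 \<le> D"
  shows "(\<lambda>m. (D * sample_size J k z m) powr P) summable_on (PiE J (\<lambda>_. UNIV))"
proof -
  have *: "(\<lambda>m. (\<Sum>l\<in>L. norm (H (k + l) (lattice_vec step (\<lambda>_. 0) J z m))) powr P) summable_on (PiE J (\<lambda>_. UNIV))"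
    if "finite L" for L
    using that
  proof induction
    case (insert l L)
    show ?case
    proof (rule summable_on_comparison_test)
      show "(\<lambda>m. 2 powr P * (norm (H (k + l) (lattice_vec step (\<lambda>_. 0) J z m)) powr P 
         + (\<Sum>l\<in>L. norm (H (k + l) (lattice_vec step (\<lambda>_. 0) J z m))) powr P)) summable_on (PiE J (\<lambda>_. UNIV))"
        by (intro summable_on_cmult_right summable_on_add summable_H_lat insert.IH)
      show "(\<Sum>l\<in>insert l L. norm (H (k + l) (lattice_vec step (\<lambda>_. 0) J z m))) powr P
        \<le> 2 powr P * (norm (H (k + l) (lattice_vec step (\<lambda>_. 0) J z m)) powr P 
         + (\<Sum>l\<in>L. norm (H (k + l) (lattice_vec step (\<lambda>_. 0) J z m))) powr P)" for m
        unfolding sum.insert[OF insert.hyps] using P by (intro powr_add_le sum_nonneg) auto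
    qed auto
  qed simp
  have "(\<lambda>m. D powr P * (\<Sum>l\<in>cube J. norm (H (k + l) (lattice_vec step (\<lambda>_. 0) J z m))) powr P) summable_on (PiE J (\<lambda>_. UNIV))"
    by (intro summable_on_cmult_right *[OF finite_cube])
  then show ?thesis unfolding sample_size_def using assms by (simp add: powr_mult sum_nonneg)
qed

lemma lterm_bound:
  assumes D: "0 \<le> D" "\<And>l m. l \<in> cube J \<Longrightarrow> norm (\<Prod>j\<in>J. G (l $ j) j (z $ j) (m j)) \<le> D * weight J z m"
  shows "norm (lterm J k z m) \<le> (D * sample_size J k z m) * weight J z m"
proof -
  have "norm (lterm J k z m) \<le> (\<Sum>l\<in>cube J. norm (H (k + l) (lattice_vec step (\<lambda>_. 0) J z m)) * (D * weight J z m))"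
    unfolding lterm_def
    by (rule order_trans[OF norm_sum]) (auto simp: norm_mult intro!: sum_mono mult_left_mono D)
  then show ?thesis unfolding sample_size_def by (simp add: sum_distrib_left sum_distrib_right mult_ac)
qed

text \<open>Iterated sums alone do not yield a sum over the product index set; summability there has
  to be known beforehand, and the Hoelder bound supplies it.\<close>

lemma lterm_summable: "lterm J k z summable_on (PiE J (\<lambda>_. UNIV))"
proof -
  define Y where "Y = Max (range (\<lambda>j. \<bar>Im (z $ j)\<bar>))"
  have Y: "\<bar>Im (z $ j)\<bar> \<le> Y" for j unfolding Y_def by (intro Max_ge) auto
  obtain D where D': "0 \<le> D" "\<forall>l z m. l \<in> cube J \<longrightarrow> (\<forall>j. \<bar>Im (z $ j)\<bar> \<le> Y) \<longrightarrow>
     norm (\<Prod>j\<in>J. G (l $ j) j (z $ j) (m j)) \<le> D * weight J z m"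
    by (rule G_prod_bound[where J=J and Y=Y]) (rule that)
  note D = D'(1) D'(2)[rule_format]
  obtain B where B': "\<forall>z X. finite X \<longrightarrow> X \<subseteq> PiE J (\<lambda>_. UNIV) \<longrightarrow> (\<Sum>m\<in>X. weight J z m powr Q) \<le> B"
    by (rule weight_sum_bound[where J=J]) (rule that)
  note B = B'[rule_format]
  have "(\<lambda>m. norm (lterm J k z m)) summable_on (PiE J (\<lambda>_. UNIV))"
  proof (rule holder_family_abs_summable[where S="{z}" and p=P and q=Q and B=B and A="\<lambda>m. D * sample_size J k z m" and W="weight J" and a="\<lambda>m z. lterm J k z m"])
    show "(\<lambda>m. (D * sample_size J k z m) powr P) summable_on (PiE J (\<lambda>_. UNIV))"
      by (rule summable_sample_size[OF D(1)])
    show "norm (lterm J k z' m) \<le> D * sample_size J k z m * weight J z' m" if "z' \<in> {z}" for z' m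
      using lterm_bound[OF D(1) D(2)[OF _ Y]] that by simp
  qed (use P Q B D(1) weight_nonneg sample_size_nonneg in auto)
  then show ?thesis by (rule abs_summable_summable)
qed

text \<open>Coordinates outside \<open>J\<close> are kept at the complex point \<open>z\<close>, so that one coordinate at a time can be sampled.\<close>

lemma lterm_has_sum:
  assumes "finite J" "\<And>j. j \<in> J \<Longrightarrow> k $ j = 0"
  shows "(lterm J k z has_sum H k z) (PiE J (\<lambda>_. UNIV))"
  using assms
proof (induction J arbitrary: k z)
  case empty
  have "lattice_vec step (\<lambda>_. 0) {} z m = z" for m by (simp add: lattice_vec_def vec_eq_iff)
  then show ?case by (simp add: lterm_def cube_empty has_sum_finite_iff)
next
  case (insert j J)
  let ?u = "\<lambda>a. of_real (step j * of_int a) :: complex"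
  \<comment> \<open>The term with coordinate \<open>j\<close> split off. For fixed \<open>a\<close>
    the induction hypothesis applies at the point whose \<open>j\<close>-th coordinate is already
    the lattice value, once for each derivative order \<open>l\<close>; this is why it is general in
    \<open>k\<close> and \<open>z\<close>.\<close>
  define T where "T = (\<lambda>(a, m). \<Sum>l\<in>{0, 1}. G l j (z $ j) a * lterm J (vset k j l) (vset z j (?u a)) m)"
  have bij: "bij_betw (\<lambda>(a, m). m(j := a)) (UNIV \<times> PiE J (\<lambda>_. UNIV)) (PiE (insert j J) (\<lambda>_. UNIV :: int set))"
    unfolding PiE_insert_eq using inj_combinator[OF insert.hyps(2), of "\<lambda>_. UNIV :: int set"]
    by (auto simp: bij_betw_def)
  have T: "lterm (insert j J) k z (m(j := a)) = T (a, m)" for a m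
  proof -
    have zl: "lattice_vec step (\<lambda>_. 0) (insert j J) z (m(j := a)) = lattice_vec step (\<lambda>_. 0) J (vset z j (?u a)) m"
      using insert.hyps(2) by (auto simp: lattice_vec_def vec_eq_iff)
    \<comment> \<open>Both \<open>k\<close> and \<open>l\<close> are 0 at \<open>j\<close>, so an
      order \<open>b\<close> placed there may be moved from one to the other.\<close>
    have kl: "k + vset l j b = vset k j b + l" if "l \<in> cube J" for l b
      using that insert.hyps(2) insert.prems by (auto simp: vec_eq_iff cube_def)
    have pr: "(\<Prod>i\<in>insert j J. G (vset l j b $ i) i (z $ i) ((m(j := a)) i)) 
      = G b j (z $ j) a * (\<Prod>i\<in>J. G (l $ i) i (vset z j (?u a) $ i) (m i))" for l b
      unfolding prod.insert[OF insert.hyps] using insert.hyps(2) by (auto intro!: arg_cong2[where f=times] prod.cong)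
    show ?thesis
      unfolding lterm_def T_def sum_cube_insert[OF insert.hyps(2)] split_conv zl pr sum_distrib_left
      by (intro sum.cong refl) (simp only: kl mult.left_commute)
  qed
  have "(T has_sum H k z) (UNIV \<times> PiE J (\<lambda>_. UNIV))"
  proof (rule has_sum_SigmaI)
    fix a :: int
    show "((\<lambda>m. T (a, m)) has_sum (\<Sum>l\<in>{0, 1}. G l j (z $ j) a * H (vset k j l) (vset z j (?u a)))) (PiE J (\<lambda>_. UNIV))"
      unfolding T_def split_conv
    proof (rule has_sum_finite_sum)
      show "finite {0::nat, 1}" by simp
      fix l assume "l \<in> {0::nat, 1}"
      have "vset k j l $ i = 0" if "i \<in> J" for i using insert.prems insert.hyps(2) that by auto
      from insert.IH[OF this]
      show "((\<lambda>m. G l j (z $ j) a * lterm J (vset k j l) (vset z j (?u a)) m) has_sum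
          G l j (z $ j) a * H (vset k j l) (vset z j (?u a))) (PiE J (\<lambda>_. UNIV))"
        by (rule has_sum_cmult_right)
    qed
  next
    have "k $ j = 0" using insert.prems by simp
    from sampling_coordinate[OF this, of z]
    show "((\<lambda>a. \<Sum>l\<in>{0, 1}. G l j (z $ j) a * H (vset k j l) (vset z j (?u a))) has_sum H k z) UNIV"
      by (simp only: mult.commute)
    have "(\<lambda>x. lterm (insert j J) k z ((\<lambda>(a, m). m(j := a)) x)) summable_on (UNIV \<times> PiE J (\<lambda>_. UNIV))"
      using lterm_summable summable_on_reindex_bij_betw[OF bij] by blast
    moreover have "(\<lambda>x. lterm (insert j J) k z ((\<lambda>(a, m). m(j := a)) x)) = T" using T by auto
    ultimately show "T summable_on (UNIV \<times> PiE J (\<lambda>_. UNIV))" by simp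
  qed
  then have "((\<lambda>x. lterm (insert j J) k z ((\<lambda>(a, m). m(j := a)) x)) has_sum H k z) (UNIV \<times> PiE J (\<lambda>_. UNIV))"
    using T by (simp add: case_prod_beta')
  then show ?case using has_sum_reindex_bij_betw[OF bij] by blast
qed

section \<open>Transfer to lattice points, and convergence\<close>

definition lpoint :: "('n \<Rightarrow> int) \<Rightarrow> real^'n" where
  "lpoint m = (\<chi> j. 2 * pi * of_int (m j) / \<sigma> $ j)"

lemma inj_lpoint: "inj lpoint"
proof (rule injI)
  fix m m' assume eq: "lpoint m = lpoint m'"
  have "m j = m' j" for j
  proof -
    have "lpoint m $ j = lpoint m' $ j" using eq by simp
    then show ?thesis using \<sigma>[of j] by (simp add: lpoint_def)
  qed
  then show "m = m'" by auto
qed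

lemma range_lpoint: "range lpoint = sampling_lattice \<sigma>"
proof -
  have "lpoint m = (\<chi> j. 2 * pi * of_int ((\<chi> j. m j) $ j) / \<sigma> $ j)" for m by (simp add: lpoint_def)
  moreover have "(\<chi> j. 2 * pi * of_int (m $ j) / \<sigma> $ j) = lpoint (vec_nth m)" for m by (simp add: lpoint_def)
  ultimately show ?thesis unfolding sampling_lattice_def by blast
qed

lemma sampling_term_lpoint: "sampling_term \<sigma> F (lpoint m) z = lterm UNIV 0 z m"
proof -
  have ix: "index_cube = cube UNIV" by (auto simp: index_cube_def cube_def)
  have u: "complex_vec (lpoint m) = lattice_vec step (\<lambda>_. 0) UNIV z m"
    by (simp add: complex_vec_def lpoint_def lattice_vec_def step_def vec_eq_iff)
  have w: "of_real (\<sigma> $ j / (2 * pi)) * z $ j - of_int (m j) = of_real (1 / step j) * (z - complex_vec (lpoint m)) $ j" for j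
    using \<sigma>[of j] by (simp add: complex_vec_def lpoint_def step_def field_simps)
  have s: "(sinc_vec ((1 / (2 * pi)) *s (complex_vec \<sigma> * (z - complex_vec (lpoint m)))))\<^sup>2 
     = (\<Prod>j\<in>UNIV. (csinc (of_real (\<sigma> $ j / (2 * pi)) * z $ j - of_int (m j)))\<^sup>2)"
  proof -
    have v: "((1 / (2 * pi)) *s (complex_vec \<sigma> * (z - complex_vec (lpoint m)))) $ j = of_real (1 / step j) * (z - complex_vec (lpoint m)) $ j" for j
      using \<sigma>[of j] by (simp add: complex_vec_def step_def)
    show ?thesis
      by (simp only: w sinc_vec_def csinc_def prod_power_distrib v)
  qed
  have g: "G (l $ j) j (z $ j) (m j) = ((z - complex_vec (lpoint m)) $ j) ^ (l $ j) * (csinc (of_real (\<sigma> $ j / (2 * pi)) * z $ j - of_int (m j)))\<^sup>2" for l :: "nat^'n" and j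
  proof -
    have "of_real (step j) * (of_real (1 / step j) * (z - complex_vec (lpoint m)) $ j) = (z - complex_vec (lpoint m)) $ j"
      using step_pos[of j] by simp
    then show ?thesis unfolding G_def sampling_kernel_def w by (simp only: mult.assoc[symmetric] power_mult_distrib[symmetric])
  qed
  show ?thesis
    unfolding sampling_term_def lterm_def sampling_poly_def s g ix u[symmetric] sum_distrib_right prod.distrib
    by (simp add: mult.assoc)
qed

lemma sampling_has_sum: "((\<lambda>u. sampling_term \<sigma> F u z) has_sum F z) (sampling_lattice \<sigma>)"
proof -
  have "multi_deriv 0 F = F"
  proof -
    have "foldr (\<lambda>j. partial_complex j ^^ ((0::nat^'n) $ j)) js F = F" for js by (induction js) auto
    then show ?thesis by (simp add: multi_deriv_def)
  qed
  then have "((\<lambda>m. sampling_term \<sigma> F (lpoint m) z) has_sum F z) UNIV"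
    using lterm_has_sum[of UNIV 0 z] by (simp add: sampling_term_lpoint)
  then show ?thesis
    unfolding range_lpoint[symmetric] has_sum_reindex[OF inj_lpoint] o_def .
qed

text \<open>Once all coordinates are sampled the samples no longer depend on \<open>z\<close>, so
  \<open>A\<close> may be formed at the base point 0. On a strip the kernels contribute one constant
  \<open>D\<close>, and the sums of powers of \<open>weight\<close> are bounded uniformly in
  \<open>z\<close>.\<close>

lemma sampling_converges:
  assumes S: "\<And>z j. z \<in> S \<Longrightarrow> \<bar>Im (z $ j)\<bar> \<le> Y"
  shows "converges_abs_uniformly_on S (sampling_lattice \<sigma>) (sampling_term \<sigma> F) F"
proof -
  obtain D where D': "0 \<le> D" "\<forall>l z m. l \<in> cube UNIV \<longrightarrow> (\<forall>j. \<bar>Im (z $ j)\<bar> \<le> Y) \<longrightarrow>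
     norm (\<Prod>j\<in>UNIV. G (l $ j) j (z $ j) (m j)) \<le> D * weight UNIV z m"
    by (rule G_prod_bound[where J=UNIV and Y=Y]) (rule that)
  note D = D'(1) D'(2)[rule_format]
  obtain B where B': "\<forall>z X. finite X \<longrightarrow> X \<subseteq> PiE UNIV (\<lambda>_. UNIV) \<longrightarrow> (\<Sum>m\<in>X. weight UNIV z m powr Q) \<le> B"
    by (rule weight_sum_bound[where J=UNIV]) (rule that)
  note B = B'[rule_format]
  let ?i = "inv lpoint"
  define A where "A u = D * sample_size UNIV 0 0 (?i u)" for u
  define W where "W z u = weight UNIV z (?i u)" for z u
  have sz: "sample_size UNIV 0 z m = sample_size UNIV 0 0 m" for z m
    by (simp add: sample_size_def lattice_vec_def)
  have nn: "0 \<le> A u" "0 \<le> W z u" for z u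
    using D(1) sample_size_nonneg weight_nonneg by (simp_all add: A_def W_def)
  have As: "(\<lambda>u. A u powr P) summable_on (sampling_lattice \<sigma>)"
    unfolding range_lpoint[symmetric] summable_on_reindex[OF inj_lpoint] o_def A_def
    using summable_sample_size[OF D(1), of UNIV 0 0] by (simp add: inj_lpoint)
  have Wb: "(\<Sum>u\<in>X. W z u powr Q) \<le> B" if fX: "finite X" and sX: "X \<subseteq> sampling_lattice \<sigma>" for z X
  proof -
    obtain X' where X': "X = lpoint ` X'" using sX unfolding range_lpoint[symmetric] by (auto simp: subset_image_iff)
    have inj: "inj_on lpoint X'" using inj_lpoint by (rule inj_on_subset) simp
    have "finite X'" using fX inj unfolding X' by (rule finite_imageD)
    then show ?thesis unfolding X' sum.reindex[OF inj] W_def using B[of X' z] by (simp add: inj_lpoint)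
  qed
  have aW: "norm (sampling_term \<sigma> F u z) \<le> A u * W z u" if zS: "z \<in> S" and uL: "u \<in> sampling_lattice \<sigma>" for z u
  proof -
    obtain m where m: "u = lpoint m" using uL unfolding range_lpoint[symmetric] by blast
    have "norm (lterm UNIV 0 z m) \<le> (D * sample_size UNIV 0 z m) * weight UNIV z m"
      by (rule lterm_bound[OF D(1) D(2)[OF _ S[OF zS]]])
    then show ?thesis by (simp add: m sampling_term_lpoint A_def W_def inj_lpoint sz[of z])
  qed
  have "(\<lambda>u. norm (sampling_term \<sigma> F u z)) summable_on (sampling_lattice \<sigma>)" if "z \<in> S" for z
    by (rule holder_family_abs_summable[where p=P and q=Q and B=B and A=A and W=W and S=S])
       (use P Q nn As Wb aW that in auto)
  moreover have "uniform_limit S (\<lambda>X z. \<Sum>u\<in>X. sampling_term \<sigma> F u z) (\<lambda>z. infsum (\<lambda>u. sampling_term \<sigma> F u z) (sampling_lattice \<sigma>)) (finite_subsets_at_top (sampling_lattice \<sigma>))"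
    by (rule holder_family_uniform_limit[where p=P and q=Q and B=B and A=A and W=W])
       (use P Q nn As Wb aW in auto)
  moreover have "(\<lambda>z. infsum (\<lambda>u. sampling_term \<sigma> F u z) (sampling_lattice \<sigma>)) = F"
    using infsumI[OF sampling_has_sum] by auto
  ultimately show ?thesis unfolding converges_abs_uniformly_on_def by simp
qed

lemma sampling_conclusion:
  "(\<forall>z. ((\<lambda>u. sampling_term \<sigma> F u z) has_sum F z) (sampling_lattice \<sigma>)) \<and>
   converges_abs_uniformly_on (range complex_vec) (sampling_lattice \<sigma>) (sampling_term \<sigma> F) F \<and>
   (\<forall>K. compact K \<longrightarrow> converges_abs_uniformly_on K (sampling_lattice \<sigma>) (sampling_term \<sigma> F) F)"
proof (intro conjI allI impI)
  show "converges_abs_uniformly_on (range complex_vec) (sampling_lattice \<sigma>) (sampling_term \<sigma> F) F"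
    by (rule sampling_converges[where Y=0]) (auto simp: complex_vec_def)
  fix K :: "(complex^'n) set" assume "compact K"
  then obtain Y where Y: "\<And>z. z \<in> K \<Longrightarrow> norm z \<le> Y"
    using compact_imp_bounded bounded_iff by metis
  show "converges_abs_uniformly_on K (sampling_lattice \<sigma>) (sampling_term \<sigma> F) F"
  proof (rule sampling_converges[where Y=Y])
    fix z j assume "z \<in> K"
    have "\<bar>Im (z $ j)\<bar> \<le> norm (z $ j)" by (rule abs_Im_le_cmod)
    also have "\<dots> \<le> norm z" by (rule norm_component_le_complex)
    also have "\<dots> \<le> Y" using \<open>z \<in> K\<close> by (rule Y)
    finally show "\<bar>Im (z $ j)\<bar> \<le> Y" .
  qed
qed (rule sampling_has_sum)

end

section \<open>Recovering interval indicators from Fourier transforms of test functions\<close>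

lemma gaussian_fourier:
  "(LINT y|lborel. exp (- \<i> * of_real (y * s)) * of_real (exp (- y\<^sup>2 / 2))) = complex_of_real (sqrt (2 * pi) * exp (- s\<^sup>2 / 2))"
proof -
  have "(LINT x|std_normal_distribution. iexp (- s * x)) = complex_of_real (exp (- (- s)\<^sup>2 / 2))"
    using fun_cong[OF char_std_normal_distribution, of "- s"] by (simp add: char_def)
  then have "(LINT x|lborel. std_normal_density x *\<^sub>R iexp (- s * x)) = complex_of_real (exp (- s\<^sup>2 / 2))"
    by (subst (asm) integral_density) (auto simp: normal_density_nonneg)
  moreover have "std_normal_density x *\<^sub>R iexp (- s * x) = of_real (1 / sqrt (2 * pi)) * (exp (- \<i> * of_real (x * s)) * of_real (exp (- x\<^sup>2 / 2)))" for x
    by (simp add: std_normal_density_def scaleR_conv_of_real mult_ac)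
  ultimately have "of_real (1 / sqrt (2 * pi)) * (LINT y|lborel. exp (- \<i> * of_real (y * s)) * of_real (exp (- y\<^sup>2 / 2))) = complex_of_real (exp (- s\<^sup>2 / 2))"
    by simp
  then have "of_real (sqrt (2 * pi)) * (of_real (1 / sqrt (2 * pi)) * (LINT y|lborel. exp (- \<i> * of_real (y * s)) * of_real (exp (- y\<^sup>2 / 2))))
     = complex_of_real (sqrt (2 * pi)) * complex_of_real (exp (- s\<^sup>2 / 2))" by simp
  moreover have "complex_of_real (sqrt (2 * pi)) * complex_of_real (1 / sqrt (2 * pi)) = 1"
    unfolding of_real_mult[symmetric] by simp
  ultimately show ?thesis by (simp only: mult.assoc[symmetric] of_real_mult mult_1_left)
qed

lemma integrable_gaussian: "integrable lborel (\<lambda>y::real. exp (- y\<^sup>2 / 2))"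
proof -
  have "integrable lborel (\<lambda>x. sqrt (2 * pi) * std_normal_density x)"
    by (intro integrable_mult_right integrable_normal_density) simp
  then show ?thesis by (simp add: std_normal_density_def)
qed

locale test_function1 =
  fixes \<psi> :: "real \<Rightarrow> complex" and R :: real
  assumes R: "0 \<le> R" and sm: "smooth1 \<psi>" and supp: "\<And>t. R \<le> \<bar>t\<bar> \<Longrightarrow> \<psi> t = 0"
begin

lemma exp_kernel: "exp_kernel R (fourier_laplace \<psi>)"
  by (rule exp_kernel_fourier_laplace[OF sm _ R]) (rule supp)

lemma borel_measurable: "\<psi> \<in> borel_measurable borel"
  by (intro borel_measurable_continuous_onI smooth1_continuous sm)

lemma integrable: "integrable lborel \<psi>"
  by (rule continuous_compact_support_integrable[where R=R]) (auto intro: smooth1_continuous[OF sm] supp)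

lemma fourier_laplace_decay: obtains C where "0 \<le> C" "\<And>x. norm (fourier_laplace \<psi> (of_real x)) \<le> C * wt x"
proof -
  obtain C where C': "0 \<le> C \<and> (\<forall>z. norm (fourier_laplace \<psi> z) \<le> C * exp (R * \<bar>Im z\<bar>) * wt (Re z))"
    using exp_kernelD(2)[OF exp_kernel] by (rule exE)
  note C = conjunct1[OF C'] conjunct2[OF C']
  have "norm (fourier_laplace \<psi> (of_real x)) \<le> C * wt x" for x
    using C(2)[rule_format, of "of_real x"] by simp
  then show ?thesis by (rule that[OF C(1)])
qed

lemma fourier_laplace_measurable: "(\<lambda>x. fourier_laplace \<psi> (of_real x)) \<in> borel_measurable borel"
proof -
  have c: "continuous_on UNIV (fourier_laplace \<psi>)" using exp_kernelD(1)[OF exp_kernel] by (rule holomorphic_on_imp_continuous_on)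
  have "continuous_on UNIV (\<lambda>x::real. fourier_laplace \<psi> (of_real x))"
    by (rule continuous_on_compose2[OF c continuous_on_of_real[OF continuous_on_id]]) simp
  then show ?thesis by (rule borel_measurable_continuous_onI)
qed

lemma fourier_laplace_integrable_real: "integrable lborel (\<lambda>x. fourier_laplace \<psi> (of_real x))"
proof -
  obtain C where C: "0 \<le> C" "\<And>x. norm (fourier_laplace \<psi> (of_real x)) \<le> C * wt x" by (rule fourier_laplace_decay) (rule that)
  note [measurable] = fourier_laplace_measurable
  show ?thesis
  proof (rule Bochner_Integration.integrable_bound)
    show "integrable lborel (\<lambda>x. C * wt x)" by (intro integrable_mult_right integrable_wt)
    show "AE x in lborel. norm (fourier_laplace \<psi> (of_real x)) \<le> norm (C * wt x)"
      using C by (intro always_eventually allI) (simp add: abs_mult)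
  qed measurable
qed

text \<open>Fubini's theorem and the self-duality of the Gaussian. Without the Gaussian factor the
  double integral would not converge absolutely, since the modulus of the integrand is constant in
  \<open>v\<close>.\<close>

lemma fourier_laplace_gaussian:
  assumes d: "0 < d"
  shows "(LINT v|lborel. fourier_laplace \<psi> (of_real v) * of_real (exp (- (d * v)\<^sup>2 / 2)))
    = (LINT y|lborel. \<psi> (d * y) * of_real (sqrt (2 * pi) * exp (- y\<^sup>2 / 2)))"
proof -
  note [measurable] = borel_measurable
  have gd: "integrable lborel (\<lambda>v. exp (- (d * v)\<^sup>2 / 2))"
    using lborel_integrable_real_affine[OF integrable_gaussian, of d 0] d by simp
  let ?k = "\<lambda>v t. exp (- \<i> * of_real v * of_real t) * \<psi> t * complex_of_real (exp (- (d * v)\<^sup>2 / 2))"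
  have nk: "norm (?k v t) = norm (\<psi> t) * exp (- (d * v)\<^sup>2 / 2)" for v t
    by (simp add: norm_mult norm_exp_eq_Re)
  have int: "integrable (lborel \<Otimes>\<^sub>M lborel) (case_prod (\<lambda>t v. ?k v t))"
  proof (rule lborel_pair.Fubini_integrable)
    show "case_prod (\<lambda>t v. ?k v t) \<in> borel_measurable (lborel \<Otimes>\<^sub>M lborel)" by measurable
    have "integrable lborel (\<lambda>t. norm (\<psi> t) * (LINT v|lborel. exp (- (d * v)\<^sup>2 / 2)))"
      by (intro integrable_mult_left integrable_norm integrable)
    then show "integrable lborel (\<lambda>t. LINT v|lborel. norm (case (t, v) of (t, v) \<Rightarrow> ?k v t))"
      by (simp only: split_conv nk integral_mult_right_zero)
    have "integrable lborel (\<lambda>v. ?k v t)" for t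
    proof (rule Bochner_Integration.integrable_bound)
      show "integrable lborel (\<lambda>v. norm (\<psi> t) * exp (- (d * v)\<^sup>2 / 2))" by (intro integrable_mult_right gd)
      show "AE v in lborel. norm (?k v t) \<le> norm (norm (\<psi> t) * exp (- (d * v)\<^sup>2 / 2))"
        unfolding nk by simp
    qed measurable
    then show "AE t in lborel. integrable lborel (\<lambda>v. case (t, v) of (t, v) \<Rightarrow> ?k v t)" by simp
  qed
  have inner: "(LINT v|lborel. ?k v t) = \<psi> t * of_real (sqrt (2 * pi) / d * exp (- (t / d)\<^sup>2 / 2))" for t
  proof -
    let ?g = "\<lambda>y. exp (- \<i> * of_real (y * (t / d))) * complex_of_real (exp (- y\<^sup>2 / 2))"
    have "(LINT y|lborel. ?g y) = \<bar>d\<bar> *\<^sub>R (LINT v|lborel. ?g (0 + d * v))"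
      by (rule lborel_integral_real_affine) (use d in simp)
    moreover have "?k v t = \<psi> t * ?g (0 + d * v)" for v using d by (simp add: mult.assoc)
    ultimately have "of_real d * (LINT v|lborel. ?k v t) = \<psi> t * (LINT y|lborel. ?g y)"
      using d by (simp add: scaleR_conv_of_real mult_ac)
    also have "(LINT y|lborel. ?g y) = complex_of_real (sqrt (2 * pi) * exp (- (t / d)\<^sup>2 / 2))"
      by (rule gaussian_fourier)
    finally show ?thesis using d by (simp add: field_simps)
  qed
  have "(LINT v|lborel. fourier_laplace \<psi> (of_real v) * of_real (exp (- (d * v)\<^sup>2 / 2))) = (LINT v|lborel. LINT t|lborel. ?k v t)"
    unfolding fourier_laplace_def by simp
  also have "\<dots> = (LINT t|lborel. LINT v|lborel. ?k v t)"
    by (rule lborel_pair.Fubini_integral[OF int])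
  also have "\<dots> = (LINT t|lborel. \<psi> t * of_real (sqrt (2 * pi) / d * exp (- (t / d)\<^sup>2 / 2)))"
    unfolding inner ..
  also have "\<dots> = \<bar>d\<bar> *\<^sub>R (LINT y|lborel. \<psi> (0 + d * y) * of_real (sqrt (2 * pi) / d * exp (- ((0 + d * y) / d)\<^sup>2 / 2)))"
    by (rule lborel_integral_real_affine) (use d in simp)
  also have "\<dots> = (LINT y|lborel. \<bar>d\<bar> *\<^sub>R (\<psi> (0 + d * y) * of_real (sqrt (2 * pi) / d * exp (- ((0 + d * y) / d)\<^sup>2 / 2))))"
    by (rule integral_scaleR_right[symmetric])
  also have "\<dots> = (LINT y|lborel. \<psi> (d * y) * of_real (sqrt (2 * pi) * exp (- y\<^sup>2 / 2)))"
    using d by (simp add: scaleR_conv_of_real)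
  finally show ?thesis .
qed

text \<open>Fourier inversion at the origin: \<open>d\<close> tends to 0 on both sides of the
  Gaussian identity, by dominated convergence. The constant 2 pi is the square of sqrt(2 pi), one
  factor from the self-duality and one from the mass of the Gaussian.\<close>

lemma integral_fourier_laplace: "(LINT v|lborel. fourier_laplace \<psi> (of_real v)) = 2 * pi * \<psi> 0"
proof -
  note [measurable] = fourier_laplace_measurable borel_measurable
  define d where "d n = 1 / real (Suc n)" for n
  have d: "0 < d n" for n by (simp add: d_def)
  have dl: "d \<longlonglongrightarrow> 0" unfolding d_def by (rule LIMSEQ_Suc[OF lim_const_over_n])
  obtain C where C: "0 \<le> C" "\<And>x. norm (fourier_laplace \<psi> (of_real x)) \<le> C * wt x" by (rule fourier_laplace_decay) (rule that)
  have "(\<lambda>n. LINT v|lborel. fourier_laplace \<psi> (of_real v) * of_real (exp (- (d n * v)\<^sup>2 / 2))) \<longlonglongrightarrow> (LINT v|lborel. fourier_laplace \<psi> (of_real v))"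
  proof (rule integral_dominated_convergence[where w="\<lambda>x. norm (fourier_laplace \<psi> (of_real x))"])
    show "integrable lborel (\<lambda>x. norm (fourier_laplace \<psi> (of_real x)))" by (intro integrable_norm fourier_laplace_integrable_real)
    have "(\<lambda>n. fourier_laplace \<psi> (of_real v) * of_real (exp (- (d n * v)\<^sup>2 / 2))) \<longlonglongrightarrow> fourier_laplace \<psi> (of_real v) * of_real (exp (- (0 * v)\<^sup>2 / 2))" for v
      by (intro tendsto_intros dl) simp
    then show "AE v in lborel. (\<lambda>n. fourier_laplace \<psi> (of_real v) * of_real (exp (- (d n * v)\<^sup>2 / 2))) \<longlonglongrightarrow> fourier_laplace \<psi> (of_real v)" by simp
    show "AE v in lborel. norm (fourier_laplace \<psi> (of_real v) * of_real (exp (- (d n * v)\<^sup>2 / 2))) \<le> norm (fourier_laplace \<psi> (of_real v))" for n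
      by (intro always_eventually allI) (simp add: norm_mult mult_left_le)
  qed measurable
  moreover have "(\<lambda>n. LINT v|lborel. fourier_laplace \<psi> (of_real v) * of_real (exp (- (d n * v)\<^sup>2 / 2))) \<longlonglongrightarrow> 
     (LINT y|lborel. \<psi> 0 * of_real (sqrt (2 * pi) * exp (- y\<^sup>2 / 2)))"
    unfolding fourier_laplace_gaussian[OF d]
  proof -
    have "bounded (\<psi> ` {-R..R})"
      by (intro compact_imp_bounded compact_continuous_image smooth1_continuous[OF sm]) auto
    then obtain B where B: "0 < B" "\<And>t. t \<in> {-R..R} \<Longrightarrow> norm (\<psi> t) \<le> B" unfolding bounded_pos by auto
    have B': "norm (\<psi> t) \<le> B" for t
    proof (cases "R \<le> \<bar>t\<bar>")
      case False
      then have "t \<in> {-R..R}" by (simp add: abs_if split: if_splits)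
      then show ?thesis by (rule B(2))
    qed (use B supp in simp)
    show "(\<lambda>n. LINT y|lborel. \<psi> (d n * y) * of_real (sqrt (2 * pi) * exp (- y\<^sup>2 / 2))) \<longlonglongrightarrow> 
     (LINT y|lborel. \<psi> 0 * of_real (sqrt (2 * pi) * exp (- y\<^sup>2 / 2)))"
    proof (rule integral_dominated_convergence[where w="\<lambda>y. B * (sqrt (2 * pi) * exp (- y\<^sup>2 / 2))"])
      show "integrable lborel (\<lambda>y. B * (sqrt (2 * pi) * exp (- y\<^sup>2 / 2)))" by (intro integrable_mult_right integrable_gaussian)
      have "isCont \<psi> (0 * y)" for y using smooth1_continuous[OF sm, of UNIV] by (simp add: continuous_on_eq_continuous_at)
      then have "(\<lambda>n. \<psi> (d n * y) * of_real (sqrt (2 * pi) * exp (- y\<^sup>2 / 2))) \<longlonglongrightarrow> \<psi> (0 * y) * of_real (sqrt (2 * pi) * exp (- y\<^sup>2 / 2))" for y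
        by (intro tendsto_mult tendsto_const isCont_tendsto_compose[where g=\<psi>] dl)
      then show "AE y in lborel. (\<lambda>n. \<psi> (d n * y) * of_real (sqrt (2 * pi) * exp (- y\<^sup>2 / 2))) \<longlonglongrightarrow> \<psi> 0 * of_real (sqrt (2 * pi) * exp (- y\<^sup>2 / 2))"
        by simp
      show "AE y in lborel. norm (\<psi> (d n * y) * of_real (sqrt (2 * pi) * exp (- y\<^sup>2 / 2))) \<le> B * (sqrt (2 * pi) * exp (- y\<^sup>2 / 2))" for n
        using B' by (intro always_eventually allI) (simp add: norm_mult mult_right_mono)
    qed measurable
  qed
  ultimately have "(LINT v|lborel. fourier_laplace \<psi> (of_real v)) = (LINT y|lborel. \<psi> 0 * of_real (sqrt (2 * pi) * exp (- y\<^sup>2 / 2)))"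
    by (rule LIMSEQ_unique)
  also have "\<dots> = \<psi> 0 * (of_real (sqrt (2 * pi)) * (LINT y|lborel. exp (- \<i> * of_real (y * 0)) * complex_of_real (exp (- y\<^sup>2 / 2))))"
    by simp
  also have "\<dots> = \<psi> 0 * (complex_of_real (sqrt (2 * pi)) * complex_of_real (sqrt (2 * pi)))"
    unfolding gaussian_fourier by simp
  also have "complex_of_real (sqrt (2 * pi)) * complex_of_real (sqrt (2 * pi)) = of_real (2 * pi)"
    unfolding of_real_mult[symmetric] by simp
  finally show ?thesis by (simp add: mult.commute)
qed

end

section \<open>Smoothed interval indicators\<close>

text \<open>The inverse Fourier transform of an interval indicator, up to the factor 2 pi:
  multiplying a test function by it convolves the transform with the indicator.\<close>

definition theta :: "real \<Rightarrow> real \<Rightarrow> real \<Rightarrow> complex" where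
  "theta a b t = (LINT s|lborel. indicator {a<..<b} s * exp (\<i> * of_real t * of_real s))"

lemma theta_smooth: 
  assumes "a \<le> b" shows "smooth1 (theta a b)"
proof -
  let ?F = "\<lambda>z. integral (cbox a b) (\<lambda>s. exp (\<i> * z * of_real s))"
  have "?F holomorphic_on UNIV"
    by (rule leibniz_rule_holomorphic[where fx="\<lambda>z s. (\<i> * of_real s) * exp (\<i> * z * of_real s)"])
       (auto intro!: derivative_eq_intros integrable_continuous_real continuous_intros simp: split_beta)
  moreover
  have "theta a b t = ?F (of_real t)" for t
  proof -
    have "theta a b t = (LINT s|lborel. indicator {a..b} s *\<^sub>R exp (\<i> * of_real t * of_real s))"
      unfolding theta_def
    proof (rule integral_cong_AE)
      have "AE s in lborel. s \<noteq> a \<and> s \<noteq> b" by (intro AE_conjI AE_lborel_singleton)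
      then show "AE s in lborel. indicator {a<..<b} s * exp (\<i> * of_real t * of_real s) = indicator {a..b} s *\<^sub>R exp (\<i> * of_real t * of_real s)"
        by eventually_elim (auto simp: indicator_def)
    qed measurable
    also have "\<dots> = integral {a..b} (\<lambda>s. exp (\<i> * of_real t * of_real s))"
      unfolding set_lebesgue_integral_def[symmetric]
      by (intro set_borel_integral_eq_integral(2) borel_integrable_atLeastAtMost' continuous_intros)
    finally show ?thesis by (simp add: cbox_interval)
  qed
  then have "theta a b = (\<lambda>t. ?F (of_real t))" by (rule ext)
  ultimately show ?thesis using smooth1_holomorphic[of ?F] by (simp only:)
qed

lemma integrable_indicator_Ioo: "integrable lborel (\<lambda>s::real. indicator {a<..<b} s :: real)"
proof (cases "a \<le> b")
  case True
  then show ?thesis by (simp add: integrable_indicator_iff)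
qed simp

context test_function1
begin

lemma fourier_laplace_times_theta:
  "fourier_laplace (\<lambda>t. \<psi> t * theta a b t) (of_real x) = (LINT s|lborel. indicator {a<..<b} s * fourier_laplace \<psi> (of_real (x - s)))"
proof -
  note [measurable] = borel_measurable
  let ?k = "\<lambda>t s. indicator {a<..<b} s * (exp (- \<i> * of_real (x - s) * of_real t) * \<psi> t)"
  have nk: "norm (?k t s) = norm (\<psi> t) * indicator {a<..<b} s" for t s
    by (simp add: norm_mult norm_exp_eq_Re indicator_def)
  have ii: "integrable lborel (\<lambda>s. indicator {a<..<b} s :: real)"
    by (rule integrable_indicator_Ioo)
  have int: "integrable (lborel \<Otimes>\<^sub>M lborel) (case_prod ?k)"
  proof (rule lborel_pair.Fubini_integrable)
    show "case_prod ?k \<in> borel_measurable (lborel \<Otimes>\<^sub>M lborel)" by measurable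
    have "integrable lborel (\<lambda>t. norm (\<psi> t) * (LINT s|lborel. indicator {a<..<b} s))"
      by (intro integrable_mult_left integrable_norm integrable)
    then show "integrable lborel (\<lambda>t. LINT s|lborel. norm (case (t, s) of (t, s) \<Rightarrow> ?k t s))"
      by (simp only: split_conv nk integral_mult_right_zero)
    have "integrable lborel (\<lambda>s. ?k t s)" for t
    proof (rule Bochner_Integration.integrable_bound)
      show "integrable lborel (\<lambda>s. norm (\<psi> t) * indicator {a<..<b} s)" by (intro integrable_mult_right ii)
      show "AE s in lborel. norm (?k t s) \<le> norm (norm (\<psi> t) * indicator {a<..<b} s)"
        unfolding nk by simp
    qed measurable
    then show "AE t in lborel. integrable lborel (\<lambda>s. case (t, s) of (t, s) \<Rightarrow> ?k t s)" by simp
  qed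
  have "fourier_laplace (\<lambda>t. \<psi> t * theta a b t) (of_real x) = (LINT t|lborel. LINT s|lborel. ?k t s)"
    unfolding fourier_laplace_def
  proof (rule Bochner_Integration.integral_cong[OF refl])
    fix t
    have "exp (- \<i> * of_real x * of_real t) * (\<psi> t * theta a b t) 
       = (LINT s|lborel. exp (- \<i> * of_real x * of_real t) * (\<psi> t * (indicator {a<..<b} s * exp (\<i> * of_real t * of_real s))))"
      unfolding theta_def by simp
    also have "\<dots> = (LINT s|lborel. ?k t s)"
    proof (rule Bochner_Integration.integral_cong[OF refl])
      fix s
      have "exp (- \<i> * of_real (x - s) * of_real t) = exp (- \<i> * of_real x * of_real t) * exp (\<i> * of_real t * of_real s)"
        unfolding exp_add[symmetric] by (simp add: algebra_simps)
      then show "exp (- \<i> * of_real x * of_real t) * (\<psi> t * (indicator {a<..<b} s * exp (\<i> * of_real t * of_real s))) = ?k t s"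
        by (simp only: mult_ac)
    qed
    finally show "exp (- \<i> * of_real x * of_real t) * (\<psi> t * theta a b t) = (LINT s|lborel. ?k t s)" .
  qed
  also have "\<dots> = (LINT s|lborel. LINT t|lborel. ?k t s)"
    by (rule lborel_pair.Fubini_integral[OF int, symmetric])
  finally show ?thesis unfolding fourier_laplace_def by simp
qed

lemma fourier_laplace_scale:
  assumes N: "0 < N"
  shows "fourier_laplace (\<lambda>t. \<psi> ((1 / N) * t + 0)) (of_real x) = of_real N * fourier_laplace \<psi> (of_real (N * x))"
proof -
  have "fourier_laplace (\<lambda>t. \<psi> ((1 / N) * t + 0)) (of_real x) = (LINT t|lborel. exp (- \<i> * of_real x * of_real t) * \<psi> ((1 / N) * t + 0))"
    by (simp add: fourier_laplace_def)
  also have "\<dots> = \<bar>N\<bar> *\<^sub>R (LINT t|lborel. exp (- \<i> * of_real x * of_real (0 + N * t)) * \<psi> ((1 / N) * (0 + N * t) + 0))"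
    by (rule lborel_integral_real_affine) (use N in simp)
  also have "\<dots> = of_real N * fourier_laplace \<psi> (of_real (N * x))"
    unfolding fourier_laplace_def using N by (simp add: scaleR_conv_of_real mult_ac)
  finally show ?thesis .
qed

text \<open>Cutting \<open>theta\<close> off at scale n + 1 keeps the product a test function, while
  its transform approximates 2 pi \<open>\<psi> 0\<close> times the interval indicator.\<close>

definition box_kernel :: "real \<Rightarrow> real \<Rightarrow> nat \<Rightarrow> real \<Rightarrow> complex" where
  "box_kernel a b n x = fourier_laplace (\<lambda>t. \<psi> ((1 / real (Suc n)) * t + 0) * theta a b t) (of_real x)"

lemma test_function1_scale:
  assumes "0 < N" shows "test_function1 (\<lambda>t. \<psi> ((1 / N) * t + 0)) (N * R)"
proof
  show "0 \<le> N * R" using R assms by simp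
  show "smooth1 (\<lambda>t. \<psi> ((1 / N) * t + 0))" by (intro smooth1_affine sm)
  fix t assume "N * R \<le> \<bar>t\<bar>"
  then have "R \<le> \<bar>(1 / N) * t + 0\<bar>" using assms by (simp add: abs_mult pos_le_divide_eq mult.commute)
  then show "\<psi> ((1 / N) * t + 0) = 0" by (rule supp)
qed

lemma box_kernel_eq:
  "box_kernel a b n x = (LINT s|lborel. indicator {a<..<b} s * (of_real (real (Suc n)) * fourier_laplace \<psi> (of_real (real (Suc n) * (x - s)))))"
proof -
  interpret S: test_function1 "\<lambda>t. \<psi> ((1 / real (Suc n)) * t + 0)" "real (Suc n) * R"
    by (rule test_function1_scale) simp
  show ?thesis unfolding box_kernel_def S.fourier_laplace_times_theta
    by (subst fourier_laplace_scale) (simp_all del: of_nat_Suc)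
qed

lemma box_kernel_eq2:
  "box_kernel a b n x = (LINT v|lborel. indicator {real (Suc n) * (x - b)<..<real (Suc n) * (x - a)} v * fourier_laplace \<psi> (of_real v))"
proof -
  let ?N = "real (Suc n)"
  have N: "0 < ?N" by simp
  have "(LINT v|lborel. indicator {?N * (x - b)<..<?N * (x - a)} v * fourier_laplace \<psi> (of_real v))
     = \<bar>- ?N\<bar> *\<^sub>R (LINT s|lborel. indicator {?N * (x - b)<..<?N * (x - a)} (?N * x + (- ?N) * s) * fourier_laplace \<psi> (of_real (?N * x + (- ?N) * s)))"
    by (rule lborel_integral_real_affine) (simp del: of_nat_Suc)
  also have "\<dots> = (LINT s|lborel. \<bar>- ?N\<bar> *\<^sub>R (indicator {?N * (x - b)<..<?N * (x - a)} (?N * x + (- ?N) * s) * fourier_laplace \<psi> (of_real (?N * x + (- ?N) * s))))"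
    by (rule integral_scaleR_right[symmetric])
  also have "\<dots> = box_kernel a b n x"
    unfolding box_kernel_eq
  proof (rule Bochner_Integration.integral_cong[OF refl])
    fix s
    have e: "?N * x + (- ?N) * s = ?N * (x - s)" by (simp only: right_diff_distrib' mult_minus_left add_uminus_conv_diff)
    have i: "indicator {?N * (x - b)<..<?N * (x - a)} (?N * (x - s)) = (indicator {a<..<b} s :: complex)"
      using N by (auto simp: indicator_def simp del: of_nat_Suc)
    have "\<bar>- ?N\<bar> = ?N" by simp
    then show "\<bar>- ?N\<bar> *\<^sub>R (indicator {?N * (x - b)<..<?N * (x - a)} (?N * x + (- ?N) * s) * fourier_laplace \<psi> (of_real (?N * x + (- ?N) * s)))
       = indicator {a<..<b} s * (of_real ?N * fourier_laplace \<psi> (of_real (?N * (x - s))))"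
      unfolding e i by (simp only: scaleR_conv_of_real mult_ac)
  qed
  finally show ?thesis ..
qed

text \<open>In the form \<open>box_kernel_eq2\<close> a fixed integrable function is integrated over
  a dilated interval. This interval exhausts the line if \<open>x\<close> lies strictly between
  \<open>a\<close> and \<open>b\<close>, and escapes to infinity if \<open>x\<close> lies outside;
  at an endpoint it would tend to a half-line.\<close>

lemma box_kernel_limit:
  assumes x: "x \<noteq> a" "x \<noteq> b" and ab: "a \<le> b"
  shows "(\<lambda>n. box_kernel a b n x) \<longlonglongrightarrow> indicator {a<..<b} x * (2 * pi * \<psi> 0)"
proof -
  note [measurable] = fourier_laplace_measurable
  have "(\<lambda>n. LINT v|lborel. indicator {real (Suc n) * (x - b)<..<real (Suc n) * (x - a)} v * fourier_laplace \<psi> (of_real v))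
     \<longlonglongrightarrow> (LINT v|lborel. indicator {a<..<b} x * fourier_laplace \<psi> (of_real v))"
  proof (rule integral_dominated_convergence[where w="\<lambda>v. norm (fourier_laplace \<psi> (of_real v))"])
    show "integrable lborel (\<lambda>x. norm (fourier_laplace \<psi> (of_real x)))" by (intro integrable_norm fourier_laplace_integrable_real)
    have "(\<lambda>n. indicator {real (Suc n) * (x - b)<..<real (Suc n) * (x - a)} v * fourier_laplace \<psi> (of_real v)) \<longlonglongrightarrow> indicator {a<..<b} x * fourier_laplace \<psi> (of_real v)" for v
    proof -
      have top: "filterlim (\<lambda>n. real (Suc n) * c) at_top sequentially" if "0 < c" for c
        by (intro filterlim_at_top_mult_tendsto_pos[OF tendsto_const] that filterlim_compose[OF filterlim_real_sequentially filterlim_Suc])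
      have pos: "\<forall>\<^sub>F n in sequentially. v < real (Suc n) * c" if "0 < c" for c
        using top[OF that] unfolding filterlim_at_top_dense by blast
      have neg: "\<forall>\<^sub>F n in sequentially. real (Suc n) * c < v" if "c < 0" for c
      proof -
        have "\<forall>\<^sub>F n in sequentially. - v < real (Suc n) * (- c)"
        proof -
          have "filterlim (\<lambda>n. real (Suc n) * (- c)) at_top sequentially" using that by (intro top) simp
          then show ?thesis unfolding filterlim_at_top_dense by (rule spec)
        qed
        then show ?thesis by eventually_elim (simp del: of_nat_Suc)
      qed
      consider "x < a" | "a < x" "x < b" | "b < x" using x ab by linarith
      then have "\<forall>\<^sub>F n in sequentially. indicator {real (Suc n) * (x - b)<..<real (Suc n) * (x - a)} v = (indicator {a<..<b} x :: complex)"
      proof cases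
        case 1
        then have "x - a < 0" by simp
        from neg[OF this] show ?thesis by eventually_elim (use 1 in \<open>auto simp: indicator_def simp del: of_nat_Suc\<close>)
      next
        case 2
        then have "x - b < 0" "0 < x - a" by simp_all
        from neg[OF this(1)] pos[OF this(2)] show ?thesis
          by eventually_elim (use 2 in \<open>auto simp: indicator_def simp del: of_nat_Suc\<close>)
      next
        case 3
        then have "0 < x - b" by simp
        from pos[OF this] show ?thesis by eventually_elim (use 3 in \<open>auto simp: indicator_def simp del: of_nat_Suc\<close>)
      qed
      then show ?thesis by (intro tendsto_eventually) (auto elim: eventually_mono)
    qed
    then show "AE v in lborel. (\<lambda>n. indicator {real (Suc n) * (x - b)<..<real (Suc n) * (x - a)} v * fourier_laplace \<psi> (of_real v)) \<longlonglongrightarrow> indicator {a<..<b} x * fourier_laplace \<psi> (of_real v)"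
      by simp
    show "AE v in lborel. norm (indicator {real (Suc n) * (x - b)<..<real (Suc n) * (x - a)} v * fourier_laplace \<psi> (of_real v)) \<le> norm (fourier_laplace \<psi> (of_real v))" for n
      by (intro always_eventually allI) (simp add: indicator_def)
  qed measurable
  then show ?thesis unfolding box_kernel_eq2[symmetric] by (simp add: integral_fourier_laplace)
qed

text \<open>The majorant for dominated convergence, independent of \<open>n\<close>. For
  \<open>\<bar>x\<bar> \<le> r + 1\<close> the total mass \<open>V\<close> is a bound and the weight
  is at least \<open>wt (r + 1)\<close>. Farther out \<open>\<bar>x - s\<bar>\<close> is at least 1,
  so the decay of the dilated transform absorbs the dilation factor: N wt(N y) is at most 2 wt(y)
  for |y| at least 1.\<close>

lemma box_kernel_bound:
  assumes ab: "a \<le> b"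
  obtains K where "0 \<le> K" "\<And>n x. norm (box_kernel a b n x) \<le> K * wt x"
proof -
  note [measurable] = fourier_laplace_measurable
  obtain C where C: "0 \<le> C" "\<And>x. norm (fourier_laplace \<psi> (of_real x)) \<le> C * wt x" by (rule fourier_laplace_decay) (rule that)
  define V where "V = (LINT v|lborel. C * wt v)"
  have V0: "0 \<le> V" unfolding V_def using C(1) by (intro integral_nonneg_AE always_eventually) simp
  define r where "r = max \<bar>a\<bar> \<bar>b\<bar>"
  have r: "\<bar>s\<bar> \<le> r" if "s \<in> {a<..<b}" for s using that by (simp add: r_def abs_if max_def)
  define K where "K = V / wt (r + 1) + C * 4 * (1 + r\<^sup>2) * (b - a)"
  have K1: "0 \<le> V / wt (r + 1)" using V0 by simp
  have K2: "0 \<le> C * 4 * (1 + r\<^sup>2) * (b - a)" using C(1) ab by simp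
  have b1: "norm (box_kernel a b n x) \<le> V" for n x
    unfolding box_kernel_eq2 V_def
  proof (rule Bochner_Integration.integral_norm_bound_integral)
    let ?I = "{real (Suc n) * (x - b)<..<real (Suc n) * (x - a)}"
    show "integrable lborel (\<lambda>v. indicator ?I v * fourier_laplace \<psi> (of_real v))"
      by (rule Bochner_Integration.integrable_bound[OF fourier_laplace_integrable_real]) (measurable, simp add: indicator_def)
    show "integrable lborel (\<lambda>v. C * wt v)" by (intro integrable_mult_right integrable_wt)
    show "norm (indicator ?I v * fourier_laplace \<psi> (of_real v)) \<le> C * wt v" for v
      using C(2)[of v] order_trans[OF norm_ge_zero C(2)[of v]] by (simp add: indicator_def)
  qed
  have b2: "norm (box_kernel a b n x) \<le> C * 4 * (1 + r\<^sup>2) * (b - a) * wt x" if x: "r + 1 < \<bar>x\<bar>" for n x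
  proof -
    let ?N = "real (Suc n)"
    let ?c = "C * 4 * (1 + r\<^sup>2) * wt x"
    have c0: "0 \<le> ?c" using C(1) by simp
    have le: "norm (indicator {a<..<b} s * (of_real ?N * fourier_laplace \<psi> (of_real (?N * (x - s))))) \<le> ?c * indicator {a<..<b} s" for s
    proof (cases "s \<in> {a<..<b}")
      case True
      have d: "1 \<le> \<bar>x - s\<bar>" using r[OF True] x by (simp add: abs_if split: if_splits)
      then have d2: "1 \<le> (x - s)\<^sup>2" using power_mono[OF d, of 2] by simp
      have s2: "s\<^sup>2 \<le> r\<^sup>2" using power_mono[OF r[OF True], of 2] by simp
      have N1: "1 \<le> ?N" by simp
      have "?N * wt (?N * (x - s)) \<le> 2 * wt (x - s)"
      proof -
        let ?q = "(x - s)\<^sup>2"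
        have "?N * (1 + ?q) \<le> ?N * (2 * ?q)" using d2 N1 by (intro mult_left_mono) auto
        also have "\<dots> \<le> 2 * (1 + ?N * ?N * ?q)"
        proof -
          have "?N * ?q \<le> (?N * ?N) * ?q" using N1 by (intro mult_right_mono) auto
          then show ?thesis
            by (simp only: distrib_left mult.left_commute[of ?N 2] mult_1_right)
        qed
        finally have "?N * (1 + ?q) \<le> 2 * (1 + (?N * (x - s))\<^sup>2)" by (simp only: power_mult_distrib power2_eq_square mult_ac)
        moreover have "0 < 1 + ?q" "0 < 1 + (?N * (x - s))\<^sup>2" by (simp_all only: add_pos_nonneg zero_less_one zero_le_power2)
        moreover have "m * (1 / B) \<le> 2 * (1 / A)" if "m * A \<le> 2 * B" "0 < A" "0 < B" for m A B :: real
          using that by (simp add: field_simps)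
        ultimately show ?thesis unfolding wt_def by blast
      qed
      also have "2 * wt (x - s) \<le> 2 * (2 * (1 + s\<^sup>2) * wt x)"
        using wt_shift[of x "- s"] by simp
      also have "\<dots> \<le> 2 * (2 * (1 + r\<^sup>2) * wt x)"
        using s2 by (intro mult_left_mono mult_right_mono) auto
      also have "2 * (2 * (1 + r\<^sup>2) * wt x) = 4 * (1 + r\<^sup>2) * wt x" by (simp add: algebra_simps)
      finally have w: "?N * wt (?N * (x - s)) \<le> 4 * (1 + r\<^sup>2) * wt x" .
      have "norm (of_real ?N * fourier_laplace \<psi> (of_real (?N * (x - s)))) \<le> ?N * (C * wt (?N * (x - s)))"
        using mult_left_mono[OF C(2)[of "?N * (x - s)"], of ?N] by (simp only: norm_mult norm_of_real abs_of_nat)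
      also have "\<dots> = C * (?N * wt (?N * (x - s)))" by (simp only: mult.left_commute)
      also have "\<dots> \<le> C * (4 * (1 + r\<^sup>2) * wt x)" using w C(1) by (rule mult_left_mono)
      finally show ?thesis using True by (simp add: mult.assoc)
    qed simp
    have "norm (box_kernel a b n x) \<le> (LINT s|lborel. ?c * indicator {a<..<b} s)"
      unfolding box_kernel_eq
    proof (rule Bochner_Integration.integral_norm_bound_integral)
      show i: "integrable lborel (\<lambda>s. ?c * indicator {a<..<b} s)"
        by (intro integrable_mult_right integrable_indicator_Ioo)
      show "integrable lborel (\<lambda>s. indicator {a<..<b} s * (of_real ?N * fourier_laplace \<psi> (of_real (?N * (x - s)))))"
        by (rule Bochner_Integration.integrable_bound[OF i]) 
           (measurable, intro always_eventually allI order_trans[OF le], simp)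
      show "norm (indicator {a<..<b} s * (of_real ?N * fourier_laplace \<psi> (of_real (?N * (x - s))))) \<le> ?c * indicator {a<..<b} s" for s by (rule le)
    qed
    also have "\<dots> = ?c * (b - a)" using ab by simp
    finally show ?thesis by (simp only: mult_ac)
  qed
  have "norm (box_kernel a b n x) \<le> K * wt x" for n x
  proof (cases "r + 1 < \<bar>x\<bar>")
    case True
    have "C * 4 * (1 + r\<^sup>2) * (b - a) * wt x \<le> K * wt x"
      unfolding K_def using K1 by (intro mult_right_mono) auto
    then show ?thesis using b2[OF True] order_trans by blast
  next
    case False
    then have "\<bar>x\<bar> \<le> r + 1" by simp
    then have "x\<^sup>2 \<le> (r + 1)\<^sup>2" using power_mono[of "\<bar>x\<bar>" "r + 1" 2] by simp
    then have "wt (r + 1) \<le> wt x" unfolding wt_def by (intro divide_left_mono) (auto simp: add_pos_nonneg)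
    then have "V / wt (r + 1) * wt (r + 1) \<le> V / wt (r + 1) * wt x" using K1 by (rule mult_left_mono)
    then have "V \<le> V / wt (r + 1) * wt x" using wt_pos[of "r + 1"] by simp
    also have "\<dots> \<le> K * wt x" unfolding K_def using K2 by (intro mult_right_mono) auto
    finally show ?thesis using b1 order_trans by blast
  qed
  moreover have "0 \<le> K" using K1 K2 by (simp add: K_def)
  ultimately show ?thesis by (intro that[of K]) auto
qed

end

section \<open>Testing the spectrum with tensor products\<close>

definition tprod :: "('n \<Rightarrow> real \<Rightarrow> complex) \<Rightarrow> real^'n \<Rightarrow> complex" where
  "tprod \<psi> t = (\<Prod>j\<in>UNIV. \<psi> j (t $ j))"

lemma partial_real_tprod:
  fixes \<psi> :: "'n::finite \<Rightarrow> real \<Rightarrow> complex"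
  assumes "\<And>j. smooth1 (\<psi> j)"
  shows "partial_real j (tprod \<psi>) = tprod (\<psi>(j := vderiv (\<psi> j)))"
proof
  fix x :: "real^'n"
  let ?P = "\<Prod>i\<in>UNIV - {j}. \<psi> i (x $ i)"
  have "tprod \<psi> (x + s *\<^sub>R axis j 1) = \<psi> j (x $ j + s) * ?P" for s
    unfolding tprod_def by (subst prod.remove[of UNIV j]) (auto simp: axis_def intro!: arg_cong2[where f=times] prod.cong)
  then have eq: "(\<lambda>s. tprod \<psi> (x + s *\<^sub>R axis j 1)) = (\<lambda>s. \<psi> j (x $ j + s) * ?P)" by (rule ext)
  have "((\<lambda>s. x $ j + s) has_vector_derivative 1) (at 0)"
    by (auto intro!: derivative_eq_intros)
  moreover have "(\<psi> j has_vector_derivative vderiv (\<psi> j) (x $ j)) (at (x $ j + 0))"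
    using smooth1_has_vderiv[OF assms[of j]] by simp
  ultimately have "(\<psi> j \<circ> (\<lambda>s. x $ j + s) has_vector_derivative 1 *\<^sub>R vderiv (\<psi> j) (x $ j)) (at 0)"
    by (rule vector_diff_chain_at)
  then have "((\<lambda>s. \<psi> j (x $ j + s)) has_vector_derivative vderiv (\<psi> j) (x $ j)) (at 0)"
    by (simp add: o_def)
  then have "((\<lambda>s. tprod \<psi> (x + s *\<^sub>R axis j 1)) has_vector_derivative vderiv (\<psi> j) (x $ j) * ?P) (at 0)"
    unfolding eq by (rule has_vector_derivative_mult_left)
  then show "partial_real j (tprod \<psi>) x = tprod (\<psi>(j := vderiv (\<psi> j))) x"
    unfolding partial_real_def tprod_def prod_fun_upd by (rule vector_derivative_at)
qed

lemma differentiable_tprod: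
  fixes \<psi> :: "'n::finite \<Rightarrow> real \<Rightarrow> complex"
  assumes "\<And>j. smooth1 (\<psi> j)"
  shows "tprod \<psi> differentiable (at x)"
proof -
  have "((\<lambda>x. \<psi> j (x $ j)) has_derivative (\<lambda>h. (h $ j) *\<^sub>R vderiv (\<psi> j) (x $ j))) (at x)" for j
  proof -
    have a: "((\<lambda>x. x $ j) has_derivative (\<lambda>h. h $ j)) (at x)"
      by (rule bounded_linear_imp_has_derivative[OF bounded_linear_vec_nth])
    have b: "(\<psi> j has_derivative (\<lambda>h. h *\<^sub>R vderiv (\<psi> j) (x $ j))) (at (x $ j))"
      using smooth1_has_vderiv[OF assms[of j]] unfolding has_vector_derivative_def .
    show ?thesis by (rule has_derivative_compose[OF a b])
  qed
  then have "((\<lambda>x. \<Prod>j\<in>UNIV. \<psi> j (x $ j)) has_derivative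
      (\<lambda>y. \<Sum>i\<in>UNIV. (y $ i) *\<^sub>R vderiv (\<psi> i) (x $ i) * (\<Prod>j\<in>UNIV - {i}. \<psi> j (x $ j)))) (at x)"
    by (rule has_derivative_prod)
  then show ?thesis
    unfolding tprod_def[abs_def] differentiable_def by blast
qed

text \<open>Iterated partial derivatives of a tensor product are again tensor products of smooth
  functions, so differentiability of these is enough.\<close>

lemma smooth_tprod:
  fixes \<psi> :: "'n::finite \<Rightarrow> real \<Rightarrow> complex"
  assumes "\<And>j. smooth1 (\<psi> j)"
  shows "smooth (tprod \<psi>)"
  unfolding smooth_def
proof (intro allI)
  fix js :: "'n list" and x
  have "\<exists>\<psi>'. (\<forall>j. smooth1 (\<psi>' j)) \<and> foldr partial_real js (tprod \<psi>) = tprod \<psi>'"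
  proof (induction js)
    case Nil
    show ?case using assms by (intro exI[of _ \<psi>]) simp
  next
    case (Cons j js)
    then obtain \<psi>' where p: "\<forall>j. smooth1 (\<psi>' j)" "foldr partial_real js (tprod \<psi>) = tprod \<psi>'" by (elim exE conjE)
    have "foldr partial_real (j # js) (tprod \<psi>) = tprod (\<psi>'(j := vderiv (\<psi>' j)))"
      using p(2) partial_real_tprod[of \<psi>' j, OF p(1)[rule_format]] by simp
    moreover have "\<forall>i. smooth1 ((\<psi>'(j := vderiv (\<psi>' j))) i)"
      using p(1) smooth1_vderiv[OF p(1)[rule_format, of j]] by simp
    ultimately show ?case by (intro exI conjI)
  qed
  then obtain \<psi>' where p: "\<forall>j. smooth1 (\<psi>' j)" "foldr partial_real js (tprod \<psi>) = tprod \<psi>'" by (elim exE conjE)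
  show "foldr partial_real js (tprod \<psi>) differentiable (at x)"
    unfolding p(2) by (rule differentiable_tprod) (rule p(1)[rule_format])
qed

definition test_family :: "('n \<Rightarrow> real \<Rightarrow> complex) \<Rightarrow> bool" where
  "test_family \<psi> \<longleftrightarrow> (\<exists>R. \<forall>j. test_function1 (\<psi> j) R)"

lemma test_familyI:
  fixes \<psi> :: "'n::finite \<Rightarrow> real \<Rightarrow> complex"
  assumes "\<And>j. test_function1 (\<psi> j) (R j)"
  shows "test_family \<psi>"
proof -
  have "test_function1 (\<psi> j) (Max (range R))" for j
  proof -
    interpret J: test_function1 "\<psi> j" "R j" by (rule assms)
    have le: "R j \<le> Max (range R)" by (intro Max_ge) auto
    show ?thesis
      using J.R le by unfold_locales (auto intro: J.sm J.supp order_trans)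
  qed
  then show ?thesis unfolding test_family_def by (intro exI[of _ "Max (range R)"] allI)
qed

lemma test_familyD:
  fixes \<psi> :: "'n::finite \<Rightarrow> real \<Rightarrow> complex"
  assumes "test_family \<psi>"
  obtains R where "\<And>j. test_function1 (\<psi> j) R"
proof -
  obtain R where "\<forall>j. test_function1 (\<psi> j) R" using assms unfolding test_family_def by (rule exE)
  then show ?thesis by (intro that[of R]) (rule spec)
qed

lemma test_function1_mult:
  assumes "smooth1 g" "test_function1 h R"
  shows "test_function1 (\<lambda>t. g t * h t) R"
proof -
  interpret test_function1 h R by (rule assms)
  show ?thesis by unfold_locales (auto intro: R smooth1_mult assms(1) sm supp)
qed

lemma test_family_upd:
  fixes \<psi> :: "'n::finite \<Rightarrow> real \<Rightarrow> complex"
  assumes "test_family \<psi>" "smooth1 g"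
  shows "test_family (\<psi>(j := \<lambda>t. g t * \<psi> j t))"
proof -
  obtain R where R: "\<And>j. test_function1 (\<psi> j) R" using assms(1) by (rule test_familyD) (rule that)
  show ?thesis
    by (rule test_familyI[where R="\<lambda>_. R"]) (use R test_function1_mult[OF assms(2) R] in auto)
qed

lemma fourier_tprod:
  fixes \<psi> :: "'n::finite \<Rightarrow> real \<Rightarrow> complex"
  assumes "test_family \<psi>"
  shows "fourier (tprod \<psi>) x = (\<Prod>j\<in>UNIV. fourier_laplace (\<psi> j) (of_real (x $ j)))"
proof -
  obtain R where R: "\<And>j. test_function1 (\<psi> j) R" using assms by (rule test_familyD) (rule that)
  have [measurable]: "\<psi> j \<in> borel_measurable borel" for j
    by (rule test_function1.borel_measurable[OF R])
  have e: "exp (- \<i> * complex_of_real (t \<bullet> x)) * tprod \<psi> t = (\<Prod>j\<in>UNIV. exp (- \<i> * of_real (x $ j) * of_real (t $ j)) * \<psi> j (t $ j))" for t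
  proof -
    have "- \<i> * complex_of_real (t \<bullet> x) = (\<Sum>j\<in>UNIV. - \<i> * of_real (x $ j) * of_real (t $ j))"
      unfolding inner_vec_def by (simp add: sum_distrib_left mult_ac sum_negf)
    then show ?thesis unfolding tprod_def prod.distrib by (simp only: exp_sum[OF finite])
  qed
  have i: "integrable lborel (\<lambda>t. exp (- \<i> * of_real (x $ j) * of_real t) * \<psi> j t)" for j
  proof (rule Bochner_Integration.integrable_bound[OF test_function1.integrable[OF R[of j]]])
    show "AE t in lborel. norm (exp (- \<i> * of_real (x $ j) * of_real t) * \<psi> j t) \<le> norm (\<psi> j t)"
      by (simp add: norm_mult norm_exp_eq_Re)
  qed measurable
  have "fourier (tprod \<psi>) x = (LINT t|lebesgue. (\<Prod>j\<in>UNIV. exp (- \<i> * of_real (x $ j) * of_real (t $ j)) * \<psi> j (t $ j)))"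
    unfolding fourier_def e ..
  also have "\<dots> = (LINT t|lborel. (\<Prod>j\<in>UNIV. exp (- \<i> * of_real (x $ j) * of_real (t $ j)) * \<psi> j (t $ j)))"
    by (rule integral_completion) measurable
  also have "\<dots> = (\<Prod>j\<in>UNIV. fourier_laplace (\<psi> j) (of_real (x $ j)))"
    unfolding fourier_laplace_def by (rule integral_prod_vec[OF i])
  finally show ?thesis .
qed

lemma exp_kernel_reflect:
  assumes "exp_kernel R \<kappa>" shows "exp_kernel R (\<lambda>w. \<kappa> (- w))"
proof -
  obtain C where C: "0 \<le> C \<and> (\<forall>z. norm (\<kappa> z) \<le> C * exp (R * \<bar>Im z\<bar>) * wt (Re z))"
    using exp_kernelD(2)[OF assms] by (rule exE)
  have "(\<lambda>w. \<kappa> (- w)) holomorphic_on UNIV"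
    using holomorphic_on_compose_gen[of uminus UNIV \<kappa> UNIV] exp_kernelD(1)[OF assms]
    by (simp add: o_def holomorphic_on_minus[OF holomorphic_on_ident])
  moreover have "norm (\<kappa> (- z)) \<le> C * exp (R * \<bar>Im z\<bar>) * wt (Re z)" for z
    using conjunct2[OF C, rule_format, of "- z"] by (simp add: wt_minus)
  ultimately show ?thesis unfolding exp_kernel_def using conjunct1[OF C] by (intro conjI exI[of _ C]) auto
qed

lemma kernel_prod_fourier_laplace:
  "kernel_prod (\<lambda>j w. fourier_laplace (\<psi> j) (- w)) (complex_vec s) x = (\<Prod>j\<in>UNIV. fourier_laplace (\<psi> j) (of_real (x $ j - s $ j)))"
  by (simp add: kernel_prod_def complex_vec_def)

context Lp_function
begin

text \<open>The distribution evaluated on a tensor product, written through one-variable transforms,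
  which makes it multilinear in the factors.\<close>

definition tpair :: "('n \<Rightarrow> real \<Rightarrow> complex) \<Rightarrow> complex" where
  "tpair \<psi> = (LINT x|lborel. f x * (\<Prod>j\<in>UNIV. fourier_laplace (\<psi> j) (of_real (x $ j))))"

lemma tpair_integrable:
  assumes "test_family \<psi>"
  shows "integrable lborel (\<lambda>x. f x * (\<Prod>j\<in>UNIV. fourier_laplace (\<psi> j) (of_real (x $ j))))"
proof -
  obtain R where R: "\<And>j. test_function1 (\<psi> j) R" using assms by (rule test_familyD) (rule that)
  have "exp_kernel R (\<lambda>w. fourier_laplace (\<psi> j) (- w))" for j
    by (intro exp_kernel_reflect test_function1.exp_kernel R)
  from kernel_integral_integrable[where R="\<lambda>_. R" and \<kappa>="\<lambda>j w. fourier_laplace (\<psi> j) (- w)" and z="complex_vec 0", OF this]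
  show ?thesis unfolding kernel_prod_fourier_laplace by simp
qed

lemma tpair_sum:
  fixes g :: "'n \<Rightarrow> nat \<Rightarrow> real \<Rightarrow> complex"
  assumes g: "\<And>m. test_family (\<lambda>j. g j (m j))"
  shows "tpair (\<lambda>j t. \<Sum>m<M. g j m t) = (\<Sum>m\<in>PiE UNIV (\<lambda>_. {..<M}). tpair (\<lambda>j. g j (m j)))"
proof -
  have i: "integrable lborel (\<lambda>t. exp (- \<i> * z * of_real t) * g j m t)" for z j m
  proof -
    obtain R where R: "\<And>j. test_function1 (g j m) R" using g[of "\<lambda>_. m"] by (rule test_familyD) (rule that)
    interpret J: test_function1 "g j m" R by (rule R)
    show ?thesis by (rule fourier_laplace_integrable[OF J.sm]) (rule J.supp)
  qed
  have "fourier_laplace (\<lambda>t. \<Sum>m<M. g j m t) z = (\<Sum>m<M. fourier_laplace (g j m) z)" for j z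
    unfolding fourier_laplace_def sum_distrib_left by (rule Bochner_Integration.integral_sum) (rule i)
  then have "tpair (\<lambda>j t. \<Sum>m<M. g j m t) = (LINT x|lborel. f x * (\<Prod>j\<in>UNIV. \<Sum>m<M. fourier_laplace (g j m) (of_real (x $ j))))"
    by (simp add: tpair_def)
  also have "\<dots> = (LINT x|lborel. (\<Sum>m\<in>PiE UNIV (\<lambda>_. {..<M}). f x * (\<Prod>j\<in>UNIV. fourier_laplace (g j (m j)) (of_real (x $ j)))))"
    by (subst prod_sum_PiE) (simp_all add: sum_distrib_left)
  also have "\<dots> = (\<Sum>m\<in>PiE UNIV (\<lambda>_. {..<M}). tpair (\<lambda>j. g j (m j)))"
    unfolding tpair_def by (rule Bochner_Integration.integral_sum) (rule tpair_integrable[OF g])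
  finally show ?thesis .
qed

lemma tpair_split:
  assumes \<psi>: "test_family \<psi>" and \<phi>: "smooth1 \<phi>"
  shows "tpair \<psi> = tpair (\<psi>(j := \<lambda>t. \<phi> t * \<psi> j t)) + tpair (\<psi>(j := \<lambda>t. (1 - \<phi> t) * \<psi> j t))"
proof -
  obtain R where R: "\<And>j. test_function1 (\<psi> j) R" using \<psi> by (rule test_familyD) (rule that)
  have s: "smooth1 (\<lambda>t. 1 - \<phi> t)" by (intro smooth1_diff smooth1_const \<phi>)
  note f1 = test_family_upd[OF \<psi> \<phi>, of j] and f2 = test_family_upd[OF \<psi> s, of j]
  have i: "integrable lborel (\<lambda>t. exp (- \<i> * z * of_real t) * (g t * \<psi> j t))" if "smooth1 g" for z g
  proof -
    interpret J: test_function1 "\<lambda>t. g t * \<psi> j t" R by (rule test_function1_mult[OF that R])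
    show ?thesis by (rule fourier_laplace_integrable[OF J.sm]) (rule J.supp)
  qed
  have "fourier_laplace (\<psi> j) z = fourier_laplace (\<lambda>t. \<phi> t * \<psi> j t) z + fourier_laplace (\<lambda>t. (1 - \<phi> t) * \<psi> j t) z" for z
    unfolding fourier_laplace_def by (subst Bochner_Integration.integral_add[OF i[OF \<phi>] i[OF s], symmetric]) (simp add: algebra_simps)
  then have "(\<Prod>i\<in>UNIV. fourier_laplace (\<psi> i) (of_real (x $ i))) = (\<Prod>i\<in>UNIV. fourier_laplace ((\<psi>(j := \<lambda>t. \<phi> t * \<psi> j t)) i) (of_real (x $ i)))
       + (\<Prod>i\<in>UNIV. fourier_laplace ((\<psi>(j := \<lambda>t. (1 - \<phi> t) * \<psi> j t)) i) (of_real (x $ i)))" for x :: "real^'n"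
    by (simp add: prod.remove[of UNIV j] distrib_right)
  then show ?thesis
    unfolding tpair_def
    by (subst Bochner_Integration.integral_add[OF tpair_integrable[OF f1] tpair_integrable[OF f2], symmetric]) (simp add: distrib_left)
qed

text \<open>The multiplication formula for the Fourier transform; it serves the case in which the
  spectrum is defined by the transform itself.\<close>

lemma tpair_fourier_integral:
  assumes int: "integrable lborel f" and \<psi>: "test_family \<psi>"
  shows "tpair \<psi> = (LINT t|lborel. tprod \<psi> t * fourier f t)"
proof -
  obtain R where R: "\<And>j. test_function1 (\<psi> j) R" using \<psi> by (rule test_familyD) (rule that)
  have [measurable]: "\<psi> j \<in> borel_measurable borel" for j by (rule test_function1.borel_measurable[OF R])
  have [measurable]: "tprod \<psi> \<in> borel_measurable borel" unfolding tprod_def[abs_def] by measurable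
  have ti: "integrable lborel (tprod \<psi>)"
    unfolding tprod_def[abs_def] by (rule integrable_prod_vec) (rule test_function1.integrable[OF R])
  let ?k = "\<lambda>x t. exp (- \<i> * complex_of_real (x \<bullet> t)) * (f x * tprod \<psi> t)"
  have nk: "norm (?k x t) = norm (f x) * norm (tprod \<psi> t)" for x t
    by (simp add: norm_mult norm_exp_eq_Re)
  have k: "integrable (lborel \<Otimes>\<^sub>M lborel) (case_prod ?k)"
  proof (rule lborel_pair.Fubini_integrable)
    show "case_prod ?k \<in> borel_measurable (lborel \<Otimes>\<^sub>M lborel)" by measurable
    have "integrable lborel (\<lambda>x. norm (f x) * (LINT t|lborel. norm (tprod \<psi> t)))"
      by (intro integrable_mult_left integrable_norm int)
    then show "integrable lborel (\<lambda>x. LINT t|lborel. norm (case (x, t) of (x, t) \<Rightarrow> ?k x t))"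
      by (simp only: split_conv nk integral_mult_right_zero)
    have "integrable lborel (\<lambda>t. ?k x t)" for x
    proof (rule Bochner_Integration.integrable_bound)
      show "integrable lborel (\<lambda>t. norm (f x) * norm (tprod \<psi> t))" by (intro integrable_mult_right integrable_norm ti)
      show "AE t in lborel. norm (?k x t) \<le> norm (norm (f x) * norm (tprod \<psi> t))" unfolding nk by simp
    qed measurable
    then show "AE x in lborel. integrable lborel (\<lambda>t. case (x, t) of (x, t) \<Rightarrow> ?k x t)" by simp
  qed
  have "tpair \<psi> = (LINT x|lborel. f x * fourier (tprod \<psi>) x)"
    unfolding tpair_def fourier_tprod[OF \<psi>] ..
  also have "\<dots> = (LINT x|lborel. LINT t|lborel. ?k x t)"
  proof (rule Bochner_Integration.integral_cong[OF refl])
    fix x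
    have "fourier (tprod \<psi>) x = (LINT t|lborel. exp (- \<i> * complex_of_real (t \<bullet> x)) * tprod \<psi> t)"
      unfolding fourier_def by (rule integral_completion) measurable
    then have "f x * fourier (tprod \<psi>) x = (LINT t|lborel. f x * (exp (- \<i> * complex_of_real (t \<bullet> x)) * tprod \<psi> t))"
      by simp
    then show "f x * fourier (tprod \<psi>) x = (LINT t|lborel. ?k x t)" by (simp add: inner_commute mult.left_commute)
  qed
  also have "\<dots> = (LINT t|lborel. LINT x|lborel. ?k x t)"
    by (rule lborel_pair.Fubini_integral[OF k, symmetric])
  also have "\<dots> = (LINT t|lborel. tprod \<psi> t * fourier f t)"
  proof (rule Bochner_Integration.integral_cong[OF refl])
    fix t
    have "fourier f t = (LINT x|lborel. exp (- \<i> * complex_of_real (x \<bullet> t)) * f x)"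
      unfolding fourier_def by (rule integral_completion) measurable
    then have "tprod \<psi> t * fourier f t = (LINT x|lborel. tprod \<psi> t * (exp (- \<i> * complex_of_real (x \<bullet> t)) * f x))"
      by simp
    then show "(LINT x|lborel. ?k x t) = tprod \<psi> t * fourier f t" by (simp add: mult_ac)
  qed
  finally show ?thesis .
qed

end

lemma tprod_nonzeroD: "tprod \<psi> t \<noteq> 0 \<Longrightarrow> \<psi> j (t $ j) \<noteq> 0"
  by (auto simp: tprod_def)

text \<open>Differences of consecutive translates of a step telescope to 1. With translates
  \<open>h = \<delta> / 2\<close> apart each difference lives on two steps, that is, on an interval
  of length \<open>\<delta>\<close>.\<close>

lemma smooth_partition:
  assumes \<delta>: "0 < \<delta>" and R: "0 \<le> R"
  obtains b :: "nat \<Rightarrow> real \<Rightarrow> complex" and M :: nat and c :: "nat \<Rightarrow> real" where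
    "\<forall>m. smooth1 (b m)" "\<forall>t. \<bar>t\<bar> \<le> R \<longrightarrow> (\<Sum>m<M. b m t) = 1"
    "\<forall>m t. b m t \<noteq> 0 \<longrightarrow> t \<in> {c m..c m + \<delta>}"
proof -
  obtain s :: "real \<Rightarrow> complex" where s: "smooth1 s" "\<And>t. t \<le> 0 \<Longrightarrow> s t = 0" "\<And>t. 1 \<le> t \<Longrightarrow> s t = 1"
    using smooth_step by blast
  define h where "h = \<delta> / 2"
  have h: "0 < h" "2 * h = \<delta>" using \<delta> by (simp_all add: h_def)
  \<comment> \<open>One more step than covers the radius: then 1 <= \<open>y t\<close> <= 2k for
    \<open>\<bar>t\<bar> \<le> R\<close>, where the telescoped sum s(y) - s(y - 2k) equals
    1.\<close>
  define k where "k = nat \<lceil>R / h\<rceil> + 1"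
  have k: "R / h + 1 \<le> real k" unfolding k_def using R h by (simp add: le_nat_iff)
  define y where "y t = (1 / h) * t + real k" for t
  define b where "b m t = s ((1 / h) * t + (real k - real m)) - s ((1 / h) * t + (real k - real m - 1))" for m t
  have b: "b m t = s (y t - real m) - s (y t - real (Suc m))" for m t
    by (simp add: b_def y_def algebra_simps)
  have "smooth1 (b m)" for m
    unfolding b_def[abs_def] by (intro smooth1_diff smooth1_affine s)
  moreover have "(\<Sum>m<2 * k. b m t) = 1" if t: "\<bar>t\<bar> \<le> R" for t
  proof -
    have "(\<Sum>m<2 * k. b m t) = s (y t - real 0) - s (y t - real (2 * k))"
      unfolding b by (rule sum_lessThan_telescope')
    moreover have "1 \<le> y t \<and> y t \<le> 2 * real k"
    proof -
      have "\<bar>(1 / h) * t\<bar> \<le> R / h" using t h by (simp add: abs_mult divide_right_mono)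
      then have "- (R / h) \<le> (1 / h) * t" "(1 / h) * t \<le> R / h" by (simp_all only: abs_le_iff minus_le_iff)
      then show ?thesis unfolding y_def using k by linarith
    qed
    ultimately show ?thesis using s(3)[of "y t"] s(2)[of "y t - real (2 * k)"] by simp
  qed
  moreover have "t \<in> {h * (real m - real k)..h * (real m - real k) + \<delta>}" if nz: "b m t \<noteq> 0" for m t
  proof -
    have "\<not> y t - real m \<le> 0"
    proof
      assume "y t - real m \<le> 0"
      then have "b m t = 0" unfolding b using s(2)[of "y t - real m"] s(2)[of "y t - real (Suc m)"] by simp
      then show False using nz by simp
    qed
    moreover have "\<not> 1 \<le> y t - real (Suc m)"
    proof
      assume "1 \<le> y t - real (Suc m)"
      then have "b m t = 0" unfolding b using s(3)[of "y t - real m"] s(3)[of "y t - real (Suc m)"] by simp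
      then show False using nz by simp
    qed
    ultimately have "real m \<le> y t" "y t \<le> real m + 2" by simp_all
    then have "h * real m \<le> h * y t" "h * y t \<le> h * (real m + 2)" using h by (auto intro: mult_left_mono)
    moreover have "h * y t = t + h * real k" using h by (simp add: y_def distrib_left)
    ultimately show ?thesis using h(2) by (simp add: algebra_simps)
  qed
  ultimately show ?thesis
    by (intro that[of b "2 * k" "\<lambda>m. h * (real m - real k)"]) simp_all
qed

section \<open>Vanishing of the pairing off the box\<close>

text \<open>\<open>f0\<close> is the given function and \<open>f\<close> its Borel modification: the
  spectrum belongs to \<open>f0\<close>, the integrals are computed with \<open>f\<close>.\<close>

locale spectral = Lp_function f p for f :: "real^'n \<Rightarrow> complex" and p +
  fixes \<sigma> :: "real^'n" and f0 :: "real^'n \<Rightarrow> complex"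
  assumes \<sigma>: "\<And>j. 0 < \<sigma> $ j" and f0_meas: "f0 \<in> borel_measurable lebesgue"
    and f0: "AE x in lborel. f0 x = f x" and spec: "spectrum f0 \<subseteq> box_Q \<sigma>"
begin

lemma f0': "AE x in lebesgue. f0 x = f x"
  using f0 by (rule AE_completion)

lemma f_meas_lebesgue: "f \<in> borel_measurable lebesgue"
  by (rule measurable_completion) (simp add: f_meas)

lemma fourier_f0: "fourier f0 = fourier f"
proof
  fix t :: "real^'n"
  have e: "(\<lambda>x. exp (- \<i> * complex_of_real (x \<bullet> t))) \<in> borel_measurable lebesgue"
    by (rule measurable_completion) measurable
  show "fourier f0 t = fourier f t"
    unfolding fourier_def
    by (rule integral_cong_AE[OF borel_measurable_times[OF e f0_meas] borel_measurable_times[OF e f_meas_lebesgue]])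
       (use f0' in \<open>auto elim: eventually_mono\<close>)
qed

lemma integrable_f0: "integrable lebesgue f0 \<longleftrightarrow> integrable lborel f"
  using integrable_cong_AE[OF f0_meas f_meas_lebesgue f0'] integrable_completion[of f lborel] f_meas by simp

lemma fourier_distribution_tprod:
  assumes "test_family \<psi>"
  shows "fourier_distribution f0 (tprod \<psi>) = tpair \<psi>"
proof -
  let ?g = "\<lambda>x. \<Prod>j\<in>UNIV. fourier_laplace (\<psi> j) (of_real (x $ j))"
  have m: "(\<lambda>x. f x * ?g x) \<in> borel_measurable lborel"
    by (rule borel_measurable_integrable[OF tpair_integrable[OF assms]])
  have gm: "?g \<in> borel_measurable borel"
  proof -
    obtain R where R: "\<And>j. test_function1 (\<psi> j) R" using assms by (rule test_familyD) (rule that)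
    note [measurable] = test_function1.fourier_laplace_measurable[OF R]
    show ?thesis by measurable
  qed
  then have gm': "?g \<in> borel_measurable lebesgue" by (intro measurable_completion) simp
  have "fourier_distribution f0 (tprod \<psi>) = (LINT x|lebesgue. f0 x * ?g x)"
    unfolding fourier_distribution_def fourier_tprod[OF assms] ..
  also have "\<dots> = (LINT x|lebesgue. f x * ?g x)"
    by (rule integral_cong_AE) (use f0' in \<open>auto intro!: borel_measurable_times gm' f0_meas f_meas_lebesgue elim: eventually_mono\<close>)
  also have "\<dots> = tpair \<psi>"
    unfolding tpair_def by (rule integral_completion[OF m])
  finally show ?thesis .
qed

lemma tpair_vanish_local:
  assumes \<psi>: "test_family \<psi>" and U: "\<And>\<phi>. \<phi> \<in> test_functions U \<Longrightarrow> fourier_distribution f0 \<phi> = 0"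
    and C: "closed C" "bounded C" "C \<subseteq> U" and nz: "\<And>t. tprod \<psi> t \<noteq> 0 \<Longrightarrow> t \<in> C"
  shows "tpair \<psi> = 0"
proof -
  obtain R where R: "\<And>j. test_function1 (\<psi> j) R" using \<psi> by (rule test_familyD) (rule that)
  have sub: "topological_support (tprod \<psi>) \<subseteq> C"
    unfolding topological_support_def by (rule closure_minimal) (use nz C in auto)
  have "compact (topological_support (tprod \<psi>))"
    unfolding compact_eq_bounded_closed using bounded_subset[OF C(2) sub]
    by (simp add: topological_support_def)
  moreover have "smooth (tprod \<psi>)"
    by (rule smooth_tprod) (rule test_function1.sm[OF R])
  ultimately have "tprod \<psi> \<in> test_functions U"
    unfolding test_functions_def using sub C(3) by blast
  from U[OF this] show ?thesis using fourier_distribution_tprod[OF \<psi>] by simp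
qed

text \<open>For an integrable function the transform itself vanishes wherever the tensor product
  does not. Otherwise the complement of the box is only known to be a union of open sets on each of
  which the distribution vanishes. A partition of unity cuts the tensor product into tensor products
  so small that each one fits into a single set of the cover.\<close>

lemma tpair_vanish:
  assumes \<psi>: "test_family \<psi>" and \<delta>: "0 < \<delta>" and off: "\<And>t. \<bar>t\<bar> < \<sigma> $ i + \<delta> \<Longrightarrow> \<psi> i t = 0"
  shows "tpair \<psi> = 0"
proof (cases "integrable lebesgue f0")
  case True
  have "tprod \<psi> t * fourier f t = 0" for t
  proof (cases "tprod \<psi> t = 0")
    case False
    then have "\<psi> i (t $ i) \<noteq> 0" by (rule tprod_nonzeroD)
    then have "\<not> \<bar>t $ i\<bar> < \<sigma> $ i + \<delta>" using off by blast
    then have "\<not> \<bar>t $ i\<bar> \<le> \<sigma> $ i" using \<delta> by simp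
    then have "t \<notin> box_Q \<sigma>" unfolding box_Q_def by blast
    then have "t \<notin> topological_support (fourier f)"
      using spec True by (auto simp: spectrum_def fourier_f0)
    then have "fourier f t = 0"
      unfolding topological_support_def using closure_subset[of "{x. fourier f x \<noteq> 0}"] by auto
    then show ?thesis by simp
  qed simp
  then have "(\<lambda>t. tprod \<psi> t * fourier f t) = (\<lambda>t. 0)" by (rule ext)
  then show ?thesis using tpair_fourier_integral[OF _ \<psi>] True integrable_f0 by simp
next
  case False
  obtain R where R: "\<And>j. test_function1 (\<psi> j) R" using \<psi> by (rule test_familyD) (rule that)
  have R0: "0 \<le> R" using test_function1.R[OF R] .
  \<comment> \<open>A compact set that contains every point where the tensor product is nonzero;
    \<open>\<delta>\<close> keeps it away from the box.\<close>
  define K where "K = cbox (- (R *\<^sub>R 1)) (R *\<^sub>R 1) \<inter> {t::real^'n. \<sigma> $ i + \<delta> \<le> \<bar>t $ i\<bar>}"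
  define \<U> where "\<U> = {U. open U \<and> (\<forall>\<phi>\<in>test_functions U. fourier_distribution f0 \<phi> = 0)}"
  have "closed {t::real^'n. \<sigma> $ i + \<delta> \<le> \<bar>t $ i\<bar>}"
    by (intro closed_Collect_le continuous_intros)
  then have cK: "compact K" unfolding K_def by (intro compact_Int_closed compact_cbox)
  have "K \<inter> box_Q \<sigma> = {}"
  proof -
    have "t \<notin> box_Q \<sigma>" if "t \<in> K" for t
    proof -
      have "\<not> \<bar>t $ i\<bar> \<le> \<sigma> $ i" using that \<delta> by (simp add: K_def)
      then show ?thesis unfolding box_Q_def by blast
    qed
    then show ?thesis by blast
  qed
  moreover have "- \<Union>\<U> \<subseteq> box_Q \<sigma>"
    using spec False unfolding spectrum_def distribution_support_def \<U>_def by simp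
  ultimately have KU: "K \<subseteq> \<Union>\<U>" by blast
  obtain e where e: "0 < e" "\<And>x. x \<in> K \<Longrightarrow> \<exists>U\<in>\<U>. ball x e \<subseteq> U"
    by (rule Heine_Borel_lemma[OF cK KU]) (auto simp: \<U>_def)
  \<comment> \<open>\<open>e\<close> acts as a Lebesgue number of the cover. Two points of a cube of
    side \<open>h\<close> are at distance at most \<open>CARD('n) * h\<close>, the bound by the sum
    of the coordinates, and this is \<open>e / 2\<close>.\<close>
  define h where "h = e / (2 * real CARD('n))"
  have h: "0 < h" "real CARD('n) * h < e" using e(1) by (simp_all add: h_def)
  obtain b and M :: nat and c where b': "\<forall>m. smooth1 (b m)" "\<forall>t. \<bar>t\<bar> \<le> R \<longrightarrow> (\<Sum>m<M. b m t) = (1::complex)"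
    "\<forall>m t. b m t \<noteq> 0 \<longrightarrow> t \<in> {c m..c m + h}"
    by (rule smooth_partition[OF h(1) R0]) (rule that)
  note b = b'[rule_format]
  define g where "g j m t = b m t * \<psi> j t" for j m t
  have fam: "test_family (\<lambda>j. g j (m j))" for m
    unfolding g_def by (rule test_familyI[where R="\<lambda>_. R"]) (rule test_function1_mult[OF b(1) R])
  have "(\<Sum>m<M. g j m t) = \<psi> j t" for j t
  proof (cases "\<bar>t\<bar> \<le> R")
    case True
    then show ?thesis using b(2)[OF True] by (simp add: g_def flip: sum_distrib_right)
  next
    case False
    then have "\<psi> j t = 0" by (intro test_function1.supp[OF R]) simp
    then show ?thesis by (simp add: g_def)
  qed
  then have "(\<lambda>j t. \<Sum>m<M. g j m t) = \<psi>" by (intro ext)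
  moreover have "tpair (\<lambda>j. g j (m j)) = 0" for m
  proof (cases "\<exists>x. tprod (\<lambda>j. g j (m j)) x \<noteq> 0")
    case False
    then have "tprod (\<lambda>j. g j (m j)) = (\<lambda>x. 0)" by (intro ext) simp
    then have "fourier_distribution f0 (tprod (\<lambda>j. g j (m j))) = 0"
      by (simp add: fourier_distribution_def fourier_def)
    then show ?thesis using fourier_distribution_tprod[OF fam] by simp
  next
    case True
    define C where "C = cbox (\<chi> j. c (m j)) (\<chi> j. c (m j) + h)"
    have nz: "t \<in> C \<and> t \<in> K" if t: "tprod (\<lambda>j. g j (m j)) t \<noteq> 0" for t
    proof -
      have gj: "b (m j) (t $ j) \<noteq> 0" "\<psi> j (t $ j) \<noteq> 0" for j
        using tprod_nonzeroD[OF t, of j] by (auto simp: g_def)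
      have "t \<in> C" unfolding C_def mem_box_cart using b(3)[OF gj(1)] by simp
      moreover have "\<not> R \<le> \<bar>t $ j\<bar>" for j using gj(2)[of j] test_function1.supp[OF R[of j]] by blast
      then have lt: "\<bar>t $ j\<bar> < R" for j by (simp only: not_le)
      have "- R \<le> t $ j \<and> t $ j \<le> R" for j using lt[of j] by (auto simp: abs_less_iff)
      then have "t \<in> cbox (- (R *\<^sub>R 1)) (R *\<^sub>R 1)" unfolding mem_box_cart by simp
      moreover have "\<not> \<bar>t $ i\<bar> < \<sigma> $ i + \<delta>" using gj(2)[of i] off by blast
      ultimately show ?thesis unfolding K_def by simp
    qed
    \<comment> \<open>The ball that fits into one set of the cover has to be centred in
      \<open>K\<close>, hence the choice of a point where the piece is nonzero.\<close>
    obtain x where x: "tprod (\<lambda>j. g j (m j)) x \<noteq> 0" using True by (rule exE)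
    obtain U where U: "U \<in> \<U>" "ball x e \<subseteq> U" using e(2)[OF conjunct2[OF nz[OF x]]] by (rule bexE)
    have "C \<subseteq> ball x e"
    proof
      fix y assume y: "y \<in> C"
      have "x \<in> C" using nz[OF x] by simp
      then have "\<bar>(y - x) $ j\<bar> \<le> h" for j
        using y unfolding C_def mem_box_cart vector_minus_component vec_lambda_beta abs_le_iff by (smt (verit))
      then have "(\<Sum>j\<in>UNIV. \<bar>(y - x) $ j\<bar>) \<le> real CARD('n) * h"
        using sum_bounded_above[of UNIV "\<lambda>j. \<bar>(y - x) $ j\<bar>" h] by simp
      then have "norm (y - x) < e" using norm_le_l1_cart[of "y - x"] h(2) by simp
      then show "y \<in> ball x e" by (simp add: dist_norm norm_minus_commute)
    qed
    show ?thesis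
    proof (rule tpair_vanish_local[where U=U and C=C, OF fam])
      show "fourier_distribution f0 \<phi> = 0" if "\<phi> \<in> test_functions U" for \<phi>
        using U(1) that unfolding \<U>_def by blast
      show "closed C" "bounded C" unfolding C_def by auto
      show "C \<subseteq> U" using \<open>C \<subseteq> ball x e\<close> U(2) by (rule order_trans)
      show "t \<in> C" if "tprod (\<lambda>j. g j (m j)) t \<noteq> 0" for t using nz[OF that] by simp
    qed
  qed
  ultimately show ?thesis using tpair_sum[where g=g and M=M, OF fam] by simp
qed

text \<open>One coordinate is cut off at a time. The difference is a tensor product whose
  \<open>j\<close>-th factor contains \<open>1 - \<phi> j\<close> and so vanishes near the interval
  of coordinate \<open>j\<close>, where \<open>tpair_vanish\<close> applies.\<close>

lemma tpair_cutoff: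
  assumes \<psi>: "test_family \<psi>" and \<phi>: "\<And>j. smooth1 (\<phi> j)" and \<delta>: "0 < \<delta>"
    and one: "\<And>j t. \<bar>t\<bar> < \<sigma> $ j + \<delta> \<Longrightarrow> \<phi> j t = 1"
  shows "tpair \<psi> = tpair (\<lambda>j t. \<phi> j t * \<psi> j t)"
proof -
  define \<psi>' where "\<psi>' J j = (if j \<in> J then \<lambda>t. \<phi> j t * \<psi> j t else \<psi> j)" for J j
  have fam: "test_family (\<psi>' J)" for J
  proof -
    obtain R where R: "\<And>j. test_function1 (\<psi> j) R" using \<psi> by (rule test_familyD) (rule that)
    show ?thesis
      by (rule test_familyI[where R="\<lambda>_. R"]) (simp add: \<psi>'_def R test_function1_mult[OF \<phi> R])
  qed
  have "tpair \<psi> = tpair (\<psi>' J)" if "finite J" for J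
    using that
  proof induction
    case empty
    have "\<psi>' {} = \<psi>" by (simp add: \<psi>'_def fun_eq_iff)
    then show ?case by simp
  next
    case (insert j J)
    have s: "smooth1 (\<lambda>t. 1 - \<phi> j t)" by (intro smooth1_diff smooth1_const \<phi>)
    have "tpair ((\<psi>' J)(j := \<lambda>t. (1 - \<phi> j t) * \<psi>' J j t)) = 0"
      by (rule tpair_vanish[where i=j, OF test_family_upd[OF fam s] \<delta>]) (simp add: one)
    moreover have "(\<psi>' J)(j := \<lambda>t. \<phi> j t * \<psi>' J j t) = \<psi>' (insert j J)"
      using insert.hyps(2) by (auto simp: \<psi>'_def fun_eq_iff)
    ultimately have "tpair (\<psi>' J) = tpair (\<psi>' (insert j J))"
      using tpair_split[OF fam \<phi>, of J j j] by simp
    then show ?case using insert.IH by simp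
  qed
  moreover have "\<psi>' UNIV = (\<lambda>j t. \<phi> j t * \<psi> j t)" by (simp add: \<psi>'_def fun_eq_iff)
  ultimately show ?thesis using finite by metis
qed

end

section \<open>Reproducing representation and the main theorem\<close>

text \<open>Boxes form an intersection-stable generator of the Borel sets, so the integrals over all
  Borel sets vanish by induction over the generated sigma-algebra. Since \<open>h\<close> is only
  integrable over boxes, this is done inside each \<open>C n\<close>.\<close>

lemma AE_zero_if_box_integrals_zero:
  fixes h :: "real^'n \<Rightarrow> complex"
  assumes int: "\<And>a b. integrable lborel (\<lambda>x. indicator (box a b) x *\<^sub>R h x)"
    and zero: "\<And>a b. (LINT x|lborel. indicator (box a b) x *\<^sub>R h x) = 0"
  shows "AE x in lborel. h x = 0"
proof -
  define C where "C n = box (- (real n *\<^sub>R One)) (real n *\<^sub>R One :: real^'n)" for n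
  have "AE x in lborel. indicator (C n) x *\<^sub>R h x = 0" for n
  proof (rule sigma_finite_measure.density_zero[OF sigma_finite_lborel])
    let ?g = "\<lambda>x. indicator (C n) x *\<^sub>R h x"
    show gi: "integrable lborel ?g" unfolding C_def by (rule int)
    fix A :: "(real^'n) set" assume A: "A \<in> sets lborel"
    let ?E = "range (\<lambda>(a, b). box a b :: (real^'n) set)"
    have st: "Int_stable ?E" by (auto simp: Int_stable_def box_Int_box)
    have As: "A \<in> sigma_sets UNIV ?E" using A by (simp add: borel_eq_box)
    have bo: "B \<in> sets lborel" if "B \<in> sigma_sets UNIV ?E" for B using that by (simp add: borel_eq_box)
    have si: "set_integrable lborel B ?g" if "B \<in> sets lborel" for B
      unfolding set_integrable_def by (rule integrable_mult_indicator[OF that gi])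
    show "set_lebesgue_integral lborel A ?g = 0"
      using st _ As
    proof (rule sigma_sets_induct_disjoint)
      show "?E \<subseteq> Pow UNIV" by simp
      show "set_lebesgue_integral lborel {} ?g = 0" by (simp add: set_lebesgue_integral_def)
    next
      fix B assume "B \<in> ?E"
      then obtain a b where B: "B = box a b" by auto
      obtain c d where cd: "box a b \<inter> C n = box c d" unfolding C_def box_Int_box by blast
      have "indicator B x *\<^sub>R ?g x = indicator (box c d) x *\<^sub>R h x" for x
        unfolding cd[symmetric] B by (simp add: indicator_def)
      then show "set_lebesgue_integral lborel B ?g = 0"
        unfolding set_lebesgue_integral_def by (simp only: zero[of c d])
    next
      fix B assume B: "B \<in> sigma_sets UNIV ?E" "set_lebesgue_integral lborel B ?g = 0"
      have "(LINT x|lborel. ?g x) = set_lebesgue_integral lborel B ?g + set_lebesgue_integral lborel (UNIV - B) ?g"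
      proof -
        have "(LINT x|lborel. ?g x) = set_lebesgue_integral lborel (B \<union> (UNIV - B)) ?g"
          by (simp add: set_lebesgue_integral_def)
        also have "\<dots> = set_lebesgue_integral lborel B ?g + set_lebesgue_integral lborel (UNIV - B) ?g"
          by (rule set_integral_Un) (use si bo[OF B(1)] in auto)
        finally show ?thesis .
      qed
      moreover have "(LINT x|lborel. ?g x) = 0" unfolding C_def by (rule zero)
      ultimately show "set_lebesgue_integral lborel (UNIV - B) ?g = 0" using B(2) by simp
    next
      fix B :: "nat \<Rightarrow> (real^'n) set"
      assume B: "disjoint_family B" "range B \<subseteq> sigma_sets UNIV ?E" "\<And>i. set_lebesgue_integral lborel (B i) ?g = 0"
      have Bs: "B i \<in> sets lborel" for i using B(2) by (intro bo) auto
      have "set_lebesgue_integral lborel (\<Union>i. B i) ?g = (\<Sum>i. set_lebesgue_integral lborel (B i) ?g)"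
        by (rule lebesgue_integral_countable_add) (use B(1) Bs si in \<open>auto simp: disjoint_family_on_def\<close>)
      then show "set_lebesgue_integral lborel (\<Union>i. B i) ?g = 0" by (simp add: B(3))
    qed
  qed
  then have "AE x in lborel. \<forall>n. indicator (C n) x *\<^sub>R h x = 0" unfolding AE_all_countable by blast
  then show ?thesis
  proof eventually_elim
    case (elim x)
    have "x \<in> (\<Union>n. C n)" unfolding C_def UN_box_eq_UNIV by simp
    then obtain n where "x \<in> C n" by blast
    then show ?case using elim[rule_format, of n] by simp
  qed
qed

lemma AE_coordinate_neq: "AE x in lborel. (x::real^'n) $ j \<noteq> c"
proof -
  have "{x::real^'n. x $ j = c} \<in> null_sets lebesgue"
    using negligible_standard_hyperplane[of "axis j 1 :: real^'n" c] by (simp add: negligible_iff_null_sets inner_axis)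
  then have "AE x in lebesgue. x \<notin> {x::real^'n. x $ j = c}" by (rule AE_not_in)
  then show ?thesis by (simp add: AE_completion_iff)
qed

lemma test_function1_mult':
  assumes "test_function1 h R" "smooth1 g"
  shows "test_function1 (\<lambda>t. h t * g t) R"
  using test_function1_mult[OF assms(2,1)] by (simp add: mult.commute)

lemma indicator_box_prod: "(\<Prod>j\<in>UNIV. indicator {a $ j<..<b $ j} (x $ j)) = (indicator (box a b) (x::real^'n) :: complex)"
proof (cases "x \<in> box a b")
  case True
  then show ?thesis by (simp add: mem_box_cart)
next
  case False
  then obtain j where "x $ j \<notin> {a $ j<..<b $ j}" by (auto simp: mem_box_cart)
  then have "(\<Prod>j\<in>UNIV. indicator {a $ j<..<b $ j} (x $ j)) = (0::complex)"
    by (intro prod_zero bexI[of _ j]) auto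
  then show ?thesis using False by simp
qed

context spectral
begin

lemma tpair_box_limit:
  assumes "test_function1 \<eta> R" and \<eta>0: "\<eta> 0 = 1" and ab: "\<And>j. a $ j \<le> b $ j"
  shows "(\<lambda>n. tpair (\<lambda>j t. \<eta> ((1 / real (Suc n)) * t + 0) * theta (a $ j) (b $ j) t))
     \<longlonglongrightarrow> (LINT x|lborel. f x * ((2 * pi) ^ CARD('n) * indicator (box a b) x))"
proof -
  interpret X: test_function1 \<eta> R by (rule assms)
  have "\<exists>K. 0 \<le> K \<and> (\<forall>n x. norm (X.box_kernel (a $ j) (b $ j) n x) \<le> K * wt x)" for j
    by (rule X.box_kernel_bound[OF ab[of j]]) blast
  then have "\<exists>K. \<forall>j. 0 \<le> K j \<and> (\<forall>n x. norm (X.box_kernel (a $ j) (b $ j) n x) \<le> K j * wt x)"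
    by (intro choice allI)
  then obtain K where K: "\<forall>j. 0 \<le> K j \<and> (\<forall>n x. norm (X.box_kernel (a $ j) (b $ j) n x) \<le> K j * wt x)" by (rule exE)
  have fam: "test_family (\<lambda>j t. \<eta> ((1 / real (Suc n)) * t + 0) * theta (a $ j) (b $ j) t)" for n
    by (rule test_familyI[where R="\<lambda>_. real (Suc n) * R"])
       (intro test_function1_mult' X.test_function1_scale theta_smooth ab, simp)
  have "(\<lambda>n. LINT x|lborel. f x * (\<Prod>j\<in>UNIV. X.box_kernel (a $ j) (b $ j) n (x $ j)))
     \<longlonglongrightarrow> (LINT x|lborel. f x * ((2 * pi) ^ CARD('n) * indicator (box a b) x))"
  proof (rule integral_dominated_convergence[where w="\<lambda>x. (\<Prod>j\<in>UNIV. K j) * (norm (f x) * wtn x)"])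
    have "integrable lborel (\<lambda>x. norm (f x) * wtn (0 - x))" by (rule integrable_wconv)
    then show "integrable lborel (\<lambda>x. (\<Prod>j\<in>UNIV. K j) * (norm (f x) * wtn x))"
      by (intro integrable_mult_right) (simp add: wtn_minus)
    show "(\<lambda>x. f x * (\<Prod>j\<in>UNIV. X.box_kernel (a $ j) (b $ j) n (x $ j))) \<in> borel_measurable lborel" for n
      using borel_measurable_integrable[OF tpair_integrable[OF fam[of n]]] by (simp only: X.box_kernel_def)
    show "(\<lambda>x. f x * ((2 * pi) ^ CARD('n) * indicator (box a b) x)) \<in> borel_measurable lborel" by measurable
    show "AE x in lborel. norm (f x * (\<Prod>j\<in>UNIV. X.box_kernel (a $ j) (b $ j) n (x $ j))) \<le> (\<Prod>j\<in>UNIV. K j) * (norm (f x) * wtn x)" for n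
    proof (intro always_eventually allI)
      fix x :: "real^'n"
      have "norm (\<Prod>j\<in>UNIV. X.box_kernel (a $ j) (b $ j) n (x $ j)) \<le> (\<Prod>j\<in>UNIV. K j * wt (x $ j))"
        unfolding prod_norm[symmetric] using K by (intro prod_mono) auto
      then have "norm (f x) * norm (\<Prod>j\<in>UNIV. X.box_kernel (a $ j) (b $ j) n (x $ j)) \<le> norm (f x) * (\<Prod>j\<in>UNIV. K j * wt (x $ j))"
        by (rule mult_left_mono) simp
      then show "norm (f x * (\<Prod>j\<in>UNIV. X.box_kernel (a $ j) (b $ j) n (x $ j))) \<le> (\<Prod>j\<in>UNIV. K j) * (norm (f x) * wtn x)"
        by (simp add: norm_mult prod.distrib wtn_def mult_ac)
    qed
    have "AE x in lborel. \<forall>j. (x::real^'n) $ j \<noteq> a $ j \<and> x $ j \<noteq> b $ j"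
      by (simp add: AE_all_countable AE_conj_iff AE_coordinate_neq)
    then show "AE x in lborel. (\<lambda>n. f x * (\<Prod>j\<in>UNIV. X.box_kernel (a $ j) (b $ j) n (x $ j))) \<longlonglongrightarrow> f x * ((2 * pi) ^ CARD('n) * indicator (box a b) x)"
    proof eventually_elim
      case (elim x)
      have "(\<lambda>n. f x * (\<Prod>j\<in>UNIV. X.box_kernel (a $ j) (b $ j) n (x $ j))) \<longlonglongrightarrow> f x * (\<Prod>j\<in>UNIV. indicator {a $ j<..<b $ j} (x $ j) * (2 * pi * \<eta> 0))"
        using elim ab by (intro tendsto_mult tendsto_const tendsto_prod X.box_kernel_limit) auto
      moreover have "(\<Prod>j\<in>UNIV. indicator {a $ j<..<b $ j} (x $ j) * (2 * pi * \<eta> 0)) = (2 * pi) ^ CARD('n) * indicator (box a b) x"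
        unfolding prod.distrib indicator_box_prod by (simp add: \<eta>0 mult.commute indicator_def)
      ultimately show ?case by (simp only:)
    qed
  qed
  then show ?thesis by (simp only: tpair_def X.box_kernel_def)
qed

text \<open>Fubini's theorem: each \<open>theta\<close> factor averages the translated transform
  over an interval. The kernel is reflected because the transform is taken at x - s, while
  \<open>kernel_prod\<close> evaluates at s - x.\<close>

lemma tpair_box_swap:
  assumes \<phi>: "\<And>j. test_function1 (\<phi> j) (R j)"
  shows "tpair (\<lambda>j t. \<phi> j t * theta (a $ j) (b $ j) t)
    = (LINT s|lborel. indicator (box a b) s *\<^sub>R kernel_integral f (\<lambda>j w. fourier_laplace (\<phi> j) (- w)) (complex_vec s))"
proof -
  define \<kappa> where "\<kappa> = (\<lambda>j w. fourier_laplace (\<phi> j) (- w))"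
  have gk: "exp_kernel (R j) (\<kappa> j)" for j
    unfolding \<kappa>_def by (intro exp_kernel_reflect test_function1.exp_kernel[OF \<phi>])
  obtain C where C: "0 \<le> C"
    "\<And>z x. norm (kernel_prod \<kappa> z x) \<le> C * exp (\<Sum>j\<in>UNIV. R j * \<bar>Im (z $ j)\<bar>) * wtn (re_vec z - x)"
    by (rule kernel_prod_bound[where R=R and \<kappa>=\<kappa>, OF gk]) (rule that)
  have Cr: "norm (kernel_prod \<kappa> (complex_vec s) x) \<le> C * wtn (s - x)" for s x
  proof -
    have "re_vec (complex_vec s) = s" by (simp add: re_vec_def complex_vec_def vec_eq_iff)
    moreover have "Im (complex_vec s $ j) = 0" for j by (simp add: complex_vec_def)
    ultimately show ?thesis using C(2)[of "complex_vec s" x] by simp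
  qed
  obtain N where N: "0 \<le> N" "\<And>x. wconv f x \<le> N" by (rule wconv_bounded) (rule that)
  note [measurable] = test_function1.fourier_laplace_measurable[OF \<phi>]
  have kp: "kernel_prod \<kappa> (complex_vec s) x = (\<Prod>j\<in>UNIV. fourier_laplace (\<phi> j) (of_real (x $ j - s $ j)))" for s x
    unfolding \<kappa>_def by (rule kernel_prod_fourier_laplace)
  have [measurable]: "(\<lambda>x::(real^'n) \<times> (real^'n). fst x $ j) \<in> borel_measurable (lborel \<Otimes>\<^sub>M lborel)"
    "(\<lambda>x::(real^'n) \<times> (real^'n). snd x $ j) \<in> borel_measurable (lborel \<Otimes>\<^sub>M lborel)"
    "(\<lambda>x::(real^'n) \<times> (real^'n). fst x $ j) \<in> borel_measurable (borel \<Otimes>\<^sub>M borel)"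
    "(\<lambda>x::(real^'n) \<times> (real^'n). snd x $ j) \<in> borel_measurable (borel \<Otimes>\<^sub>M borel)" for j
    by (rule measurable_compose[OF measurable_fst] measurable_compose[OF measurable_snd], measurable)+
  let ?k = "\<lambda>s x. indicator (box a b) s *\<^sub>R (f x * kernel_prod \<kappa> (complex_vec s) x)"
  have km: "case_prod ?k \<in> borel_measurable (lborel \<Otimes>\<^sub>M lborel)" unfolding kp by measurable
  have nk: "norm (?k s x) \<le> indicator (box a b) s * (C * (norm (f x) * wtn (s - x)))" for s x
    using mult_left_mono[OF Cr[of s x], of "norm (f x)"] by (simp add: norm_mult indicator_def mult_ac)
  have ki: "integrable lborel (\<lambda>x. ?k s x)" for s
    by (intro integrable_scaleR_right kernel_integral_integrable[where R=R and \<kappa>=\<kappa>, OF gk])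
  have k: "integrable (lborel \<Otimes>\<^sub>M lborel) (case_prod ?k)"
  proof (rule lborel_pair.Fubini_integrable[OF km])
    show "AE s in lborel. integrable lborel (\<lambda>x. case (s, x) of (s, x) \<Rightarrow> ?k s x)" using ki by simp
    have "integrable lborel (\<lambda>s. LINT x|lborel. norm (?k s x))"
    proof (rule Bochner_Integration.integrable_bound)
      show "integrable lborel (\<lambda>s. indicator (box a b) s * (C * N))"
        by (intro integrable_mult_left) (simp add: integrable_indicator_iff emeasure_bounded_finite[OF bounded_box, unfolded infinity_ennreal_def])
      show "(\<lambda>s. LINT x|lborel. norm (?k s x)) \<in> borel_measurable lborel"
        by (rule lborel.borel_measurable_lebesgue_integral) (use km in measurable)
      show "AE s in lborel. norm (LINT x|lborel. norm (?k s x)) \<le> norm (indicator (box a b) s * (C * N))"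
      proof (intro always_eventually allI)
        fix s
        have "(LINT x|lborel. norm (?k s x)) \<le> (LINT x|lborel. indicator (box a b) s * (C * (norm (f x) * wtn (s - x))))"
          by (intro integral_mono integrable_norm ki integrable_mult_right integrable_wconv nk)
        also have "\<dots> = indicator (box a b) s * (C * wconv f s)" by (simp add: wconv_def)
        also have "\<dots> \<le> indicator (box a b) s * (C * N)" using C(1) N(2) by (intro mult_left_mono) auto
        finally have "(LINT x|lborel. norm (?k s x)) \<le> indicator (box a b) s * (C * N)" .
        moreover have "0 \<le> (LINT x|lborel. norm (?k s x))" by (intro integral_nonneg_AE always_eventually) simp
        ultimately show "norm (LINT x|lborel. norm (?k s x)) \<le> norm (indicator (box a b) s * (C * N))" by simp
      qed
    qed
    then show "integrable lborel (\<lambda>s. LINT x|lborel. norm (case (s, x) of (s, x) \<Rightarrow> ?k s x))" by simp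
  qed
  have "tpair (\<lambda>j t. \<phi> j t * theta (a $ j) (b $ j) t) = (LINT x|lborel. LINT s|lborel. ?k s x)"
    unfolding tpair_def
  proof (rule Bochner_Integration.integral_cong[OF refl])
    fix x :: "real^'n"
    have i: "integrable lborel (\<lambda>s. indicator {a $ j<..<b $ j} s * fourier_laplace (\<phi> j) (of_real (x $ j - s)))" for j
    proof -
      obtain D where D: "0 \<le> D" "\<And>x. norm (fourier_laplace (\<phi> j) (of_real x)) \<le> D * wt x"
        by (rule test_function1.fourier_laplace_decay[OF \<phi>[of j]]) (rule that)
      have D': "norm (fourier_laplace (\<phi> j) (of_real y)) \<le> D" for y
        using order_trans[OF D(2)[of y] mult_left_mono[OF wt_le_1 D(1)]] by simp
      show ?thesis
      proof (rule Bochner_Integration.integrable_bound)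
        show "integrable lborel (\<lambda>s. D * indicator {a $ j<..<b $ j} s)" by (intro integrable_mult_right integrable_indicator_Ioo)
        show "AE s in lborel. norm (indicator {a $ j<..<b $ j} s * fourier_laplace (\<phi> j) (of_real (x $ j - s))) \<le> norm (D * indicator {a $ j<..<b $ j} s)"
          using D(1) D' by (intro always_eventually allI) (auto simp: norm_mult indicator_def simp del: of_real_diff)
      qed measurable
    qed
    have "(\<Prod>j\<in>UNIV. fourier_laplace (\<lambda>t. \<phi> j t * theta (a $ j) (b $ j) t) (of_real (x $ j)))
       = (\<Prod>j\<in>UNIV. (LINT s|lborel. indicator {a $ j<..<b $ j} s * fourier_laplace (\<phi> j) (of_real (x $ j - s))))"
      unfolding test_function1.fourier_laplace_times_theta[OF \<phi>] ..
    also have "\<dots> = (LINT s|lborel. (\<Prod>j\<in>UNIV. indicator {a $ j<..<b $ j} (s $ j) * fourier_laplace (\<phi> j) (of_real (x $ j - s $ j))))"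
      by (rule integral_prod_vec[OF i, symmetric])
    also have "\<dots> = (LINT s|lborel. indicator (box a b) s * kernel_prod \<kappa> (complex_vec s) x)"
      unfolding prod.distrib indicator_box_prod kp ..
    finally have "f x * (\<Prod>j\<in>UNIV. fourier_laplace (\<lambda>t. \<phi> j t * theta (a $ j) (b $ j) t) (of_real (x $ j)))
       = (LINT s|lborel. f x * (indicator (box a b) s * kernel_prod \<kappa> (complex_vec s) x))" by simp
    also have "\<dots> = (LINT s|lborel. ?k s x)"
      by (rule Bochner_Integration.integral_cong[OF refl]) (simp add: indicator_def)
    finally show "f x * (\<Prod>j\<in>UNIV. fourier_laplace (\<lambda>t. \<phi> j t * theta (a $ j) (b $ j) t) (of_real (x $ j))) = (LINT s|lborel. ?k s x)" .
  qed
  also have "\<dots> = (LINT s|lborel. LINT x|lborel. ?k s x)"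
    by (rule lborel_pair.Fubini_integral[OF k])
  also have "\<dots> = (LINT s|lborel. indicator (box a b) s *\<^sub>R kernel_integral f \<kappa> (complex_vec s))"
    by (simp add: kernel_integral_def)
  finally show ?thesis unfolding \<kappa>_def .
qed

text \<open>The pairing with the dilated cutoff times \<open>theta\<close> is computed twice. As
  \<open>n\<close> grows it tends to a multiple of the integral of \<open>f\<close> over the box.
  After insertion of \<open>\<phi>\<close>, which leaves the pairing unchanged, the dilated cutoff
  is 1 on the support of \<open>\<phi>\<close> for large \<open>n\<close>; so the sequence is
  eventually constant and equals the same multiple of the integral of the convolution.\<close>

lemma representation:
  assumes e: "0 < e"
  shows "\<exists>\<kappa>. (\<forall>j. exp_kernel (\<sigma> $ j + e) (\<kappa> j)) \<and> (AE x in lborel. kernel_integral f \<kappa> (complex_vec x) = f x)"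
proof -
  \<comment> \<open>The inner half of the margin \<open>e\<close> is the neighbourhood required by
    \<open>tpair_cutoff\<close>; the outer radius becomes the exponential type.\<close>
  have "\<exists>\<phi>. smooth1 \<phi> \<and> (\<forall>t. \<bar>t\<bar> \<le> \<sigma> $ j + e / 2 \<longrightarrow> \<phi> t = 1) \<and> (\<forall>t. \<sigma> $ j + e \<le> \<bar>t\<bar> \<longrightarrow> \<phi> t = 0)" for j
    by (rule smooth_cutoff[of "\<sigma> $ j + e / 2" "\<sigma> $ j + e"]) (use e in simp, blast)
  then have "\<exists>\<phi>. \<forall>j. smooth1 (\<phi> j) \<and> (\<forall>t. \<bar>t\<bar> \<le> \<sigma> $ j + e / 2 \<longrightarrow> \<phi> j t = 1) \<and> (\<forall>t. \<sigma> $ j + e \<le> \<bar>t\<bar> \<longrightarrow> \<phi> j t = 0)"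
    by (intro choice allI)
  then obtain \<phi> where \<phi>: "\<forall>j. smooth1 (\<phi> j) \<and> (\<forall>t. \<bar>t\<bar> \<le> \<sigma> $ j + e / 2 \<longrightarrow> \<phi> j t = 1) \<and> (\<forall>t. \<sigma> $ j + e \<le> \<bar>t\<bar> \<longrightarrow> \<phi> j t = 0)"
    by (rule exE)
  have \<phi>s: "smooth1 (\<phi> j)" and \<phi>1: "\<bar>t\<bar> \<le> \<sigma> $ j + e / 2 \<Longrightarrow> \<phi> j t = 1" and \<phi>0: "\<sigma> $ j + e \<le> \<bar>t\<bar> \<Longrightarrow> \<phi> j t = 0" for j t
    using \<phi> by auto
  have tf: "test_function1 (\<phi> j) (\<sigma> $ j + e)" for j
    using \<sigma>[of j] e by unfold_locales (simp, rule \<phi>s, erule \<phi>0)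
  obtain \<eta> :: "real \<Rightarrow> complex" where \<eta>: "smooth1 \<eta>" "\<And>t. \<bar>t\<bar> \<le> 1 \<Longrightarrow> \<eta> t = 1" "\<And>t. 2 \<le> \<bar>t\<bar> \<Longrightarrow> \<eta> t = 0"
    by (rule smooth_cutoff[of 1 2]) (simp, rule that)
  have tx: "test_function1 \<eta> 2" by unfold_locales (simp, rule \<eta>(1), erule \<eta>(3))
  define \<kappa>0 where "\<kappa>0 = (\<lambda>j w. fourier_laplace (\<phi> j) (- w))"
  \<comment> \<open>Division by 2 pi in each coordinate compensates for the constant of Fourier
    inversion.\<close>
  define \<kappa> where "\<kappa> = (\<lambda>j w. (1 / (2 * pi)) * \<kappa>0 j w)"
  have gk0: "exp_kernel (\<sigma> $ j + e) (\<kappa>0 j)" for j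
    unfolding \<kappa>0_def by (intro exp_kernel_reflect test_function1.exp_kernel[OF tf])
  have gk: "exp_kernel (\<sigma> $ j + e) (\<kappa> j)" for j
    unfolding \<kappa>_def by (rule exp_kernel_mult_left[OF gk0])
  have kk: "kernel_integral f \<kappa>0 z = (2 * pi) ^ CARD('n) * kernel_integral f \<kappa> z" for z
  proof -
    have "kernel_prod \<kappa>0 z x = (2 * pi) ^ CARD('n) * kernel_prod \<kappa> z x" for x
      unfolding kernel_prod_def \<kappa>_def prod.distrib by (simp add: power_one_over)
    then have "f x * kernel_prod \<kappa>0 z x = (2 * pi) ^ CARD('n) * (f x * kernel_prod \<kappa> z x)" for x by simp
    then show ?thesis unfolding kernel_integral_def by (simp only: integral_mult_right_zero)
  qed
  have R0: "0 \<le> \<sigma> $ j + e" for j using \<sigma>[of j] e by simp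
  define F where "F x = kernel_integral f \<kappa> (complex_vec x)" for x
  have Fc: "continuous_on UNIV F"
  proof -
    have c: "continuous_on UNIV (kernel_integral f \<kappa>)"
      by (intro continuous_at_imp_continuous_on ballI has_derivative_continuous)
         (rule kernel_integral_has_derivative[where R="\<lambda>j. \<sigma> $ j + e" and \<kappa>=\<kappa>, OF gk R0])
    have "continuous_on UNIV (complex_vec :: real^'n \<Rightarrow> complex^'n)"
      unfolding complex_vec_def by (intro continuous_intros)
    then show ?thesis unfolding F_def by (rule continuous_on_compose2[OF c]) simp
  qed
  have [measurable]: "F \<in> borel_measurable borel" using Fc by (rule borel_measurable_continuous_onI)
  obtain C where C: "0 \<le> C"
    "\<And>z. norm (kernel_integral f \<kappa> z) \<le> C * exp (\<Sum>j\<in>UNIV. (\<sigma> $ j + e) * \<bar>Im (z $ j)\<bar>) * wconv f (re_vec z)"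
    by (rule kernel_integral_bound[where R="\<lambda>j. \<sigma> $ j + e" and \<kappa>=\<kappa>, OF gk]) (rule that)
  obtain N where N: "0 \<le> N" "\<And>x. wconv f x \<le> N" by (rule wconv_bounded) (rule that)
  have FN: "norm (F x) \<le> C * N" for x
  proof -
    have "norm (F x) \<le> C * wconv f (re_vec (complex_vec x))"
      using C(2)[of "complex_vec x"] by (simp add: F_def complex_vec_def)
    also have "\<dots> \<le> C * N" using C(1) N(2) by (intro mult_left_mono) auto
    finally show ?thesis .
  qed
  have ib: "integrable lborel (indicator (box a b) :: real^'n \<Rightarrow> real)" for a b
    by (simp add: integrable_indicator_iff emeasure_bounded_finite[OF bounded_box, unfolded infinity_ennreal_def])
  have iF: "integrable lborel (\<lambda>x. indicator (box a b) x *\<^sub>R F x)" for a b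
  proof (rule Bochner_Integration.integrable_bound)
    show "integrable lborel (\<lambda>x. C * N * indicator (box a b) x)" by (intro integrable_mult_right ib)
    show "AE x in lborel. norm (indicator (box a b) x *\<^sub>R F x) \<le> norm (C * N * indicator (box a b) x)"
      using FN C(1) N(1) by (intro always_eventually allI) (simp add: indicator_def)
  qed measurable
  have f_box_int: "integrable lborel (\<lambda>x. indicator (box a b) x *\<^sub>R f x)" for a b
  proof (rule Bochner_Integration.integrable_bound)
    show "integrable lborel (\<lambda>x. indicator (box a b) x + norm (f x) powr p)"
      by (intro Bochner_Integration.integrable_add ib f_int)
    show "AE x in lborel. norm (indicator (box a b) x *\<^sub>R f x) \<le> norm (indicator (box a b) x + norm (f x) powr p)"
    proof (intro always_eventually allI)
      fix x
      have "norm (f x) \<le> 1 + norm (f x) powr p" by (rule le_one_plus_powr[OF norm_ge_zero p])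
      then show "norm (indicator (box a b) x *\<^sub>R f x) \<le> norm (indicator (box a b) x + norm (f x) powr p)"
        by (simp add: indicator_def)
    qed
  qed measurable
  have box: "(LINT x|lborel. indicator (box a b) x *\<^sub>R f x) = (LINT x|lborel. indicator (box a b) x *\<^sub>R F x)" for a b :: "real^'n"
  proof (cases "\<forall>j. a $ j \<le> b $ j")
    case True
    then have ab: "a $ j \<le> b $ j" for j by simp
    define \<psi> where "\<psi> n = (\<lambda>j t. \<eta> ((1 / real (Suc n)) * t + 0) * theta (a $ j) (b $ j) t)" for n
    have fam: "test_family (\<psi> n)" for n
      unfolding \<psi>_def
      by (rule test_familyI[where R="\<lambda>_. real (Suc n) * 2"])
         (intro test_function1_mult' test_function1.test_function1_scale[OF tx] theta_smooth ab, simp)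
    have cut: "tpair (\<psi> n) = tpair (\<lambda>j t. \<phi> j t * \<psi> n j t)" for n
    proof (rule tpair_cutoff[OF fam \<phi>s])
      show "0 < e / 2" using e by simp
      show "\<phi> j t = 1" if "\<bar>t\<bar> < \<sigma> $ j + e / 2" for j t using that by (intro \<phi>1) simp
    qed
    \<comment> \<open>From here on \<open>\<eta>\<close>, which is 1 on the interval from -1 to 1,
      is 1 after dilation on the supports of all \<open>\<phi> j\<close> simultaneously.\<close>
    define n0 where "n0 = nat \<lceil>Max (range (\<lambda>j. \<sigma> $ j + e))\<rceil>"
    have ev: "tpair (\<psi> n) = tpair (\<lambda>j t. \<phi> j t * theta (a $ j) (b $ j) t)" if n: "n0 \<le> n" for n
    proof -
      have "\<phi> j t * \<psi> n j t = \<phi> j t * theta (a $ j) (b $ j) t" for j t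
      proof (cases "\<sigma> $ j + e \<le> \<bar>t\<bar>")
        case False
        have "\<sigma> $ j + e \<le> Max (range (\<lambda>j. \<sigma> $ j + e))" by (intro Max_ge) auto
        also have "\<dots> \<le> real n0" unfolding n0_def by (rule real_nat_ceiling_ge)
        also have "\<dots> \<le> real (Suc n)" using n by simp
        finally have "\<bar>t\<bar> \<le> real (Suc n)" using False by simp
        then have "\<bar>(1 / real (Suc n)) * t + 0\<bar> \<le> 1" by (simp add: abs_mult del: of_nat_Suc)
        then show ?thesis unfolding \<psi>_def by (simp only: \<eta>(2) mult_1_left)
      qed (simp add: \<phi>0)
      then have "(\<lambda>j t. \<phi> j t * \<psi> n j t) = (\<lambda>j t. \<phi> j t * theta (a $ j) (b $ j) t)" by (intro ext)
      then show ?thesis unfolding cut by (rule arg_cong)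
    qed
    have "(\<lambda>n. tpair (\<psi> n)) \<longlonglongrightarrow> tpair (\<lambda>j t. \<phi> j t * theta (a $ j) (b $ j) t)"
      by (rule tendsto_eventually) (use ev in \<open>auto simp: eventually_sequentially\<close>)
    moreover have "(\<lambda>n. tpair (\<psi> n)) \<longlonglongrightarrow> (LINT x|lborel. f x * ((2 * pi) ^ CARD('n) * indicator (box a b) x))"
      unfolding \<psi>_def by (rule tpair_box_limit[OF tx _ ab]) (simp add: \<eta>(2))
    ultimately have "(LINT x|lborel. f x * ((2 * pi) ^ CARD('n) * indicator (box a b) x)) = tpair (\<lambda>j t. \<phi> j t * theta (a $ j) (b $ j) t)"
      by (rule LIMSEQ_unique[rotated])
    also have "\<dots> = (LINT s|lborel. indicator (box a b) s *\<^sub>R kernel_integral f \<kappa>0 (complex_vec s))"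
      unfolding \<kappa>0_def by (rule tpair_box_swap[where R="\<lambda>j. \<sigma> $ j + e"]) (rule tf)
    also have "\<dots> = (2 * pi) ^ CARD('n) * (LINT s|lborel. indicator (box a b) s *\<^sub>R F s)"
      unfolding kk F_def by (simp flip: integral_mult_right_zero mult_scaleR_right)
    finally have "(LINT x|lborel. f x * ((2 * pi) ^ CARD('n) * indicator (box a b) x)) = (2 * pi) ^ CARD('n) * (LINT s|lborel. indicator (box a b) s *\<^sub>R F s)" .
    moreover have "(LINT x|lborel. f x * ((2 * pi) ^ CARD('n) * indicator (box a b) x)) = (2 * pi) ^ CARD('n) * (LINT x|lborel. indicator (box a b) x *\<^sub>R f x)"
      unfolding integral_mult_right_zero[symmetric]
      by (rule Bochner_Integration.integral_cong[OF refl]) (simp add: indicator_def)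
    ultimately show ?thesis by simp
  next
    case False
    then have "box a b = {}" by (auto simp: mem_box_cart) (metis less_trans not_less_iff_gr_or_eq le_less)
    then show ?thesis by simp
  qed
  have "AE x in lborel. f x - F x = 0"
  proof (rule AE_zero_if_box_integrals_zero)
    show "integrable lborel (\<lambda>x. indicator (box a b) x *\<^sub>R (f x - F x))" for a b
      unfolding scaleR_diff_right by (intro Bochner_Integration.integrable_diff f_box_int iF)
    show "(LINT x|lborel. indicator (box a b) x *\<^sub>R (f x - F x)) = 0" for a b
      unfolding scaleR_diff_right using Bochner_Integration.integral_diff[OF f_box_int iF] box by simp
  qed
  then have "AE x in lborel. kernel_integral f \<kappa> (complex_vec x) = f x" by eventually_elim (simp add: F_def)
  then show ?thesis using gk by (intro exI[of _ \<kappa>]) simp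
qed

end

lemma complex_ex_borel_measurable:
  fixes g :: "'a \<Rightarrow> complex"
  assumes g: "g \<in> borel_measurable (completion M)"
  obtains g' where "g' \<in> borel_measurable M" "AE x in M. g x = g' x"
proof -
  have "(\<lambda>x. Re (g x)) \<in> borel_measurable (completion M)" "(\<lambda>x. Im (g x)) \<in> borel_measurable (completion M)"
    using g by (auto intro: borel_measurable_Re borel_measurable_Im)
  from this[THEN completion_ex_borel_measurable_real]
  obtain r i where r: "r \<in> borel_measurable M" "AE x in M. Re (g x) = r x"
    and i: "i \<in> borel_measurable M" "AE x in M. Im (g x) = i x" by blast
  have "(\<lambda>x. Complex (r x) (i x)) \<in> borel_measurable M"
    unfolding Complex_eq using r i by measurable
  moreover have "AE x in M. g x = Complex (r x) (i x)"
    using r(2) i(2) by eventually_elim (simp add: complex_eq_iff)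
  ultimately show ?thesis by (rule that)
qed

theorem theorem1p1:
  fixes \<sigma> :: "real^'n" and p :: real and f :: "real^'n \<Rightarrow> complex"
  assumes "\<And>j. 0 < \<sigma> $ j"
    and "1 \<le> p"
    and "f \<in> bernstein_space p \<sigma>"
  shows "(\<forall>z. ((\<lambda>u. sampling_term \<sigma> (entire_extension f) u z) has_sum entire_extension f z)
              (sampling_lattice \<sigma>)) \<and>
         converges_abs_uniformly_on (range complex_vec) (sampling_lattice \<sigma>)
           (sampling_term \<sigma> (entire_extension f)) (entire_extension f) \<and>
         (\<forall>K. compact K \<longrightarrow>
            converges_abs_uniformly_on K (sampling_lattice \<sigma>)
              (sampling_term \<sigma> (entire_extension f)) (entire_extension f))"
proof -
  have f: "f \<in> borel_measurable lebesgue" "integrable lebesgue (\<lambda>x. norm (f x) powr p)" "spectrum f \<subseteq> box_Q \<sigma>"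
    using assms(3) by (auto simp: bernstein_space_def L_space_def)
  \<comment> \<open>All integrals are computed with this Borel version; the spectrum remains that of
    \<open>f\<close>.\<close>
  obtain g where g: "g \<in> borel_measurable lborel" "AE x in lborel. f x = g x"
    using complex_ex_borel_measurable[OF f(1)] by blast
  have gb [measurable]: "g \<in> borel_measurable borel" using g(1) by simp
  have gp: "(\<lambda>x. norm (g x) powr p) \<in> borel_measurable lborel" by measurable
  have fp: "(\<lambda>x. norm (f x) powr p) \<in> borel_measurable lebesgue" using f(2) by (rule borel_measurable_integrable)
  have "AE x in lebesgue. norm (f x) powr p = norm (g x) powr p"
    using AE_completion[OF g(2)] by (auto elim: eventually_mono)
  then have "integrable lebesgue (\<lambda>x. norm (g x) powr p)"
    using integrable_cong_AE[OF fp measurable_completion[OF gp]] f(2) by blast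
  then have "integrable lborel (\<lambda>x. norm (g x) powr p)"
    using integrable_completion[OF gp] by blast
  then interpret S: spectral g p \<sigma> f
    using assms(1,2) gb f g(2) by unfold_locales auto
  obtain \<kappa> where \<kappa>: "\<And>j. exp_kernel (\<sigma> $ j + 1) (\<kappa> j)" "AE x in lborel. kernel_integral g \<kappa> (complex_vec x) = g x"
    using S.representation[OF zero_less_one] by blast
  have R: "0 \<le> \<sigma> $ j + e" if "0 < e" for j e using assms(1)[of j] that by simp
  have ent: "entire (kernel_integral g \<kappa>')" if "\<And>j. exp_kernel (\<sigma> $ j + e) (\<kappa>' j)" "0 < e" for \<kappa>' e
    by (rule S.kernel_integral_entire[where R="\<lambda>j. \<sigma> $ j + e" and \<kappa>=\<kappa>', OF that(1) R[OF that(2)]])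
  define F where "F = kernel_integral g \<kappa>"
  have entF: "entire F" unfolding F_def using \<kappa>(1) by (rule ent) simp
  \<comment> \<open>\<open>F\<close> is built with margin 1. For any other margin \<open>e\<close>
    the kernels differ, but the kernel integral agrees with \<open>F\<close> almost everywhere on
    the real subspace and hence everywhere.\<close>
  interpret T: sampling g p \<sigma> F
  proof
    fix e :: real assume e: "0 < e"
    obtain \<kappa>' where \<kappa>': "\<forall>j. exp_kernel (\<sigma> $ j + e) (\<kappa>' j)" "AE x in lborel. kernel_integral g \<kappa>' (complex_vec x) = g x"
      using S.representation[OF e] by blast
    have "AE x in lborel. F (complex_vec x) = kernel_integral g \<kappa>' (complex_vec x)"
      unfolding F_def using \<kappa>(2) \<kappa>'(2) by eventually_elim simp
    then have "AE x in lebesgue. F (complex_vec x) = kernel_integral g \<kappa>' (complex_vec x)"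
      by (rule AE_completion)
    then have "F = kernel_integral g \<kappa>'"
      using entire_eq[OF entF ent[OF \<kappa>'(1)[rule_format] e]] by simp
    then show "\<exists>\<kappa>. (\<forall>j. exp_kernel (\<sigma> $ j + e) (\<kappa> j)) \<and> F = kernel_integral g \<kappa>" using \<kappa>'(1) by (intro exI conjI)
  qed (rule assms(1))
  have "AE x in lborel. F (complex_vec x) = f x"
    unfolding F_def using \<kappa>(2) g(2) by eventually_elim simp
  then have "AE x in lebesgue. F (complex_vec x) = f x" by (rule AE_completion)
  then have "entire_extension f = F" by (rule entire_extension_eqI[OF entF])
  then show ?thesis using T.sampling_conclusion by simp
qed

end
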